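(* Let $\mathfrak D=(X,U,\mathbb K,\mathsf T)$ be a continuous cdt-MP and let $S\subseteq X$ be compact. Then the following statements are equivalent: (i) $m(S)<\infty$; (ii) the operator ${}_S\mathsf T^*$ has a unique fixpoint in $\mathrm b\mathcal A^*(S)$; (iii) $\mathsf M^*(x;\square S)=0$ for all $x\in X$; (iv) $S_\infty=\emptyset$.
   Context: A Borel space is a topological space homeomorphic to a Borel subset of a complete separable metric space. A cdt-MP is a tuple $\mathfrak D=(X,U,\mathbb K,\mathsf T)$ with $X,U$ non-empty Borel spaces, $\mathbb K\subseteq X\times U$ an analytic set such that $\mathbb K_x:=\{u\in U:(x,u)\in\mathbb K\}\neq\emptyset$ for all $x\in X$, and $\mathsf T(\cdot|x,u)$ a Borel measurable stochastic kernel on $X$ given $X\times U$. It is continuous if $U$ is compact, $\mathbb K$ is closed in $X\times U$, and the restriction $\mathsf T|_{\mathbb K}:\mathbb K\to\mathcal P(X)$ is continuous, where $\mathcal P(X)$ (Borel probability measures on $X$) has the topology of weak convergence. The path space is $H=(X\times U)^{\mathbb N_0}$ and $H_n=(X\times U)^n\times X$ is the space of histories $h_n=(x_0,u_0,\dots,u_{n-1},x_n)$. A policy is a sequence $\pi=(\pi_n)_{n\ge0}$ of universally measurable stochastic kernels $\pi_n$ on $U$ given $H_n$ with $\pi_n(\mathbb K_{x_n}|h_n)=1$ for all $h_n$; $\Pi$ is the set of all policies. $\mathsf P^\pi_x$ is the unique probability measure on $H$ under which $x_0=x$, the conditional law of $u_n$ given $h_n$ is $\pi_n(\cdot|h_n)$,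 and the conditional law of $x_{n+1}$ given $(h_n,u_n)$ is $\mathsf T(\cdot|x_n,u_n)$. For an event $A$: $\mathsf M^*(x;A)=\sup_{\pi\in\Pi}\mathsf P^\pi_x(A)$. For $n\in\mathbb N_0\cup\{\infty\}$, $\square^nS$ is the event that $x_k\in S$ for all finite $k\le n$; $\square S:=\square^\infty S$. For $n\in\mathbb N_0$: $\beta_n(S)=\sup_{x\in X}\mathsf M^*(x;\square^nS)$ and $m(S)=\inf\{n\in\mathbb N_0:\beta_n(S)<1\}\in\mathbb N_0\cup\{\infty\}$. $S_n=\{x\in X:\mathsf M^*(x;\square^nS)=1\}$ and $S_\infty=\bigcap_{n\in\mathbb N_0}S_n$. $\mathrm b\mathcal A^*(S)$ is the set of bounded upper semi-analytic functions on $S$ ($\{f>c\}$ is analytic for every $c\in\mathbb R$), and ${}_S\mathsf T^*f(x)=\sup_{u\in\mathbb K_x}\int_Sf(x')\mathsf T(dx'|x,u)$ for $f\in\mathrm b\mathcal A^*(S)$, $x\in S$. *)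

theory Defs
  imports "HOL-Probability.Probability"
begin

definition borel_of :: "'a topology \<Rightarrow> 'a measure" where
  "borel_of X = sigma (topspace X) {V. openin X V}"

(* A separable metric space has at most the cardinality of the continuum, so up to isometry every
   complete separable metric space has its points in the type real; the metric m is arbitrary and
   unrelated to the usual metric of the reals. *)
definition borel_space :: "'a topology \<Rightarrow> bool" where
  "borel_space X \<longleftrightarrow>
     (\<exists>(m :: real metric) B. mcomplete_of m \<and> separable_space (mtopology_of m) \<and>
        B \<in> sets (borel_of (mtopology_of m)) \<and>
        X homeomorphic_space subtopology (mtopology_of m) B)"

(* Analytic sets are the continuous images of Borel spaces. As above, letting the Borel space Y
   range over topologies on subsets of the type real is no loss of generality. *)
definition analytic_in :: "'a topology \<Rightarrow> 'a set \<Rightarrow> bool" where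
  "analytic_in X A \<longleftrightarrow>
     (\<exists>(Y :: real topology) f. borel_space Y \<and> continuous_map Y X f \<and> A = f ` topspace Y)"

definition universal_completion :: "'a measure \<Rightarrow> 'a measure" where
  "universal_completion M =
     sigma (space M) {A \<in> Pow (space M). \<forall>\<mu> \<in> space (prob_algebra M). A \<in> sets (completion \<mu>)}"

(* The sets of universal completion already form a sigma-algebra. *)
lemma space_universal_completion: "space (universal_completion M) = space M"
  unfolding universal_completion_def by (rule space_measure_of) auto

lemma sets_universal_completion:
  "sets (universal_completion M) =
     {A \<in> Pow (space M). \<forall>\<mu> \<in> space (prob_algebra M). A \<in> sets (completion \<mu>)}"
proof -
  let ?U = "{A \<in> Pow (space M). \<forall>\<mu> \<in> space (prob_algebra M). A \<in> sets (completion \<mu>)}"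
  have sp: "space (completion \<mu>) = space M" if "\<mu> \<in> space (prob_algebra M)" for \<mu>
    using that sets_eq_imp_space_eq[of \<mu> M] by (simp add: space_prob_algebra)
  have "sigma_algebra (space M) ?U"
    unfolding sigma_algebra_iff2
  proof (intro conjI ballI allI impI)
    fix A assume A: "A \<in> ?U"
    have "space M - A \<in> sets (completion \<mu>)" if "\<mu> \<in> space (prob_algebra M)" for \<mu>
      using A that sets.compl_sets[of A "completion \<mu>"] sp[OF that] by auto
    then show "space M - A \<in> ?U" by auto
  next
    fix A :: "nat \<Rightarrow> 'a set" assume A: "range A \<subseteq> ?U"
    have "(\<Union>i. A i) \<in> sets (completion \<mu>)" if "\<mu> \<in> space (prob_algebra M)" for \<mu>
      using A that by (intro sets.countable_UN) blast
    then show "(\<Union>i. A i) \<in> ?U" using A by blast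
  qed auto
  then show ?thesis
    unfolding universal_completion_def by (rule sigma_algebra.sets_measure_of_eq)
qed

(* The topology of weak convergence on the Borel probability measures on X. *)
definition weak_topology :: "'a topology \<Rightarrow> 'a measure topology" where
  "weak_topology X = topology_generated_by
     {{\<mu> \<in> space (prob_algebra (borel_of X)). (\<integral>x. f x \<partial>\<mu>) \<in> V} | (f :: 'a \<Rightarrow> real) V.
        continuous_map X euclideanreal f \<and> bounded (f ` topspace X) \<and> open V}"

record ('x, 'u) cdt_mp =
  state_sp :: "'x topology"
  ctrl_sp :: "'u topology"
  feasible :: "('x \<times> 'u) set"
  trans_kernel :: "'x \<times> 'u \<Rightarrow> 'x measure"

abbreviation states :: "('x, 'u) cdt_mp \<Rightarrow> 'x set" where
  "states D \<equiv> topspace (state_sp D)"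

abbreviation state_M :: "('x, 'u) cdt_mp \<Rightarrow> 'x measure" where
  "state_M D \<equiv> borel_of (state_sp D)"

abbreviation ctrl_M :: "('x, 'u) cdt_mp \<Rightarrow> 'u measure" where
  "ctrl_M D \<equiv> borel_of (ctrl_sp D)"

definition feasible_at :: "('x, 'u) cdt_mp \<Rightarrow> 'x \<Rightarrow> 'u set" where
  "feasible_at D x = {u \<in> topspace (ctrl_sp D). (x, u) \<in> feasible D}"

(* Borel spaces are second countable, so here and below the product sigma-algebras are the Borel
   sigma-algebras of the (finite or countable) product topologies. *)
definition is_cdt_mp :: "('x, 'u) cdt_mp \<Rightarrow> bool" where
  "is_cdt_mp D \<longleftrightarrow>
     borel_space (state_sp D) \<and> states D \<noteq> {} \<and>
     borel_space (ctrl_sp D) \<and> topspace (ctrl_sp D) \<noteq> {} \<and>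
     feasible D \<subseteq> states D \<times> topspace (ctrl_sp D) \<and>
     analytic_in (prod_topology (state_sp D) (ctrl_sp D)) (feasible D) \<and>
     (\<forall>x \<in> states D. feasible_at D x \<noteq> {}) \<and>
     trans_kernel D \<in> state_M D \<Otimes>\<^sub>M ctrl_M D \<rightarrow>\<^sub>M prob_algebra (state_M D)"

definition continuous_cdt_mp :: "('x, 'u) cdt_mp \<Rightarrow> bool" where
  "continuous_cdt_mp D \<longleftrightarrow>
     is_cdt_mp D \<and>
     compact_space (ctrl_sp D) \<and>
     closedin (prod_topology (state_sp D) (ctrl_sp D)) (feasible D) \<and>
     continuous_map (subtopology (prod_topology (state_sp D) (ctrl_sp D)) (feasible D))
       (weak_topology (state_sp D)) (trans_kernel D)"

definition path_M :: "('x, 'u) cdt_mp \<Rightarrow> (nat \<Rightarrow> 'x \<times> 'u) measure" where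
  "path_M D = (\<Pi>\<^sub>M i \<in> UNIV. state_M D \<Otimes>\<^sub>M ctrl_M D)"

definition hist_M :: "('x, 'u) cdt_mp \<Rightarrow> nat \<Rightarrow> ((nat \<Rightarrow> 'x \<times> 'u) \<times> 'x) measure" where
  "hist_M D n = (\<Pi>\<^sub>M i \<in> {..<n}. state_M D \<Otimes>\<^sub>M ctrl_M D) \<Otimes>\<^sub>M state_M D"

definition hist :: "nat \<Rightarrow> (nat \<Rightarrow> 'x \<times> 'u) \<Rightarrow> (nat \<Rightarrow> 'x \<times> 'u) \<times> 'x" where
  "hist n \<omega> = (restrict \<omega> {..<n}, fst (\<omega> n))"

(* The completion only serves to measure sections of a feasible set that is merely analytic. *)
definition policies ::
  "('x, 'u) cdt_mp \<Rightarrow> (nat \<Rightarrow> (nat \<Rightarrow> 'x \<times> 'u) \<times> 'x \<Rightarrow> 'u measure) set" where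
  "policies D = {\<pi>. \<forall>n.
     \<pi> n \<in> universal_completion (hist_M D n) \<rightarrow>\<^sub>M prob_algebra (ctrl_M D) \<and>
     (\<forall>h \<in> space (hist_M D n). emeasure (completion (\<pi> n h)) (feasible_at D (snd h)) = 1)}"

(* The last two clauses are the defining identities of the regular conditional laws of u_n given
   h_n and of x_(n+1) given (h_n, u_n). The first of them integrates against the completion of P
   because the policy kernels are only universally measurable. *)
definition is_path_law ::
  "('x, 'u) cdt_mp \<Rightarrow> (nat \<Rightarrow> (nat \<Rightarrow> 'x \<times> 'u) \<times> 'x \<Rightarrow> 'u measure) \<Rightarrow> 'x \<Rightarrow>
     (nat \<Rightarrow> 'x \<times> 'u) measure \<Rightarrow> bool" where
  "is_path_law D \<pi> x P \<longleftrightarrow>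
     prob_space P \<and> sets P = sets (path_M D) \<and>
     (AE \<omega> in P. fst (\<omega> 0) = x) \<and>
     (\<forall>n. \<forall>A \<in> sets (hist_M D n). \<forall>B \<in> sets (ctrl_M D).
        emeasure P {\<omega> \<in> space P. hist n \<omega> \<in> A \<and> snd (\<omega> n) \<in> B} =
        (\<integral>\<^sup>+\<omega>. emeasure (\<pi> n (hist n \<omega>)) B * indicator A (hist n \<omega>) \<partial>completion P)) \<and>
     (\<forall>n. \<forall>A \<in> sets (hist_M D n \<Otimes>\<^sub>M ctrl_M D). \<forall>B \<in> sets (state_M D).
        emeasure P {\<omega> \<in> space P. (hist n \<omega>, snd (\<omega> n)) \<in> A \<and> fst (\<omega> (Suc n)) \<in> B} =
        (\<integral>\<^sup>+\<omega>. emeasure (trans_kernel D (\<omega> n)) B * indicator A (hist n \<omega>, snd (\<omega> n)) \<partial>P))"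

definition path_law ::
  "('x, 'u) cdt_mp \<Rightarrow> (nat \<Rightarrow> (nat \<Rightarrow> 'x \<times> 'u) \<times> 'x \<Rightarrow> 'u measure) \<Rightarrow> 'x \<Rightarrow>
     (nat \<Rightarrow> 'x \<times> 'u) measure" where
  "path_law D \<pi> x = (THE P. is_path_law D \<pi> x P)"

definition max_prob :: "('x, 'u) cdt_mp \<Rightarrow> 'x \<Rightarrow> (nat \<Rightarrow> 'x \<times> 'u) set \<Rightarrow> real" where
  "max_prob D x A = (SUP \<pi> \<in> policies D. measure (path_law D \<pi> x) A)"

definition safe :: "('x, 'u) cdt_mp \<Rightarrow> enat \<Rightarrow> 'x set \<Rightarrow> (nat \<Rightarrow> 'x \<times> 'u) set" where
  "safe D n S = {\<omega> \<in> space (path_M D). \<forall>k. enat k \<le> n \<longrightarrow> fst (\<omega> k) \<in> S}"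

definition safe_bound :: "('x, 'u) cdt_mp \<Rightarrow> nat \<Rightarrow> 'x set \<Rightarrow> real" where
  "safe_bound D n S = (SUP x \<in> states D. max_prob D x (safe D (enat n) S))"

(* The infimum of the empty set in enat is infinity. *)
definition safe_index :: "('x, 'u) cdt_mp \<Rightarrow> 'x set \<Rightarrow> enat" where
  "safe_index D S = Inf {enat n | n. safe_bound D n S < 1}"

definition sure_set :: "('x, 'u) cdt_mp \<Rightarrow> nat \<Rightarrow> 'x set \<Rightarrow> 'x set" where
  "sure_set D n S = {x \<in> states D. max_prob D x (safe D (enat n) S) = 1}"

definition sure_set_inf :: "('x, 'u) cdt_mp \<Rightarrow> 'x set \<Rightarrow> 'x set" where
  "sure_set_inf D S = (\<Inter>n. sure_set D n S)"

(* Functions on S are represented as extensional functions, so that equality is equality on S. *)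
definition bounded_usa :: "'a topology \<Rightarrow> 'a set \<Rightarrow> ('a \<Rightarrow> real) set" where
  "bounded_usa X S = {f \<in> extensional S. bounded (f ` S) \<and>
     (\<forall>c. analytic_in (subtopology X S) {x \<in> S. f x > c})}"

(* Upper semi-analytic functions are universally measurable, but not Borel measurable in general,
   hence the completion. *)
definition safe_op :: "('x, 'u) cdt_mp \<Rightarrow> 'x set \<Rightarrow> ('x \<Rightarrow> real) \<Rightarrow> 'x \<Rightarrow> real" where
  "safe_op D S f = (\<lambda>x \<in> S. SUP u \<in> feasible_at D x.
     (LINT x' : S | completion (trans_kernel D (x, u)). f x'))"

end

theory Submission
  imports Defs
begin

text \<open>
Let \<open>v\<^sub>0\<close> be the indicator of \<open>S\<close>, and let \<open>v\<^sub>n\<^sub>+\<^sub>1(x)\<close> be the supremum over the feasible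
controls \<open>u\<close> of \<open>\<integral> v\<^sub>n dT(\<cdot>|x,u)\<close> for \<open>x \<in> S\<close>, and \<open>0\<close> outside \<open>S\<close>. These functions decrease to
some \<open>v\<close> with values in \<open>[0,1]\<close>. Each of the four conditions is equivalent to the emptiness of
the trap \<open>{v \<ge> 1}\<close>, for the following reasons.

Continuity and compactness enter through semicontinuity. If \<open>g\<close> is upper semicontinuous with values
in \<open>[0,1]\<close>, then so is \<open>(x,u) \<mapsto> \<integral> g dT(\<cdot>|x,u)\<close> on the feasible pairs (\<open>usc_on_weak_integral\<close>); as
the controls are compact, the supremum over \<open>u\<close> is attained and upper semicontinuous in \<open>x\<close>
(\<open>section_attains_max\<close>, \<open>usc_on_section_SUP\<close>). Hence all \<open>v\<^sub>n\<close> are upper semicontinuous, and since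
nested nonempty compact sets of near-optimal controls meet, the supremum commutes with the decreasing
limit, so that \<open>v\<close> is a fixpoint of the safety operator (\<open>bellman_val_inf\<close>). Moreover, if the trap
is empty, then the compact sets \<open>{v\<^sub>n \<ge> 1}\<close> shrink to the empty set, so some \<open>v\<^sub>n\<close> is bounded by a
constant \<open>c < 1\<close> (\<open>val_uniformly_less_1\<close>).

If a fixpoint \<open>f\<close> satisfies \<open>\<bar>f\<bar> \<le> R\<close> on \<open>S\<close>, then induction gives \<open>\<bar>f\<bar> \<le> R v\<^sub>n\<close> for all \<open>n\<close> and
so \<open>\<bar>f\<bar> \<le> R v\<close> (\<open>fixpoint_le_val_inf\<close>). If the trap is empty, this applies to \<open>v\<close> itself with
\<open>R = c < 1\<close>; it yields \<open>v \<le> c v\<close>, that is, \<open>v = 0\<close>, and then every bounded fixpoint is \<open>0\<close>. Since no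
policy can remain in \<open>S\<close> up to time \<open>n\<close> with probability above \<open>v\<^sub>n\<close> (\<open>prob_safe_le_val\<close>), the safe
bound of some \<open>n\<close> is at most \<open>c\<close> and the probability of remaining in \<open>S\<close> forever is \<open>0\<close>.

If the trap is nonempty, then \<open>v\<close> and \<open>0\<close> are different fixpoints. A control that maximises \<open>\<integral> v dT\<close>
at a trap state gives the integral the value \<open>1\<close>, so it moves the state into the trap almost surely.
A measurable choice of such controls (\<open>measurable_selection\<close>) is a stationary policy that remains in
the trap, hence in \<open>S\<close>, forever with probability \<open>1\<close> (\<open>max_prob_trap\<close>). All four conditions fail.

What remains is that the path law of a policy exists and is unique, although its kernels are only
universally measurable. Given the law of the history \<open>h\<^sub>n\<close>, the kernel of the policy agrees almost
surely with a Borel kernel (\<open>universal_completion_borel_modification\<close>); making these replacements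
successively reduces existence to the theorem of Ionescu-Tulcea (\<open>path_law_exists\<close>), and the same
replacement shows that the law of each history determines the law of the next (\<open>path_law_unique\<close>).
\<close>

section \<open>Borel sets of second countable and metrizable topologies\<close>

lemma space_borel_of [simp]: "space (borel_of X) = topspace X"
  unfolding borel_of_def by (rule space_measure_of) (auto dest: openin_subset)

lemma sets_borel_of: "sets (borel_of X) = sigma_sets (topspace X) {V. openin X V}"
  unfolding borel_of_def by (rule sets_measure_of) (auto dest: openin_subset)

lemma openin_sets_borel_of: "openin X V \<Longrightarrow> V \<in> sets (borel_of X)"
  by (simp add: sets_borel_of sigma_sets.Basic)

lemma closedin_sets_borel_of:
  assumes "closedin X C" shows "C \<in> sets (borel_of X)"
proof -
  have "space (borel_of X) - (topspace X - C) \<in> sets (borel_of X)"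
    using assms by (intro sets.compl_sets openin_sets_borel_of) (simp add: closedin_def)
  moreover have "space (borel_of X) - (topspace X - C) = C"
    using closedin_subset[OF assms] by auto
  ultimately show ?thesis by simp
qed

lemma second_countable_base:
  assumes "second_countable X"
  obtains B where "countable B" "\<And>V. V \<in> B \<Longrightarrow> openin X V"
    "\<And>W x. openin X W \<Longrightarrow> x \<in> W \<Longrightarrow> \<exists>V\<in>B. x \<in> V \<and> V \<subseteq> W"
proof -
  from assms obtain B where "countable B \<and> (\<forall>V\<in>B. openin X V) \<and>
      (\<forall>U x. openin X U \<and> x \<in> U \<longrightarrow> (\<exists>V\<in>B. x \<in> V \<and> V \<subseteq> U))"
    unfolding second_countable_def ..
  then show ?thesis by (intro that[of B]) simp_all
qed

text \<open>The finite intersections of the members of a countable base. Stability under intersection is what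
makes a measure, and the measurability of a kernel, depend on this generator only.\<close>

lemma second_countable_imp_countable_generator:
  assumes "second_countable X"
  obtains G where "countable G" "Int_stable G" "G \<subseteq> Pow (topspace X)"
    "sets (borel_of X) = sigma_sets (topspace X) G"
proof -
  obtain B where B: "countable B" "\<And>V. V \<in> B \<Longrightarrow> openin X V"
    and base: "\<And>W x. openin X W \<Longrightarrow> x \<in> W \<Longrightarrow> \<exists>V\<in>B. x \<in> V \<and> V \<subseteq> W"
    by (rule second_countable_base[OF assms]) (rule that; assumption)
  define G where "G = (\<lambda>F. topspace X \<inter> \<Inter>F) ` {F. finite F \<and> F \<subseteq> B}"
  have cG: "countable G"
    unfolding G_def using B(1) by (intro countable_image countable_Collect_finite_subset)
  have sG: "G \<subseteq> Pow (topspace X)" by (auto simp: G_def)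
  have iG: "Int_stable G"
    unfolding Int_stable_def G_def
  proof safe
    fix E F assume "finite E" "E \<subseteq> B" "finite F" "F \<subseteq> B"
    then show "topspace X \<inter> \<Inter>E \<inter> (topspace X \<inter> \<Inter>F)
        \<in> (\<lambda>F. topspace X \<inter> \<Inter>F) ` {F. finite F \<and> F \<subseteq> B}"
      by (intro image_eqI[of _ _ "E \<union> F"]) auto
  qed
  have BG: "B \<subseteq> G"
  proof
    fix V assume "V \<in> B"
    then show "V \<in> G" unfolding G_def
      using openin_subset[OF B(2)] by (intro image_eqI[of _ _ "{V}"]) auto
  qed
  have "openin X V" if "V \<in> G" for V
  proof -
    from that obtain F where F: "finite F" "F \<subseteq> B" "V = topspace X \<inter> \<Inter>F"
      unfolding G_def by blast
    show ?thesis
    proof (cases "F = {}")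
      case False
      with F B(2) have "openin X (\<Inter>F)" by (intro openin_Inter) auto
      then show ?thesis using F by auto
    qed (use F in auto)
  qed
  moreover have "V \<in> sigma_sets (topspace X) G" if "openin X V" for V
  proof -
    have "V = \<Union>{W \<in> B. W \<subseteq> V}" using base[OF that] by blast
    moreover have "\<Union>{W \<in> B. W \<subseteq> V} \<in> sigma_sets (topspace X) G"
      using B(1) BG by (intro sigma_sets_UNION) (auto intro: countable_subset[of _ B])
    ultimately show ?thesis by simp
  qed
  ultimately have "sigma_sets (topspace X) {V. openin X V} = sigma_sets (topspace X) G"
    by (intro antisym sigma_sets_mono) auto
  with cG sG iG that show ?thesis by (simp add: sets_borel_of)
qed

text \<open>An open set of the product is a union of open rectangles, and second countability makes countably
many of them suffice.\<close>

lemma openin_prod_sets_pair: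
  assumes "second_countable X" "second_countable Y" "openin (prod_topology X Y) W"
  shows "W \<in> sets (borel_of X \<Otimes>\<^sub>M borel_of Y)"
proof -
  obtain A where A: "countable A" "\<And>V. V \<in> A \<Longrightarrow> openin X V"
    and Ab: "\<And>W x. openin X W \<Longrightarrow> x \<in> W \<Longrightarrow> \<exists>V\<in>A. x \<in> V \<and> V \<subseteq> W"
    by (rule second_countable_base[OF assms(1)]) (rule that; assumption)
  obtain B where B: "countable B" "\<And>V. V \<in> B \<Longrightarrow> openin Y V"
    and Bb: "\<And>W x. openin Y W \<Longrightarrow> x \<in> W \<Longrightarrow> \<exists>V\<in>B. x \<in> V \<and> V \<subseteq> W"
    by (rule second_countable_base[OF assms(2)]) (rule that; assumption)
  let ?R = "{(U, V) \<in> A \<times> B. U \<times> V \<subseteq> W}"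
  have "W \<subseteq> (\<Union>(U, V) \<in> ?R. U \<times> V)"
  proof safe
    fix x y assume "(x, y) \<in> W"
    then obtain U V where UV: "openin X U" "openin Y V" "x \<in> U" "y \<in> V" "U \<times> V \<subseteq> W"
      using assms(3)[unfolded openin_prod_topology_alt, rule_format] by metis
    obtain U' where "U' \<in> A" "x \<in> U'" "U' \<subseteq> U"
      using Ab[OF UV(1,3)] by auto
    moreover obtain V' where "V' \<in> B" "y \<in> V'" "V' \<subseteq> V"
      using Bb[OF UV(2,4)] by auto
    ultimately show "(x, y) \<in> (\<Union>(U, V) \<in> ?R. U \<times> V)"
      using UV(5) by (intro UN_I[of "(U', V')"]) auto
  qed
  then have "W = (\<Union>(U, V) \<in> ?R. U \<times> V)" by (intro antisym) auto
  moreover have "countable ?R"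
    using A(1) B(1) by (intro countable_subset[of ?R "A \<times> B"]) auto
  then have "(\<Union>(U, V) \<in> ?R. U \<times> V) \<in> sets (borel_of X \<Otimes>\<^sub>M borel_of Y)"
    using A(2) B(2) by (intro sets.countable_UN') (auto intro!: pair_measureI openin_sets_borel_of)
  ultimately show ?thesis by simp
qed

lemma closedin_prod_sets_pair:
  assumes "second_countable X" "second_countable Y" "closedin (prod_topology X Y) C"
  shows "C \<in> sets (borel_of X \<Otimes>\<^sub>M borel_of Y)"
proof -
  have "topspace X \<times> topspace Y - C \<in> sets (borel_of X \<Otimes>\<^sub>M borel_of Y)"
    using assms by (intro openin_prod_sets_pair) (auto simp: closedin_def)
  then have "space (borel_of X \<Otimes>\<^sub>M borel_of Y) - (topspace X \<times> topspace Y - C)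
      \<in> sets (borel_of X \<Otimes>\<^sub>M borel_of Y)"
    by (rule sets.compl_sets)
  moreover have "C \<subseteq> topspace X \<times> topspace Y"
    using closedin_subset[OF assms(3)] by simp
  ultimately show ?thesis by (simp add: space_pair_measure double_diff)
qed

text \<open>The balls of radius \<open>1/(n+1)\<close> around the points of a countable dense set form a base.\<close>

lemma (in Metric_space) separable_imp_second_countable:
  assumes "separable_space mtopology"
  shows "second_countable mtopology"
proof -
  obtain C where C: "countable C" "C \<subseteq> M" "mtopology closure_of C = M"
    using assms by (auto simp: separable_space_def)
  let ?B = "(\<lambda>(c, n). mball c (1 / real (Suc n))) ` (C \<times> UNIV)"
  show ?thesis
    unfolding second_countable_def
  proof (intro exI[of _ ?B] conjI allI impI ballI)
    show "countable ?B" using C by auto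
    show "openin mtopology V" if "V \<in> ?B" for V using that by auto
    fix U x assume "openin mtopology U \<and> x \<in> U"
    then have U: "U \<subseteq> M" "\<forall>x. x \<in> U \<longrightarrow> (\<exists>r>0. mball x r \<subseteq> U)" "x \<in> U"
      by (auto simp: openin_mtopology)
    then obtain r where r: "r > 0" "mball x r \<subseteq> U" by blast
    have x: "x \<in> M" using U by blast
    obtain n where n: "1 / real (Suc n) < r / 2"
      using nat_approx_posE[of "r / 2"] r by auto
    have "x \<in> mtopology closure_of C" using C x by simp
    then have "\<forall>r>0. \<exists>y\<in>C. y \<in> mball x r"
      unfolding metric_closure_of by blast
    from this[rule_format, of "1 / real (Suc n)"]
    obtain c where c: "c \<in> C" "c \<in> mball x (1 / real (Suc n))"
      by auto
    have "mball c (1 / real (Suc n)) \<subseteq> mball x r"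
    proof
      fix y assume "y \<in> mball c (1 / real (Suc n))"
      then have "d x y < r" "y \<in> M"
        using c n triangle[of x c y] x by (auto simp: commute simp del: of_nat_Suc)
      then show "y \<in> mball x r" using x by simp
    qed
    moreover have "x \<in> mball c (1 / real (Suc n))"
      using c by (simp add: commute)
    moreover have "mball c (1 / real (Suc n)) \<in> ?B"
      using c(1) by (intro image_eqI[of _ _ "(c, n)"]) simp_all
    ultimately show "\<exists>V\<in>?B. x \<in> V \<and> V \<subseteq> U"
      using r(2) by (meson subset_trans)
  qed
qed

lemma borel_space_second_countable: "borel_space X \<Longrightarrow> second_countable X"
proof -
  assume "borel_space X"
  then obtain m :: "real metric" and B where m: "separable_space (mtopology_of m)"
      "X homeomorphic_space subtopology (mtopology_of m) B"
    unfolding borel_space_def by blast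
  have "second_countable (mtopology_of m)"
    using m(1) Metric_space.separable_imp_second_countable[OF Metric_space_mspace_mdist]
    by (simp add: mtopology_of_def)
  then show ?thesis
    using m(2) homeomorphic_space_second_countability second_countable_subtopology by blast
qed

lemma borel_space_metrizable: "borel_space X \<Longrightarrow> metrizable_space X"
proof -
  assume "borel_space X"
  then obtain m :: "real metric" and B where m: 
      "X homeomorphic_space subtopology (mtopology_of m) B"
    unfolding borel_space_def by blast
  have "metrizable_space (mtopology_of m)"
    by (simp add: Metric_space.metrizable_space_mtopology mtopology_of_def)
  then show ?thesis
    using m homeomorphic_metrizable_space metrizable_space_subtopology by blast
qed

text \<open>A homeomorphism from \<open>X\<close> onto a Borel subset of a complete separable metric space carries a Borel
set \<open>A\<close> to a Borel set. The latter is a Borel space, and the inverse homeomorphism is the required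
continuous parametrisation of \<open>A\<close>.\<close>

lemma borel_subset_analytic:
  assumes X: "borel_space X" and A: "A \<in> sets (borel_of X)" and AS: "A \<subseteq> S"
  shows "analytic_in (subtopology X S) A"
proof -
  obtain m :: "real metric" and B where m: "mcomplete_of m" "separable_space (mtopology_of m)"
    and B: "B \<in> sets (borel_of (mtopology_of m))"
    and hom: "X homeomorphic_space subtopology (mtopology_of m) B"
    using X unfolding borel_space_def by blast
  let ?T = "mtopology_of m"
  obtain h k where h: "continuous_map X (subtopology ?T B) h"
    and k: "continuous_map (subtopology ?T B) X k"
    and kh: "\<And>x. x \<in> topspace X \<Longrightarrow> k (h x) = x"
    and hk: "\<And>y. y \<in> topspace (subtopology ?T B) \<Longrightarrow> h (k y) = y"
    using hom unfolding homeomorphic_space_def homeomorphic_maps_def by blast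
  have Bsub: "B \<subseteq> topspace ?T" using sets.sets_into_space[OF B] by simp
  have Asub: "A \<subseteq> topspace X" using sets.sets_into_space[OF A] by simp
  have km: "k \<in> restrict_space (borel_of ?T) B \<rightarrow>\<^sub>M borel_of X"
  proof (rule measurable_sigma_sets[OF sets_borel_of])
    show "k \<in> space (restrict_space (borel_of ?T) B) \<rightarrow> topspace X"
      using continuous_map_funspace[OF k] by (auto simp: space_restrict_space)
    fix V assume "V \<in> {V. openin X V}"
    then have "openin (subtopology ?T B) {y \<in> topspace (subtopology ?T B). k y \<in> V}"
      using openin_continuous_map_preimage[OF k] by simp
    then obtain W where W: "openin ?T W" "{y \<in> topspace (subtopology ?T B). k y \<in> V} = W \<inter> B"
      by (auto simp: openin_subtopology)
    then have "k -` V \<inter> space (restrict_space (borel_of ?T) B) = W \<inter> B"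
      using Bsub by (auto simp: space_restrict_space)
    then show "k -` V \<inter> space (restrict_space (borel_of ?T) B) \<in> sets (restrict_space (borel_of ?T) B)"
      using W B by (auto simp: sets_restrict_space openin_sets_borel_of)
  qed (auto dest: openin_subset)
  have hA: "h ` A = k -` A \<inter> space (restrict_space (borel_of ?T) B)"
    using Asub Bsub continuous_map_funspace[OF h] kh hk
    by (force simp: space_restrict_space Pi_iff image_iff)
  then have "h ` A \<in> sets (restrict_space (borel_of ?T) B)"
    using measurable_sets[OF km A] by simp
  then have hA': "h ` A \<in> sets (borel_of ?T)" "h ` A \<subseteq> B"
    using B by (auto simp: sets_restrict_space)
  let ?Y = "subtopology ?T (h ` A)"
  have top: "topspace ?Y = h ` A" using hA'(2) Bsub by auto
  have "borel_space ?Y"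
    unfolding borel_space_def using m hA'(1) homeomorphic_space_refl by blast
  moreover have "continuous_map ?Y (subtopology X S) k"
  proof -
    have "continuous_map (subtopology (subtopology ?T B) (h ` A)) X k"
      using k by (rule continuous_map_from_subtopology)
    moreover have "subtopology (subtopology ?T B) (h ` A) = ?Y"
      using hA'(2) by (simp add: subtopology_subtopology inf.absorb2)
    ultimately show ?thesis
      using kh Asub AS top by (auto simp: continuous_map_in_subtopology subset_iff)
  qed
  moreover have "A = k ` topspace ?Y"
    unfolding top using kh Asub by (force simp: image_image)
  ultimately show ?thesis unfolding analytic_in_def by blast
qed

section \<open>Upper semicontinuous functions and weak convergence\<close>

definition usc_on :: "'a topology \<Rightarrow> ('a \<Rightarrow> real) \<Rightarrow> bool" where
  "usc_on X g \<longleftrightarrow> (\<forall>c. closedin X {x \<in> topspace X. c \<le> g x})"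

lemma usc_onD: "usc_on X g \<Longrightarrow> closedin X {x \<in> topspace X. c \<le> g x}"
  by (simp add: usc_on_def)

lemma usc_on_borel_measurable:
  assumes "usc_on X g" shows "g \<in> borel_measurable (borel_of X)"
  unfolding borel_measurable_iff_ge
  using closedin_sets_borel_of[OF usc_onD[OF assms]] by simp

lemma usc_on_compose:
  assumes "usc_on Z h" "continuous_map Y Z f" shows "usc_on Y (\<lambda>y. h (f y))"
  unfolding usc_on_def
proof
  fix c
  have "closedin Y {y \<in> topspace Y. f y \<in> {z \<in> topspace Z. c \<le> h z}}"
    by (rule closedin_continuous_map_preimage[OF assms(2) usc_onD[OF assms(1)]])
  moreover have "{y \<in> topspace Y. f y \<in> {z \<in> topspace Z. c \<le> h z}} = {y \<in> topspace Y. c \<le> h (f y)}"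
    using continuous_map_funspace[OF assms(2)] by auto
  ultimately show "closedin Y {y \<in> topspace Y. c \<le> h (f y)}" by simp
qed

lemma usc_on_limit:
  assumes "\<And>n. usc_on X (g n)"
    and "\<And>n x. x \<in> topspace X \<Longrightarrow> w x \<le> g n x"
    and "\<And>x. x \<in> topspace X \<Longrightarrow> (\<lambda>n. g n x) \<longlonglongrightarrow> w x"
  shows "usc_on X w"
  unfolding usc_on_def
proof
  fix c
  have "{x \<in> topspace X. c \<le> w x} = (\<Inter>n. {x \<in> topspace X. c \<le> g n x})"
  proof (intro antisym subsetI)
    fix x assume x: "x \<in> {x \<in> topspace X. c \<le> w x}"
    then have "c \<le> g n x" for n using assms(2)[of x n] by simp
    with x show "x \<in> (\<Inter>n. {x \<in> topspace X. c \<le> g n x})" by simp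
  next
    fix x assume x: "x \<in> (\<Inter>n. {x \<in> topspace X. c \<le> g n x})"
    then have *: "x \<in> topspace X" "\<And>n. c \<le> g n x" by auto
    have "c \<le> w x" by (rule LIMSEQ_le_const[OF assms(3)[OF *(1)]]) (simp add: *(2))
    with *(1) show "x \<in> {x \<in> topspace X. c \<le> w x}" by simp
  qed
  moreover have "closedin X (\<Inter>n. {x \<in> topspace X. c \<le> g n x})"
    using usc_onD[OF assms(1)] by (intro closedin_Inter) auto
  ultimately show "closedin X {x \<in> topspace X. c \<le> w x}" by simp
qed

text \<open>The superlevel sets at levels increasing to the supremum are nested nonempty compact sets; a common
point is a maximiser.\<close>

lemma usc_on_attains_max:
  assumes "compact_space Y" "topspace Y \<noteq> {}" "usc_on Y g"
    and bdd: "\<And>y. y \<in> topspace Y \<Longrightarrow> g y \<le> b"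
  obtains y where "y \<in> topspace Y" "\<And>z. z \<in> topspace Y \<Longrightarrow> g z \<le> g y"
proof -
  define s where "s = (SUP y \<in> topspace Y. g y)"
  have bd: "bdd_above (g ` topspace Y)" using bdd by (auto intro!: bdd_aboveI)
  let ?C = "\<lambda>n::nat. {y \<in> topspace Y. s - 1 / real (Suc n) \<le> g y}"
  have "(\<Inter>n. ?C n) \<noteq> {}"
  proof (rule compact_space_imp_nest[OF assms(1)])
    show "closedin Y (?C n)" for n using assms(3) by (rule usc_onD)
    show "?C n \<noteq> {}" for n
    proof -
      have "s - 1 / real (Suc n) < s" by simp
      then obtain y where "y \<in> topspace Y" "s - 1 / real (Suc n) < g y"
        unfolding s_def using less_cSUP_iff[OF assms(2) bd] by blast
      then show ?thesis by (auto intro: less_imp_le)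
    qed
    show "decseq ?C"
      unfolding decseq_def
    proof safe
      fix m n :: nat and y assume "m \<le> n" and y: "s - 1 / real (Suc n) \<le> g y"
      then have "1 / real (Suc n) \<le> 1 / real (Suc m)" by (intro divide_left_mono) auto
      with y show "s - 1 / real (Suc m) \<le> g y" by linarith
    qed
  qed
  then obtain y where y: "y \<in> topspace Y" "\<And>n. s - 1 / real (Suc n) \<le> g y" by auto
  have "(\<lambda>n. s - 1 / real (Suc n)) \<longlonglongrightarrow> s - 0"
    by (intro tendsto_intros lim_inverse_n' filterlim_compose[OF lim_inverse_n' filterlim_Suc])
  then have "s - 0 \<le> g y" using y(2) by (intro LIMSEQ_le_const2) auto
  moreover have "g z \<le> s" if "z \<in> topspace Y" for z
    unfolding s_def using that bd by (rule cSUP_upper)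
  ultimately show ?thesis using that y(1) by fastforce
qed

text \<open>For a compatible metric \<open>d\<close>, the sup-convolution \<open>\<phi>\<^sub>n(x) = sup\<^sub>y (g(y) - n d(x,y))\<close> is
\<open>n\<close>-Lipschitz and dominates \<open>g\<close>. For large \<open>n\<close> the penalty excludes every \<open>y\<close> outside a small ball
around \<open>x\<close>, where upper semicontinuity bounds \<open>g(y)\<close> by \<open>g(x)\<close> up to a small error.\<close>

lemma usc_on_continuous_approx:
  fixes g :: "'a \<Rightarrow> real"
  assumes met: "metrizable_space X" and usc: "usc_on X g"
    and g: "\<And>x. x \<in> topspace X \<Longrightarrow> 0 \<le> g x \<and> g x \<le> 1"
  obtains \<phi> where "\<And>n. continuous_map X euclideanreal (\<phi> n)"
    "\<And>n x. x \<in> topspace X \<Longrightarrow> g x \<le> \<phi> n x \<and> \<phi> n x \<le> 1"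
    "\<And>x. x \<in> topspace X \<Longrightarrow> (\<lambda>n. \<phi> n x) \<longlonglongrightarrow> g x"
proof -
  obtain M d where M: "Metric_space M d" and X: "X = Metric_space.mtopology M d"
    using met unfolding metrizable_space_def by blast
  interpret Metric_space M d by (rule M)
  have top: "topspace X = M" by (simp add: X)
  define \<phi> :: "nat \<Rightarrow> 'a \<Rightarrow> real" where "\<phi> n x = (SUP y \<in> M. g y - real n * d x y)" for n x
  have up: "g y - real n * d x y \<le> 1" if "y \<in> M" for n x y
  proof -
    have "g y \<le> 1" "0 \<le> real n * d x y" using g[of y] that by (simp_all add: top)
    then show ?thesis by linarith
  qed
  have bdd: "bdd_above ((\<lambda>y. g y - real n * d x y) ` M)" for n x
    using up by (auto intro!: bdd_aboveI[of _ 1])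
  have ge: "g y - real n * d x y \<le> \<phi> n x" if "y \<in> M" for n x y
    unfolding \<phi>_def using that bdd by (rule cSUP_upper)
  have le: "\<phi> n x \<le> c" if "\<And>y. y \<in> M \<Longrightarrow> g y - real n * d x y \<le> c" "x \<in> M" for n x c
    unfolding \<phi>_def using that by (intro cSUP_least) auto
  have lo: "g x \<le> \<phi> n x" if "x \<in> M" for n x
    using ge[OF that, of n x] that by simp
  have "continuous_map X euclideanreal (\<phi> n)" for n
  proof -
    have lip: "\<phi> n x - \<phi> n y \<le> real n * d x y" if "x \<in> M" "y \<in> M" for x y
    proof -
      have "\<phi> n x \<le> \<phi> n y + real n * d x y"
      proof (rule le)
        fix z assume z: "z \<in> M"
        have "real n * d y z \<le> real n * (d x y + d x z)"
          using triangle[OF that(2,1) z] by (intro mult_left_mono) (auto simp: commute)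
        then show "g z - real n * d x z \<le> \<phi> n y + real n * d x y"
          using ge[OF z, of n y] by (simp add: algebra_simps)
      qed (use that in auto)
      then show ?thesis by simp
    qed
    have "Lipschitz_continuous_map (metric (M, d)) euclidean_metric (\<phi> n)"
      unfolding Lipschitz_continuous_map_def
    proof (intro conjI exI ballI)
      fix x y assume xy: "x \<in> mspace (metric (M, d))" "y \<in> mspace (metric (M, d))"
      then have "\<bar>\<phi> n x - \<phi> n y\<bar> \<le> real n * d x y"
        using lip[of x y] lip[of y x] by (auto simp: commute abs_le_iff)
      then show "mdist euclidean_metric (\<phi> n x) (\<phi> n y) \<le> real n * mdist (metric (M, d)) x y"
        by (simp add: dist_real_def)
    qed simp
    from Lipschitz_continuous_imp_continuous_map[OF this] show ?thesis
      by (simp add: X mtopology_of_def)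
  qed
  moreover have "\<phi> n x \<le> 1" if "x \<in> topspace X" for n x
    using that by (intro le up) (auto simp: top)
  moreover have "(\<lambda>n. \<phi> n x) \<longlonglongrightarrow> g x" if "x \<in> topspace X" for x
  proof (rule LIMSEQ_I)
    fix e :: real assume e: "e > 0"
    have x: "x \<in> M" using that top by simp
    have "openin X (topspace X - {y \<in> topspace X. g x + e / 2 \<le> g y})"
      using usc_onD[OF usc] by (simp add: closedin_def)
    moreover have "x \<in> topspace X - {y \<in> topspace X. g x + e / 2 \<le> g y}"
      using that e by auto
    ultimately obtain r where r: "r > 0"
      "mball x r \<subseteq> topspace X - {y \<in> topspace X. g x + e / 2 \<le> g y}"
      unfolding X openin_mtopology by blast
    \<comment> \<open>For \<open>n \<ge> N\<close>, the penalty outside the ball of radius r exceeds 1, hence the oscillation of g.\<close>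
    obtain N :: nat where N: "1 / r < real N" using reals_Archimedean2 by blast
    have "\<phi> n x \<le> g x + e / 2" if n: "n \<ge> N" for n
    proof (rule le[OF _ x])
      fix y assume y: "y \<in> M"
      show "g y - real n * d x y \<le> g x + e / 2"
      proof (cases "d x y < r")
        case True
        then have "g y < g x + e / 2" using r(2) x y by (auto simp: top subset_iff)
        moreover have "0 \<le> real n * d x y" by simp
        ultimately show ?thesis by linarith
      next
        case False
        have "1 < real N * r" using N r(1) by (simp add: field_simps)
        also have "\<dots> \<le> real n * d x y" using False n r by (intro mult_mono) auto
        finally have "1 < real n * d x y" .
        moreover have "0 \<le> g x" "g y \<le> 1" using g[of x] g[of y] x y by (simp_all add: top)
        ultimately show ?thesis using e by linarith
      qed
    qed
    then have "norm (\<phi> n x - g x) < e" if "n \<ge> N" for n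
      using lo[OF x, of n] e that unfolding real_norm_def by fastforce
    then show "\<exists>N. \<forall>n\<ge>N. norm (\<phi> n x - g x) < e" by blast
  qed
  ultimately show ?thesis using that[of \<phi>] lo top by auto
qed

lemma topspace_weak_topology_subset:
  "topspace (weak_topology X) \<subseteq> space (prob_algebra (borel_of X))"
  unfolding weak_topology_def topology_generated_by_topspace by auto

text \<open>The integrals of bounded continuous functions are continuous in the weak topology; only upper
semicontinuity is recorded, as it survives the passage to decreasing limits.\<close>

lemma usc_on_weak_integral_continuous:
  assumes \<kappa>: "continuous_map Z (weak_topology X) \<kappa>"
    and f: "continuous_map X euclideanreal f" "bounded (f ` topspace X)"
  shows "usc_on Z (\<lambda>z. \<integral>x. f x \<partial>\<kappa> z)"
  unfolding usc_on_def
proof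
  fix c :: real
  let ?O = "{\<mu> \<in> space (prob_algebra (borel_of X)). (\<integral>x. f x \<partial>\<mu>) \<in> {..<c}}"
  have "openin (weak_topology X) ?O"
    unfolding weak_topology_def using f
    by (intro topology_generated_by_Basis CollectI exI[of _ f] exI[of _ "{..<c}"]) simp
  then have "openin Z {z \<in> topspace Z. \<kappa> z \<in> ?O}"
    using \<kappa> by (intro openin_continuous_map_preimage)
  moreover have "{z \<in> topspace Z. \<kappa> z \<in> ?O} = topspace Z - {z \<in> topspace Z. c \<le> (\<integral>x. f x \<partial>\<kappa> z)}"
    using subsetD[OF topspace_weak_topology_subset funcset_mem[OF continuous_map_funspace[OF \<kappa>]]]
    by auto
  ultimately show "closedin Z {z \<in> topspace Z. c \<le> (\<integral>x. f x \<partial>\<kappa> z)}"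
    by (auto simp: closedin_def)
qed

lemma continuous_map_borel_measurable:
  assumes "continuous_map X euclideanreal f" shows "f \<in> borel_measurable (borel_of X)"
proof (rule borel_measurableI)
  fix V :: "real set" assume "open V"
  then have "openin X {x \<in> topspace X. f x \<in> V}"
    using assms by (intro openin_continuous_map_preimage) auto
  then show "f -` V \<inter> space (borel_of X) \<in> sets (borel_of X)"
    using openin_sets_borel_of[of X "{x \<in> topspace X. f x \<in> V}"]
    by (simp add: vimage_def Int_def conj_commute)
qed

text \<open>The half of the portmanteau theorem for upper semicontinuous functions: \<open>g\<close> is approximated from
above by continuous functions, so its integral is an infimum of upper semicontinuous functions of
the measure.\<close>

lemma usc_on_weak_integral:
  assumes X: "metrizable_space X" and \<kappa>: "continuous_map Z (weak_topology X) \<kappa>"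
    and usc: "usc_on X g" and g: "\<And>x. x \<in> topspace X \<Longrightarrow> 0 \<le> g x \<and> g x \<le> 1"
  shows "usc_on Z (\<lambda>z. \<integral>x. g x \<partial>\<kappa> z)"
proof -
  obtain \<phi> where \<phi>: "\<And>n. continuous_map X euclideanreal (\<phi> n)"
    "\<And>n x. x \<in> topspace X \<Longrightarrow> g x \<le> \<phi> n x \<and> \<phi> n x \<le> 1"
    "\<And>x. x \<in> topspace X \<Longrightarrow> (\<lambda>n. \<phi> n x) \<longlonglongrightarrow> g x"
    using usc_on_continuous_approx[OF X usc g] by metis
  have \<phi>b: "\<bar>\<phi> n x\<bar> \<le> 1" if "x \<in> topspace X" for n x
    using \<phi>(2)[OF that, of n] g[OF that] by linarith
  show ?thesis
  proof (rule usc_on_limit)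
    show "usc_on Z (\<lambda>z. \<integral>x. \<phi> n x \<partial>\<kappa> z)" for n
      using \<phi>(1) \<phi>b by (intro usc_on_weak_integral_continuous[OF \<kappa>]) (auto simp: bounded_iff)
    fix z assume z: "z \<in> topspace Z"
    then have kz: "\<kappa> z \<in> space (prob_algebra (borel_of X))"
      using subsetD[OF topspace_weak_topology_subset funcset_mem[OF continuous_map_funspace[OF \<kappa>]]]
      by simp
    then interpret prob_space "\<kappa> z" by (simp add: space_prob_algebra)
    have S: "sets (\<kappa> z) = sets (borel_of X)" using kz by (simp add: space_prob_algebra)
    then have sp: "space (\<kappa> z) = topspace X" using sets_eq_imp_space_eq[OF S] by simp
    note measurable_cong_sets[OF S refl, simp]
    have gm: "g \<in> borel_measurable (\<kappa> z)" "\<phi> n \<in> borel_measurable (\<kappa> z)" for n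
      using usc_on_borel_measurable[OF usc] continuous_map_borel_measurable[OF \<phi>(1)] by simp_all
    have ig: "integrable (\<kappa> z) g"
      using g gm by (intro integrable_const_bound[of _ 1]) (auto simp: sp)
    have i\<phi>: "integrable (\<kappa> z) (\<phi> n)" for n
      using \<phi>b gm by (intro integrable_const_bound[of _ 1]) (auto simp: sp)
    show "(\<integral>x. g x \<partial>\<kappa> z) \<le> (\<integral>x. \<phi> n x \<partial>\<kappa> z)" for n
      using ig i\<phi> \<phi>(2) by (intro integral_mono) (auto simp: sp)
    show "(\<lambda>n. \<integral>x. \<phi> n x \<partial>\<kappa> z) \<longlonglongrightarrow> (\<integral>x. g x \<partial>\<kappa> z)"
      using gm \<phi>(3) \<phi>b by (intro integral_dominated_convergence[where w="\<lambda>_. 1"]) (auto simp: sp)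
  qed
qed

lemma compact_section:
  assumes "compact_space U" "closedin (prod_topology X U) K" "x \<in> topspace X"
  shows "closedin U {u \<in> topspace U. (x, u) \<in> K}"
    and "compact_space (subtopology U {u \<in> topspace U. (x, u) \<in> K})"
proof -
  have "continuous_map U (prod_topology X U) (\<lambda>u. (x, u))"
    using assms(3) by (simp add: continuous_map_pairwise o_def)
  from closedin_continuous_map_preimage[OF this assms(2)]
  show "closedin U {u \<in> topspace U. (x, u) \<in> K}" .
  with assms(1) show "compact_space (subtopology U {u \<in> topspace U. (x, u) \<in> K})"
    by (simp add: closedin_compact_space compact_space_subtopology)
qed

lemma section_attains_max:
  assumes "compact_space U" "closedin (prod_topology X U) K" "x \<in> topspace X"
    and "{u \<in> topspace U. (x, u) \<in> K} \<noteq> {}"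
    and h: "usc_on (subtopology (prod_topology X U) K) h" "\<And>z. z \<in> K \<Longrightarrow> h z \<le> b"
  obtains u where "u \<in> topspace U" "(x, u) \<in> K" "(SUP u \<in> {u \<in> topspace U. (x, u) \<in> K}. h (x, u)) = h (x, u)"
proof -
  let ?Kx = "{u \<in> topspace U. (x, u) \<in> K}"
  let ?Y = "subtopology U ?Kx"
  have "continuous_map ?Y (subtopology (prod_topology X U) K) (\<lambda>u. (x, u))"
    using assms(3) by (auto simp: continuous_map_in_subtopology continuous_map_pairwise o_def
        intro!: continuous_map_from_subtopology)
  then have usc: "usc_on ?Y (\<lambda>u. h (x, u))" by (rule usc_on_compose[OF h(1)])
  have top: "topspace ?Y = ?Kx" by auto
  show ?thesis
  proof (rule usc_on_attains_max[OF compact_section(2)[OF assms(1-3)] _ usc, unfolded top])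
    show "?Kx \<noteq> {}" by (rule assms(4))
    show "h (x, u) \<le> b" if "u \<in> ?Kx" for u using that h(2) by simp
    fix u assume u: "u \<in> ?Kx" "\<And>v. v \<in> ?Kx \<Longrightarrow> h (x, v) \<le> h (x, u)"
    have "(SUP u \<in> ?Kx. h (x, u)) = h (x, u)"
    proof (rule cSup_eq_maximum)
      show "h (x, u) \<in> (\<lambda>u. h (x, u)) ` ?Kx" using u(1) by (rule imageI)
      show "y \<le> h (x, u)" if "y \<in> (\<lambda>u. h (x, u)) ` ?Kx" for y using that u(2) by blast
    qed
    with u(1) show thesis by (intro that[of u]) simp_all
  qed
qed

text \<open>As the supremum is attained, its superlevel set is the projection of the closed set
\<open>{z \<in> K. c \<le> h z}\<close>, and projections along a compact factor are closed.\<close>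

lemma usc_on_section_SUP:
  assumes U: "compact_space U" and K: "closedin (prod_topology X U) K"
    and ne: "\<And>x. x \<in> topspace X \<Longrightarrow> {u \<in> topspace U. (x, u) \<in> K} \<noteq> {}"
    and h: "usc_on (subtopology (prod_topology X U) K) h" "\<And>z. z \<in> K \<Longrightarrow> h z \<le> b"
  shows "usc_on X (\<lambda>x. SUP u \<in> {u \<in> topspace U. (x, u) \<in> K}. h (x, u))"
  unfolding usc_on_def
proof
  fix c
  let ?J = "{z \<in> topspace (subtopology (prod_topology X U) K). c \<le> h z}"
  have "closedin (prod_topology X U) ?J"
    using usc_onD[OF h(1)] K closedin_trans_full by blast
  then have "closedin X (fst ` ?J)"
    using closed_map_fst[OF U] unfolding closed_map_def by blast
  moreover have "fst ` ?J = {x \<in> topspace X. c \<le> (SUP u \<in> {u \<in> topspace U. (x, u) \<in> K}. h (x, u))}"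
  proof (intro antisym subsetI)
    fix x assume "x \<in> fst ` ?J"
    then obtain u where xu: "x \<in> topspace X" "u \<in> topspace U" "(x, u) \<in> K" "c \<le> h (x, u)"
      by auto
    have "h (x, u) \<le> (SUP u \<in> {u \<in> topspace U. (x, u) \<in> K}. h (x, u))"
      using xu h(2) by (intro cSUP_upper bdd_aboveI[of _ b]) auto
    with xu(1,4) show "x \<in> {x \<in> topspace X. c \<le> (SUP u \<in> {u \<in> topspace U. (x, u) \<in> K}. h (x, u))}"
      by simp
  next
    fix x assume "x \<in> {x \<in> topspace X. c \<le> (SUP u \<in> {u \<in> topspace U. (x, u) \<in> K}. h (x, u))}"
    then have x: "x \<in> topspace X" "c \<le> (SUP u \<in> {u \<in> topspace U. (x, u) \<in> K}. h (x, u))"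
      by simp_all
    obtain u where "u \<in> topspace U" "(x, u) \<in> K"
      "(SUP u \<in> {u \<in> topspace U. (x, u) \<in> K}. h (x, u)) = h (x, u)"
      by (rule section_attains_max[OF U K x(1) ne[OF x(1)] h])
    with x show "x \<in> fst ` ?J" by (intro image_eqI[of _ _ "(x, u)"]) auto
  qed
  ultimately show "closedin X {x \<in> topspace X. c \<le> (SUP u \<in> {u \<in> topspace U. (x, u) \<in> K}. h (x, u))}"
    by simp
qed

section \<open>Measurable selection from compact sections\<close>

text \<open>A form of the Kuratowski and Ryll-Nardzewski theorem for compact \<open>U\<close>. Let \<open>C\<^sub>0, C\<^sub>1, \<dots>\<close> be the
complements of the members of a countable base. Starting from \<open>\<Psi> x\<close>, successively intersect with
\<open>C\<^sub>n\<close> whenever the result is nonempty. By compactness something remains, and since the \<open>C\<^sub>n\<close> separate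
points, it is a single point, the value of the selector. The condition that the current set meets a
given closed set is measurable in \<open>x\<close> at each stage, and in the limit it says that the selected
point belongs to this set.\<close>

lemma measurable_selection:
  assumes U: "compact_space U" "second_countable U" "t1_space U"
    and cl: "\<And>x. x \<in> space M \<Longrightarrow> closedin U (\<Psi> x)"
    and ne: "\<And>x. x \<in> space M \<Longrightarrow> \<Psi> x \<noteq> {}"
    and meas: "\<And>C. closedin U C \<Longrightarrow> {x \<in> space M. \<Psi> x \<inter> C \<noteq> {}} \<in> sets M"
  obtains f where "f \<in> M \<rightarrow>\<^sub>M borel_of U" "\<And>x. x \<in> space M \<Longrightarrow> f x \<in> \<Psi> x"
proof -
  obtain B where B: "countable B" "\<And>V. V \<in> B \<Longrightarrow> openin U V"
    and base: "\<And>W x. openin U W \<Longrightarrow> x \<in> W \<Longrightarrow> \<exists>V\<in>B. x \<in> V \<and> V \<subseteq> W"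
    by (rule second_countable_base[OF U(2)]) (rule that; assumption)
  \<comment> \<open>Adding the empty set makes the enumeration total; its complement is harmless.\<close>
  define C where "C n = topspace U - from_nat_into (insert {} B) n" for n
  have C: "closedin U (C n)" for n
    using from_nat_into[of "insert {} B" n] B(2) unfolding C_def by auto
  define P where "P n x = rec_nat (\<Psi> x) (\<lambda>n Q. if Q \<inter> C n \<noteq> {} then Q \<inter> C n else Q) n" for n x
  have P0: "P 0 x = \<Psi> x" for x by (simp add: P_def)
  have PS: "P (Suc n) x = (if P n x \<inter> C n \<noteq> {} then P n x \<inter> C n else P n x)" for n x
    by (simp add: P_def)
  have Pc: "closedin U (P n x) \<and> P n x \<noteq> {}" if "x \<in> space M" for n x
    by (induction n) (use that cl ne C in \<open>auto simp: P0 PS\<close>)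
  have dec: "decseq (\<lambda>n. P n x)" for x by (rule decseq_SucI) (auto simp: PS)
  have Pm: "{x \<in> space M. P n x \<inter> E \<noteq> {}} \<in> sets M" if "closedin U E" for n E
    using that
  proof (induction n arbitrary: E)
    case (Suc n)
    have "{x \<in> space M. P (Suc n) x \<inter> E \<noteq> {}} =
        {x \<in> space M. P n x \<inter> (C n \<inter> E) \<noteq> {}} \<union>
        ({x \<in> space M. P n x \<inter> E \<noteq> {}} - {x \<in> space M. P n x \<inter> C n \<noteq> {}})"
      by (auto simp: PS)
    moreover have "\<dots> \<in> sets M"
      by (intro sets.Un sets.Diff Suc.IH closedin_Int C Suc.prems)
    ultimately show ?case by simp
  qed (use meas P0 in simp)
  have uniq: "u = v" if x: "x \<in> space M" and u: "\<And>n. u \<in> P n x" and v: "\<And>n. v \<in> P n x" for x u v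
  proof (rule ccontr)
    assume "u \<noteq> v"
    have uv: "u \<in> topspace U" "v \<in> topspace U"
      using closedin_subset[of U "P 0 x"] Pc[OF x] u v by blast+
    with U(3) \<open>u \<noteq> v\<close> obtain W where "openin U W" "v \<in> W" "u \<notin> W"
      unfolding t1_space_def by metis
    then obtain V where V: "V \<in> B" "v \<in> V" "u \<notin> V" using base[of W v] by blast
    obtain n where n: "from_nat_into (insert {} B) n = V"
      using from_nat_into_surj[of "insert {} B" V] B(1) V(1) by auto
    then have "u \<in> C n" "v \<notin> C n" using V uv by (auto simp: C_def)
    then have "v \<notin> P (Suc n) x" using u[of n] by (auto simp: PS)
    with v show False by blast
  qed
  define f where "f x = (SOME u. \<forall>n. u \<in> P n x)" for x
  have f: "f x \<in> P n x" if "x \<in> space M" for x n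
  proof -
    have "(\<Inter>n. P n x) \<noteq> {}"
      using Pc[OF that] dec by (intro compact_space_imp_nest[OF U(1)]) auto
    then have "\<exists>u. \<forall>n. u \<in> P n x" by auto
    then show ?thesis unfolding f_def by (rule someI2_ex) blast
  qed
  have fC: "{x \<in> space M. f x \<in> E} \<in> sets M" if E: "closedin U E" for E
  proof -
    have "{x \<in> space M. f x \<in> E} = (\<Inter>n. {x \<in> space M. P n x \<inter> E \<noteq> {}})"
    proof safe
      fix x assume x: "x \<in> (\<Inter>n. {x \<in> space M. P n x \<inter> E \<noteq> {}})"
      then have xM: "x \<in> space M" by auto
      have "(\<Inter>n. P n x \<inter> E) \<noteq> {}"
        using Pc[OF xM] dec[of x] x E
        by (intro compact_space_imp_nest[OF U(1)]) (auto simp: decseq_def)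
      then obtain u where "\<And>n. u \<in> P n x" "u \<in> E" by auto
      with uniq[OF xM, of "f x" u] f[OF xM] show "f x \<in> E" by simp
    qed (use f in auto)
    then show ?thesis using Pm[OF E] by auto
  qed
  have fU: "f x \<in> topspace U" if "x \<in> space M" for x
    using f[OF that, of 0] cl[OF that] closedin_subset by (auto simp: P0)
  have "f \<in> M \<rightarrow>\<^sub>M borel_of U"
  proof (rule measurable_sigma_sets[OF sets_borel_of])
    fix V assume "V \<in> {V. openin U V}"
    then have "closedin U (topspace U - V)" by auto
    from fC[OF this] have "space M - {x \<in> space M. f x \<in> topspace U - V} \<in> sets M" by auto
    moreover have "space M - {x \<in> space M. f x \<in> topspace U - V} = f -` V \<inter> space M"
      using fU by auto
    ultimately show "f -` V \<inter> space M \<in> sets M" by simp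
  qed (use fU in \<open>auto dest: openin_subset\<close>)
  with f[of _ 0] that[of f] show ?thesis by (simp add: P0)
qed

section \<open>Composition of a law with a kernel\<close>

text \<open>The law on pairs obtained by drawing \<open>h\<close> from \<open>\<mu>\<close> and then \<open>u\<close> from \<open>\<kappa> h\<close>. The measures \<open>M\<close>
and \<open>N\<close> serve only as measurable spaces.\<close>

definition joint :: "'a measure \<Rightarrow> 'b measure \<Rightarrow> 'a measure \<Rightarrow> ('a \<Rightarrow> 'b measure) \<Rightarrow> ('a \<times> 'b) measure" where
  "joint M N \<mu> \<kappa> = \<mu> \<bind> (\<lambda>h. distr (\<kappa> h) (M \<Otimes>\<^sub>M N) (Pair h))"

lemma measurable_distr_Pair:
  assumes [measurable]: "\<kappa> \<in> M \<rightarrow>\<^sub>M prob_algebra N"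
  shows "(\<lambda>h. distr (\<kappa> h) (M \<Otimes>\<^sub>M N) (Pair h)) \<in> M \<rightarrow>\<^sub>M prob_algebra (M \<Otimes>\<^sub>M N)"
  by (rule measurable_distr_prob_space2[OF assms]) simp

lemma measurable_joint:
  assumes f[measurable]: "f \<in> L \<rightarrow>\<^sub>M prob_algebra M"
    and k[measurable]: "(\<lambda>(l, h). \<kappa> l h) \<in> L \<Otimes>\<^sub>M M \<rightarrow>\<^sub>M prob_algebra N"
  shows "(\<lambda>l. joint M N (f l) (\<kappa> l)) \<in> L \<rightarrow>\<^sub>M prob_algebra (M \<Otimes>\<^sub>M N)"
  unfolding joint_def
proof (rule measurable_bind_prob_space2[OF f])
  have "(\<lambda>z. distr (case_prod \<kappa> z) (M \<Otimes>\<^sub>M N) (Pair (snd z))) \<in> L \<Otimes>\<^sub>M M \<rightarrow>\<^sub>M prob_algebra (M \<Otimes>\<^sub>M N)"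
    by (rule measurable_distr_prob_space2[OF k]) simp
  then show "(\<lambda>(l, h). distr (\<kappa> l h) (M \<Otimes>\<^sub>M N) (Pair h)) \<in> L \<Otimes>\<^sub>M M \<rightarrow>\<^sub>M prob_algebra (M \<Otimes>\<^sub>M N)"
    by (simp add: case_prod_beta')
qed

lemma joint_in_prob_algebra:
  assumes "\<mu> \<in> space (prob_algebra M)" "\<kappa> \<in> M \<rightarrow>\<^sub>M prob_algebra N"
  shows "joint M N \<mu> \<kappa> \<in> space (prob_algebra (M \<Otimes>\<^sub>M N))"
  unfolding joint_def space_prob_algebra
  using prob_space_bind'[OF assms(1) measurable_distr_Pair[OF assms(2)]]
    sets_bind'[OF assms(1) measurable_distr_Pair[OF assms(2)]] by simp

lemma nn_integral_joint:
  assumes \<mu>: "\<mu> \<in> space (prob_algebra M)" and \<kappa>[measurable]: "\<kappa> \<in> M \<rightarrow>\<^sub>M prob_algebra N"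
    and f[measurable]: "f \<in> borel_measurable (M \<Otimes>\<^sub>M N)"
  shows "(\<integral>\<^sup>+z. f z \<partial>joint M N \<mu> \<kappa>) = (\<integral>\<^sup>+h. (\<integral>\<^sup>+u. f (h, u) \<partial>\<kappa> h) \<partial>\<mu>)"
proof -
  have s: "sets \<mu> = sets M" using \<mu> by (simp add: space_prob_algebra)
  have "(\<integral>\<^sup>+z. f z \<partial>joint M N \<mu> \<kappa>) = (\<integral>\<^sup>+h. (\<integral>\<^sup>+z. f z \<partial>distr (\<kappa> h) (M \<Otimes>\<^sub>M N) (Pair h)) \<partial>\<mu>)"
    unfolding joint_def
    using measurable_prob_algebraD[OF measurable_distr_Pair[OF \<kappa>]]
    by (intro nn_integral_bind[OF f]) (simp cong: measurable_cong_sets add: measurable_cong_sets[OF s refl])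
  also have "\<dots> = (\<integral>\<^sup>+h. (\<integral>\<^sup>+u. f (h, u) \<partial>\<kappa> h) \<partial>\<mu>)"
  proof (rule nn_integral_cong)
    fix h assume "h \<in> space \<mu>"
    then have h: "h \<in> space M" using sets_eq_imp_space_eq[OF s] by simp
    have "sets (\<kappa> h) = sets N"
      using measurable_space[OF \<kappa> h] by (simp add: space_prob_algebra)
    then have "Pair h \<in> \<kappa> h \<rightarrow>\<^sub>M M \<Otimes>\<^sub>M N"
      using measurable_Pair1'[OF h] by (simp cong: measurable_cong_sets)
    then show "(\<integral>\<^sup>+z. f z \<partial>distr (\<kappa> h) (M \<Otimes>\<^sub>M N) (Pair h)) = (\<integral>\<^sup>+u. f (h, u) \<partial>\<kappa> h)"
      by (intro nn_integral_distr) simp_all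
  qed
  finally show ?thesis .
qed

lemma emeasure_joint_Times:
  assumes \<mu>: "\<mu> \<in> space (prob_algebra M)" and \<kappa>: "\<kappa> \<in> M \<rightarrow>\<^sub>M prob_algebra N"
    and A: "A \<in> sets M" and B: "B \<in> sets N"
  shows "emeasure (joint M N \<mu> \<kappa>) (A \<times> B) = (\<integral>\<^sup>+h. emeasure (\<kappa> h) B * indicator A h \<partial>\<mu>)"
proof -
  have s: "sets \<mu> = sets M" using \<mu> by (simp add: space_prob_algebra)
  have AB: "A \<times> B \<in> sets (M \<Otimes>\<^sub>M N)" using A B by simp
  have "emeasure (joint M N \<mu> \<kappa>) (A \<times> B) = (\<integral>\<^sup>+z. indicator (A \<times> B) z \<partial>joint M N \<mu> \<kappa>)"
    using AB joint_in_prob_algebra[OF \<mu> \<kappa>] by (simp add: space_prob_algebra)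
  also have "\<dots> = (\<integral>\<^sup>+h. (\<integral>\<^sup>+u. indicator (A \<times> B) (h, u) \<partial>\<kappa> h) \<partial>\<mu>)"
    using AB by (intro nn_integral_joint[OF \<mu> \<kappa>]) simp
  also have "\<dots> = (\<integral>\<^sup>+h. emeasure (\<kappa> h) B * indicator A h \<partial>\<mu>)"
  proof (rule nn_integral_cong)
    fix h assume "h \<in> space \<mu>"
    then have h: "h \<in> space M" using sets_eq_imp_space_eq[OF s] by simp
    have "sets (\<kappa> h) = sets N"
      using measurable_space[OF \<kappa> h] by (simp add: space_prob_algebra)
    moreover have "(\<lambda>u. indicator (A \<times> B) (h, u)) = (\<lambda>u. indicator B u * (indicator A h :: ennreal))"
      by (auto simp: indicator_def)
    ultimately show "(\<integral>\<^sup>+u. indicator (A \<times> B) (h, u) \<partial>\<kappa> h) = emeasure (\<kappa> h) B * indicator A h"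
      using B by (simp add: nn_integral_multc)
  qed
  finally show ?thesis .
qed

lemma finite_measure_eqI_Times:
  assumes "finite_measure J" "sets J = sets (M \<Otimes>\<^sub>M N)" "sets J' = sets (M \<Otimes>\<^sub>M N)"
    and eq: "\<And>A B. A \<in> sets M \<Longrightarrow> B \<in> sets N \<Longrightarrow> emeasure J (A \<times> B) = emeasure J' (A \<times> B)"
  shows "J = J'"
proof (rule measure_eqI_generator_eq[OF Int_stable_pair_measure_generator])
  let ?E = "{A \<times> B |A B. A \<in> sets M \<and> B \<in> sets N}"
  show "?E \<subseteq> Pow (space M \<times> space N)"
    using sets.sets_into_space[of _ M] sets.sets_into_space[of _ N] by auto
  show "emeasure J X = emeasure J' X" if "X \<in> ?E" for X using that eq by auto
  show "sets J = sigma_sets (space M \<times> space N) ?E" "sets J' = sigma_sets (space M \<times> space N) ?E"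
    using assms(2,3) by (simp_all add: sets_pair_measure)
  show "range (\<lambda>i::nat. space M \<times> space N) \<subseteq> ?E" by auto
  show "emeasure J (space M \<times> space N) \<noteq> \<infinity>" for i :: nat
    using finite_measure.emeasure_finite[OF assms(1)] by simp
qed auto

text \<open>Recognises a law on pairs from its conditional probabilities. This turns the defining identities of
a path law, which speak about rectangles, into statements about all measurable sets and functions.\<close>

lemma joint_eqI:
  assumes "\<mu> \<in> space (prob_algebra M)" "\<kappa> \<in> M \<rightarrow>\<^sub>M prob_algebra N"
    and "finite_measure J" "sets J = sets (M \<Otimes>\<^sub>M N)"
    and "\<And>A B. A \<in> sets M \<Longrightarrow> B \<in> sets N \<Longrightarrow>
      emeasure J (A \<times> B) = (\<integral>\<^sup>+h. emeasure (\<kappa> h) B * indicator A h \<partial>\<mu>)"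
  shows "J = joint M N \<mu> \<kappa>"
  using assms joint_in_prob_algebra[OF assms(1,2)]
  by (intro finite_measure_eqI_Times[where M=M and N=N])
    (simp_all add: emeasure_joint_Times space_prob_algebra)

lemma AE_joint:
  assumes \<mu>: "\<mu> \<in> space (prob_algebra M)" and \<kappa>: "\<kappa> \<in> M \<rightarrow>\<^sub>M prob_algebra N"
    and Z: "Z \<in> sets (M \<Otimes>\<^sub>M N)"
    and 1: "AE h in \<mu>. emeasure (\<kappa> h) {u \<in> space N. (h, u) \<in> Z} = 1"
  shows "AE z in joint M N \<mu> \<kappa>. z \<in> Z"
proof -
  have J: "prob_space (joint M N \<mu> \<kappa>)" "sets (joint M N \<mu> \<kappa>) = sets (M \<Otimes>\<^sub>M N)"
    using joint_in_prob_algebra[OF \<mu> \<kappa>] by (simp_all add: space_prob_algebra)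
  have s: "sets \<mu> = sets M" and p: "prob_space \<mu>" using \<mu> by (simp_all add: space_prob_algebra)
  have "emeasure (joint M N \<mu> \<kappa>) Z = (\<integral>\<^sup>+z. indicator Z z \<partial>joint M N \<mu> \<kappa>)"
    using Z J by simp
  also have "\<dots> = (\<integral>\<^sup>+h. (\<integral>\<^sup>+u. indicator Z (h, u) \<partial>\<kappa> h) \<partial>\<mu>)"
    using Z by (intro nn_integral_joint[OF \<mu> \<kappa>]) simp
  also have "\<dots> = (\<integral>\<^sup>+h. 1 \<partial>\<mu>)"
  proof (rule nn_integral_cong_AE)
    show "AE h in \<mu>. (\<integral>\<^sup>+u. indicator Z (h, u) \<partial>\<kappa> h) = 1"
      using 1
    proof (rule AE_mp, intro AE_I2 impI)
      fix h assume "h \<in> space \<mu>" and e: "emeasure (\<kappa> h) {u \<in> space N. (h, u) \<in> Z} = 1"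
      then have h: "h \<in> space M" using sets_eq_imp_space_eq[OF s] by simp
      have k: "sets (\<kappa> h) = sets N"
        using measurable_space[OF \<kappa> h] by (simp add: space_prob_algebra)
      have "{u \<in> space N. (h, u) \<in> Z} = Pair h -` Z \<inter> space N" by auto
      then have sZ: "{u \<in> space N. (h, u) \<in> Z} \<in> sets (\<kappa> h)"
        using measurable_sets[OF measurable_Pair1'[OF h] Z] k by simp
      have "(\<integral>\<^sup>+u. indicator Z (h, u) \<partial>\<kappa> h) = (\<integral>\<^sup>+u. indicator {u \<in> space N. (h, u) \<in> Z} u \<partial>\<kappa> h)"
        using sets_eq_imp_space_eq[OF k] by (intro nn_integral_cong) (auto simp: indicator_def)
      then show "(\<integral>\<^sup>+u. indicator Z (h, u) \<partial>\<kappa> h) = 1" using sZ e by simp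
    qed
  qed
  also have "\<dots> = 1" using prob_space.emeasure_space_1[OF p] by simp
  finally have "measure (joint M N \<mu> \<kappa>) Z = 1" by (simp add: Sigma_Algebra.measure_def)
  then show ?thesis using prob_space.AE_in_set_eq_1[OF J(1)] Z J(2) by simp
qed

lemma distr_joint_fst:
  assumes \<mu>: "\<mu> \<in> space (prob_algebra M)" and \<kappa>: "\<kappa> \<in> M \<rightarrow>\<^sub>M prob_algebra N"
  shows "distr (joint M N \<mu> \<kappa>) M fst = \<mu>"
proof (rule measure_eqI)
  have s: "sets \<mu> = sets M" using \<mu> by (simp add: space_prob_algebra)
  have J: "sets (joint M N \<mu> \<kappa>) = sets (M \<Otimes>\<^sub>M N)"
    using joint_in_prob_algebra[OF \<mu> \<kappa>] by (simp add: space_prob_algebra)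
  have m: "fst \<in> joint M N \<mu> \<kappa> \<rightarrow>\<^sub>M M" by (simp add: measurable_cong_sets[OF J refl])
  show "sets (distr (joint M N \<mu> \<kappa>) M fst) = sets \<mu>" using s by simp
  fix A assume "A \<in> sets (distr (joint M N \<mu> \<kappa>) M fst)"
  then have A: "A \<in> sets M" by simp
  have "fst -` A \<inter> space (joint M N \<mu> \<kappa>) = A \<times> space N"
    using sets.sets_into_space[OF A] sets_eq_imp_space_eq[OF J] by (auto simp: space_pair_measure)
  then have "emeasure (distr (joint M N \<mu> \<kappa>) M fst) A = emeasure (joint M N \<mu> \<kappa>) (A \<times> space N)"
    using emeasure_distr[OF m A] by simp
  also have "\<dots> = (\<integral>\<^sup>+h. emeasure (\<kappa> h) (space N) * indicator A h \<partial>\<mu>)"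
    by (rule emeasure_joint_Times[OF \<mu> \<kappa> A sets.top])
  also have "\<dots> = (\<integral>\<^sup>+h. indicator A h \<partial>\<mu>)"
  proof (rule nn_integral_cong)
    fix h assume "h \<in> space \<mu>"
    then have "h \<in> space M" using sets_eq_imp_space_eq[OF s] by simp
    from in_space_prob_algebra[OF measurable_space[OF \<kappa> this]]
    show "emeasure (\<kappa> h) (space N) * indicator A h = indicator A h" by simp
  qed
  also have "\<dots> = emeasure \<mu> A" using A s by simp
  finally show "emeasure (distr (joint M N \<mu> \<kappa>) M fst) A = emeasure \<mu> A" .
qed

lemma distr_in_prob_algebra:
  assumes "prob_space P" "f \<in> P \<rightarrow>\<^sub>M M"
  shows "distr P M f \<in> space (prob_algebra M)"
  using assms by (simp add: space_prob_algebra prob_space.prob_space_distr)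

text \<open>Appending a pair \<open>(y, u)\<close> to the prefix \<open>r\<close>, with \<open>y\<close> drawn from \<open>\<tau> r\<close> and \<open>u\<close> from \<open>\<rho> (r, y)\<close>,
amounts to first extending the prefix to the history \<open>(r, y)\<close> and then drawing the control. The
product construction works with pairs, the path law with histories; this identity translates.\<close>

lemma bind_joint_fun_upd:
  fixes S :: "'a measure" and C :: "'b measure" and n :: nat
  defines "Pn \<equiv> PiM {..<n} (\<lambda>_. S \<Otimes>\<^sub>M C)" and "Ps \<equiv> PiM {..<Suc n} (\<lambda>_. S \<Otimes>\<^sub>M C)"
  assumes R: "R \<in> space (prob_algebra Pn)"
    and \<tau>[measurable]: "\<tau> \<in> Pn \<rightarrow>\<^sub>M prob_algebra S"
    and \<rho>[measurable]: "\<rho> \<in> Pn \<Otimes>\<^sub>M S \<rightarrow>\<^sub>M prob_algebra C"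
  shows "distr (R \<bind> (\<lambda>r. distr (joint S C (\<tau> r) (\<lambda>y. \<rho> (r, y))) Ps (fun_upd r n)))
      ((Pn \<Otimes>\<^sub>M S) \<Otimes>\<^sub>M C) (\<lambda>r. ((restrict r {..<n}, fst (r n)), snd (r n))) =
    joint (Pn \<Otimes>\<^sub>M S) C (joint Pn S R \<tau>) \<rho>" (is "distr ?B ?M ?g = ?J")
    and "(\<lambda>r. joint S C (\<tau> r) (\<lambda>y. \<rho> (r, y))) \<in> Pn \<rightarrow>\<^sub>M prob_algebra (S \<Otimes>\<^sub>M C)"
    and "(\<lambda>r. distr (joint S C (\<tau> r) (\<lambda>y. \<rho> (r, y))) Ps (fun_upd r n)) \<in> Pn \<rightarrow>\<^sub>M prob_algebra Ps"
proof -
  have sR: "sets R = sets Pn" using R by (simp add: space_prob_algebra)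
  show Q: "(\<lambda>r. joint S C (\<tau> r) (\<lambda>y. \<rho> (r, y))) \<in> Pn \<rightarrow>\<^sub>M prob_algebra (S \<Otimes>\<^sub>M C)"
    by (rule measurable_joint[OF \<tau>]) simp
  have upd: "(\<lambda>(r, y). r(n := y)) \<in> Pn \<Otimes>\<^sub>M (S \<Otimes>\<^sub>M C) \<rightarrow>\<^sub>M Ps"
    unfolding Pn_def Ps_def case_prod_beta'
    by (rule measurable_fun_upd[where J="{..<n}"]) auto
  show K: "(\<lambda>r. distr (joint S C (\<tau> r) (\<lambda>y. \<rho> (r, y))) Ps (fun_upd r n)) \<in> Pn \<rightarrow>\<^sub>M prob_algebra Ps"
    by (rule measurable_distr_prob_space2[OF Q upd])
  have sB: "sets ?B = sets Ps" by (rule sets_bind'[OF R K])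
  have comp: "(\<lambda>r. r n) \<in> Ps \<rightarrow>\<^sub>M S \<Otimes>\<^sub>M C"
    unfolding Ps_def by (rule measurable_component_singleton) simp
  have res: "(\<lambda>r. restrict r {..<n}) \<in> Ps \<rightarrow>\<^sub>M Pn"
    unfolding Ps_def Pn_def by (rule measurable_restrict_subset) auto
  have g: "?g \<in> Ps \<rightarrow>\<^sub>M ?M"
    by (intro measurable_Pair res measurable_compose[OF comp measurable_fst]
        measurable_compose[OF comp measurable_snd])
  have gB: "?g \<in> ?B \<rightarrow>\<^sub>M ?M" using g by (simp add: measurable_cong_sets[OF sB refl])
  have m1: "joint Pn S R \<tau> \<in> space (prob_algebra (Pn \<Otimes>\<^sub>M S))" by (rule joint_in_prob_algebra[OF R \<tau>])
  have m2: "?J \<in> space (prob_algebra ?M)" by (rule joint_in_prob_algebra[OF m1 \<rho>])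
  show "distr ?B ?M ?g = ?J"
  proof (rule measure_eqI)
    show "sets (distr ?B ?M ?g) = sets ?J" using m2 by (simp add: space_prob_algebra)
    fix A assume "A \<in> sets (distr ?B ?M ?g)"
    then have A[measurable]: "A \<in> sets ?M" by simp
    have "emeasure (distr ?B ?M ?g) A = (\<integral>\<^sup>+z. indicator A z \<partial>distr ?B ?M ?g)" by simp
    also have "\<dots> = (\<integral>\<^sup>+r. indicator A (?g r) \<partial>?B)"
      using gB by (intro nn_integral_distr) simp_all
    also have "\<dots> = (\<integral>\<^sup>+r. (\<integral>\<^sup>+q. indicator A (?g q) \<partial>distr (joint S C (\<tau> r) (\<lambda>y. \<rho> (r, y))) Ps (fun_upd r n)) \<partial>R)"
      using g A measurable_prob_algebraD[OF K]
      by (intro nn_integral_bind[where B=Ps])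
        (auto simp: measurable_cong_sets[OF sR refl] intro!: measurable_compose[OF g])
    also have "\<dots> = (\<integral>\<^sup>+r. (\<integral>\<^sup>+y. (\<integral>\<^sup>+u. indicator A ((r, y), u) \<partial>\<rho> (r, y)) \<partial>\<tau> r) \<partial>R)"
    proof (rule nn_integral_cong)
      fix r assume "r \<in> space R"
      then have r: "r \<in> space Pn" using sets_eq_imp_space_eq[OF sR] by simp
      have sQ: "sets (joint S C (\<tau> r) (\<lambda>y. \<rho> (r, y))) = sets (S \<Otimes>\<^sub>M C)"
        using measurable_space[OF Q r] by (simp add: space_prob_algebra)
      have u: "fun_upd r n \<in> joint S C (\<tau> r) (\<lambda>y. \<rho> (r, y)) \<rightarrow>\<^sub>M Ps"
        using measurable_compose[OF measurable_Pair1'[OF r] upd]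
        by (simp add: measurable_cong_sets[OF sQ refl])
      have ext: "restrict (r(n := z)) {..<n} = r" for z
        using r unfolding Pn_def space_PiM by (auto simp: fun_eq_iff PiE_def extensional_def)
      have "(\<integral>\<^sup>+q. indicator A (?g q) \<partial>distr (joint S C (\<tau> r) (\<lambda>y. \<rho> (r, y))) Ps (fun_upd r n)) =
          (\<integral>\<^sup>+z. indicator A (?g (r(n := z))) \<partial>joint S C (\<tau> r) (\<lambda>y. \<rho> (r, y)))"
        using u A by (intro nn_integral_distr) (auto intro!: measurable_compose[OF g])
      also have "\<dots> = (\<integral>\<^sup>+z. indicator A ((r, fst z), snd z) \<partial>joint S C (\<tau> r) (\<lambda>y. \<rho> (r, y)))"
        by (simp add: ext)
      also have "\<dots> = (\<integral>\<^sup>+y. (\<integral>\<^sup>+u. indicator A ((r, y), u) \<partial>\<rho> (r, y)) \<partial>\<tau> r)"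
      proof (subst nn_integral_joint)
        show "\<tau> r \<in> space (prob_algebra S)" using measurable_space[OF \<tau> r] .
        show "(\<lambda>y. \<rho> (r, y)) \<in> S \<rightarrow>\<^sub>M prob_algebra C"
          by (rule measurable_compose[OF measurable_Pair1'[OF r] \<rho>])
        have "(\<lambda>z. ((r, fst z), snd z)) \<in> S \<Otimes>\<^sub>M C \<rightarrow>\<^sub>M ?M"
          using r by (intro measurable_Pair measurable_const) simp_all
        then show "(\<lambda>z. indicator A ((r, fst z), snd z)) \<in> borel_measurable (S \<Otimes>\<^sub>M C)"
          by (rule measurable_compose) simp
      qed simp
      finally show "(\<integral>\<^sup>+q. indicator A (?g q) \<partial>distr (joint S C (\<tau> r) (\<lambda>y. \<rho> (r, y))) Ps (fun_upd r n)) =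
          (\<integral>\<^sup>+y. (\<integral>\<^sup>+u. indicator A ((r, y), u) \<partial>\<rho> (r, y)) \<partial>\<tau> r)" .
    qed
    also have "\<dots> = (\<integral>\<^sup>+h. (\<integral>\<^sup>+u. indicator A (h, u) \<partial>\<rho> h) \<partial>joint Pn S R \<tau>)"
    proof (rule nn_integral_joint[OF R \<tau>, symmetric])
      have "(\<lambda>(h, u). indicator A (h, u) :: ennreal) \<in> borel_measurable ?M" by simp
      from nn_integral_measurable_subprob_algebra2[OF this measurable_prob_algebraD[OF \<rho>]]
      show "(\<lambda>h. \<integral>\<^sup>+u. indicator A (h, u) \<partial>\<rho> h) \<in> borel_measurable (Pn \<Otimes>\<^sub>M S)" .
    qed
    also have "\<dots> = (\<integral>\<^sup>+z. indicator A z \<partial>?J)"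
      by (rule nn_integral_joint[OF m1 \<rho>, symmetric]) simp
    also have "\<dots> = emeasure ?J A" using m2 by (simp add: space_prob_algebra)
    finally show "emeasure (distr ?B ?M ?g) A = emeasure ?J A" .
  qed
qed

section \<open>Borel versions of kernels and the Ionescu-Tulcea measure\<close>

text \<open>For each of countably many generating events \<open>b\<close>, the function \<open>h \<mapsto> \<kappa> h b\<close> agrees with a Borel
function outside a null set. Redefining \<open>\<kappa>\<close> as constant on the union of the null sets makes it
Borel on the generator, hence everywhere.\<close>

lemma universal_completion_borel_modification:
  assumes \<mu>: "\<mu> \<in> space (prob_algebra M)"
    and \<kappa>: "\<kappa> \<in> universal_completion M \<rightarrow>\<^sub>M prob_algebra N"
    and G: "countable G" "Int_stable G" "G \<subseteq> Pow (space N)" "sets N = sigma_sets (space N) G"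
  obtains \<rho> where "\<rho> \<in> M \<rightarrow>\<^sub>M prob_algebra N" "AE h in \<mu>. \<kappa> h = \<rho> h"
proof -
  have s: "sets \<mu> = sets M" and p: "prob_space \<mu>" using \<mu> by (simp_all add: space_prob_algebra)
  have sp: "space \<mu> = space M" using sets_eq_imp_space_eq[OF s] .
  have \<kappa>h: "\<kappa> h \<in> space (prob_algebra N)" if "h \<in> space M" for h
    using measurable_space[OF \<kappa>] that by (simp add: space_universal_completion)
  have "\<exists>g \<in> borel_measurable \<mu>. AE h in \<mu>. emeasure (\<kappa> h) b = g h" if b: "b \<in> G" for b
  proof (rule completion_ex_borel_measurable)
    have "b \<in> sets N" using b G(4) by (simp add: sigma_sets.Basic)
    then have "(\<lambda>h. emeasure (\<kappa> h) b) \<in> borel_measurable (universal_completion M)"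
      by (intro measurable_compose[OF measurable_prob_algebraD[OF \<kappa>]] measurable_emeasure_subprob_algebra)
    moreover have "borel_measurable (universal_completion M)
        \<subseteq> (borel_measurable (completion \<mu>) :: ('a \<Rightarrow> ennreal) set)"
      using \<mu> sp by (intro measurable_mono) (auto simp: sets_universal_completion space_universal_completion)
    ultimately show "(\<lambda>h. emeasure (\<kappa> h) b) \<in> borel_measurable (completion \<mu>)"
      by (rule rev_subsetD)
  qed
  then obtain g where g: "\<And>b. b \<in> G \<Longrightarrow> g b \<in> borel_measurable \<mu>"
    "\<And>b. b \<in> G \<Longrightarrow> AE h in \<mu>. emeasure (\<kappa> h) b = g b h" by metis
  have "AE h in \<mu>. \<forall>b\<in>G. emeasure (\<kappa> h) b = g b h"
    using g(2) G(1) by (intro AE_ball_countable')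
  then obtain E where E: "E \<in> null_sets \<mu>"
    "\<And>h. h \<in> space M \<Longrightarrow> h \<notin> E \<Longrightarrow> \<forall>b\<in>G. emeasure (\<kappa> h) b = g b h"
    unfolding eventually_ae_filter sp by blast
  obtain h0 where h0: "h0 \<in> space M" using prob_space.not_empty[OF p] sp by auto
  define \<rho> where "\<rho> h = (if h \<in> E then \<kappa> h0 else \<kappa> h)" for h
  have \<rho>: "\<rho> h \<in> space (prob_algebra N)" if "h \<in> space M" for h
    using \<kappa>h that h0 by (simp add: \<rho>_def)
  have "\<rho> \<in> M \<rightarrow>\<^sub>M prob_algebra N"
  proof (rule measurable_prob_algebra_generated[OF G(4,2,3)])
    fix b assume b: "b \<in> G"
    have "E \<in> sets M" using E(1) s by auto
    moreover have "g b \<in> borel_measurable M" using g(1)[OF b] s by (simp cong: measurable_cong_sets)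
    ultimately have "(\<lambda>h. if h \<in> E then emeasure (\<kappa> h0) b else g b h) \<in> borel_measurable M"
      by (intro measurable_If_set) (auto simp: sets.Int_space_eq1)
    moreover have "emeasure (\<rho> h) b = (if h \<in> E then emeasure (\<kappa> h0) b else g b h)"
      if "h \<in> space M" for h using E(2)[OF that] b by (simp add: \<rho>_def)
    ultimately show "(\<lambda>h. emeasure (\<rho> h) b) \<in> borel_measurable M"
      by (simp cong: measurable_cong)
  qed (use \<rho> in \<open>auto simp: space_prob_algebra\<close>)
  moreover have "AE h in \<mu>. \<kappa> h = \<rho> h"
    using AE_not_in[OF E(1)] by (rule AE_mp) (simp add: \<rho>_def)
  ultimately show ?thesis using that by blast
qed

text \<open>The theorem of Ionescu-Tulcea for a single space, as a recursion for the laws of the prefixes. In this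
form it matches the recursion by which kernels and history laws are built from each other.\<close>

lemma Ionescu_Tulcea_sequence:
  fixes N :: "'a measure" and Q :: "nat \<Rightarrow> (nat \<Rightarrow> 'a) \<Rightarrow> 'a measure"
  assumes Q: "\<And>n. Q n \<in> PiM {..<n} (\<lambda>_. N) \<rightarrow>\<^sub>M prob_algebra N"
  obtains P where "prob_space P" "sets P = sets (PiM UNIV (\<lambda>_. N))"
    "distr P (PiM {..<0} (\<lambda>_. N)) (\<lambda>\<omega>. restrict \<omega> {..<0}) = return (PiM {..<0} (\<lambda>_. N)) (\<lambda>_. undefined)"
    "\<And>n. distr P (PiM {..<Suc n} (\<lambda>_. N)) (\<lambda>\<omega>. restrict \<omega> {..<Suc n}) =
      distr P (PiM {..<n} (\<lambda>_. N)) (\<lambda>\<omega>. restrict \<omega> {..<n}) \<bind>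
        (\<lambda>r. distr (Q n r) (PiM {..<Suc n} (\<lambda>_. N)) (fun_upd r n))"
proof -
  interpret IT: Ionescu_Tulcea Q "\<lambda>_. N"
  proof (rule Ionescu_Tulcea.intro)
    show "Q i \<in> PiM {0..<i} (\<lambda>_. N) \<rightarrow>\<^sub>M subprob_algebra N" for i
      using measurable_prob_algebraD[OF Q] by (simp add: atLeast0LessThan)
    show "prob_space (Q i x)" if "x \<in> space (PiM {0..<i} (\<lambda>_. N))" for i x
      using measurable_space[OF Q, of x i] that by (simp add: atLeast0LessThan space_prob_algebra)
  qed
  have up: "IT.up_to {0..<n} = n" for n :: nat
  proof (rule antisym)
    show "IT.up_to {0..<n} \<le> n" by (simp add: IT.up_to_iff)
    show "n \<le> IT.up_to {0..<n}"
      by (rule ccontr) (use IT.up_to_less[of "{0..<n}" "IT.up_to {0..<n}"] in auto)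
  qed
  have C: "distr IT.PF.lim (PiM {0..<n} (\<lambda>_. N)) (\<lambda>\<omega>. restrict \<omega> {0..<n}) = IT.C 0 n (\<lambda>_. undefined)" for n
  proof -
    have "IT.C 0 n (\<lambda>_. undefined) = distr (IT.C 0 n (\<lambda>_. undefined)) (PiM {0..<0 + n} (\<lambda>_. N)) (\<lambda>x. restrict x {0..<0 + n})"
      by (rule IT.distr_C) (simp_all add: space_PiM)
    then show ?thesis
      by (simp add: IT.distr_lim IT.CI_def up)
  qed
  show ?thesis
  proof (rule that[of IT.PF.lim])
    have "prob_space (distr IT.PF.lim (PiM {} (\<lambda>_. N)) (\<lambda>\<omega>. restrict \<omega> {}))"
      using IT.PF.prob_space_P[of "{}"] by (simp add: IT.distr_lim)
    then show "prob_space IT.PF.lim"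
      by (rule prob_space_distrD[rotated])
        (simp add: measurable_restrict_subset cong: measurable_cong_sets)
    show "sets IT.PF.lim = sets (PiM UNIV (\<lambda>_. N))" by simp
    show "distr IT.PF.lim (PiM {..<0} (\<lambda>_. N)) (\<lambda>\<omega>. restrict \<omega> {..<0}) = return (PiM {..<0} (\<lambda>_. N)) (\<lambda>_. undefined)"
      using C[of 0] by (simp add: atLeast0LessThan)
    show "distr IT.PF.lim (PiM {..<Suc n} (\<lambda>_. N)) (\<lambda>\<omega>. restrict \<omega> {..<Suc n}) =
      distr IT.PF.lim (PiM {..<n} (\<lambda>_. N)) (\<lambda>\<omega>. restrict \<omega> {..<n}) \<bind>
        (\<lambda>r. distr (Q n r) (PiM {..<Suc n} (\<lambda>_. N)) (fun_upd r n))" for n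
      using C[of "Suc n"] C[of n] by (simp add: atLeast0LessThan IT.eP_def[abs_def])
  qed
qed

section \<open>Path laws: uniqueness and existence\<close>

locale cdt_mp =
  fixes D :: "('x, 'u) cdt_mp"
  assumes D: "is_cdt_mp D"
begin

abbreviation "SM \<equiv> state_M D"
abbreviation "CM \<equiv> ctrl_M D"
abbreviation "T \<equiv> trans_kernel D"

lemma states_borel: "borel_space (state_sp D)" and ctrl_borel: "borel_space (ctrl_sp D)"
  and states_nonempty: "states D \<noteq> {}"
  and feasible_subset: "feasible D \<subseteq> states D \<times> topspace (ctrl_sp D)"
  and feasible_at_nonempty: "x \<in> states D \<Longrightarrow> feasible_at D x \<noteq> {}"
  and trans_kernel_measurable: "T \<in> SM \<Otimes>\<^sub>M CM \<rightarrow>\<^sub>M prob_algebra SM"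
  using D by (auto simp: is_cdt_mp_def)

lemma singleton_sets: "x \<in> states D \<Longrightarrow> {x} \<in> sets SM"
  using metrizable_imp_Hausdorff_space[OF borel_space_metrizable[OF states_borel]]
  by (intro closedin_sets_borel_of closedin_Hausdorff_singleton)

lemma measurable_fst_component: "(\<lambda>\<omega>. fst (\<omega> n)) \<in> path_M D \<rightarrow>\<^sub>M SM"
  and measurable_snd_component: "(\<lambda>\<omega>. snd (\<omega> n)) \<in> path_M D \<rightarrow>\<^sub>M CM"
  unfolding path_M_def
  by (auto intro!: measurable_compose[OF measurable_component_singleton])

lemma measurable_restrict_path:
  "(\<lambda>\<omega>. restrict \<omega> J) \<in> path_M D \<rightarrow>\<^sub>M PiM J (\<lambda>_. SM \<Otimes>\<^sub>M CM)"
  unfolding path_M_def by (rule measurable_restrict_subset) simp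

lemma measurable_hist: "hist n \<in> path_M D \<rightarrow>\<^sub>M hist_M D n"
  unfolding hist_def[abs_def] hist_M_def
  by (intro measurable_Pair measurable_restrict_path measurable_fst_component)

definition hist_law where "hist_law P n = distr P (hist_M D n) (hist n)"

definition hist_ctrl_law where
  "hist_ctrl_law P n = distr P (hist_M D n \<Otimes>\<^sub>M CM) (\<lambda>\<omega>. (hist n \<omega>, snd (\<omega> n)))"

definition hist_ctrl_state_law where
  "hist_ctrl_state_law P n = distr P ((hist_M D n \<Otimes>\<^sub>M CM) \<Otimes>\<^sub>M SM)
     (\<lambda>\<omega>. ((hist n \<omega>, snd (\<omega> n)), fst (\<omega> (Suc n))))"

lemma measurable_hist_ctrl: "(\<lambda>\<omega>. (hist n \<omega>, snd (\<omega> n))) \<in> path_M D \<rightarrow>\<^sub>M hist_M D n \<Otimes>\<^sub>M CM"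
  by (intro measurable_Pair measurable_hist measurable_snd_component)

lemma measurable_hist_ctrl_state:
  "(\<lambda>\<omega>. ((hist n \<omega>, snd (\<omega> n)), fst (\<omega> (Suc n)))) \<in> path_M D \<rightarrow>\<^sub>M (hist_M D n \<Otimes>\<^sub>M CM) \<Otimes>\<^sub>M SM"
  by (intro measurable_Pair measurable_hist measurable_snd_component measurable_fst_component)

lemma hist_laws_in_prob_algebra:
  assumes "prob_space P" "sets P = sets (path_M D)"
  shows "hist_law P n \<in> space (prob_algebra (hist_M D n))"
    and "hist_ctrl_law P n \<in> space (prob_algebra (hist_M D n \<Otimes>\<^sub>M CM))"
    and "hist_ctrl_state_law P n \<in> space (prob_algebra ((hist_M D n \<Otimes>\<^sub>M CM) \<Otimes>\<^sub>M SM))"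
  unfolding hist_law_def hist_ctrl_law_def hist_ctrl_state_law_def
  by (intro distr_in_prob_algebra[OF assms(1)];
      subst measurable_cong_sets[OF assms(2) refl];
      rule measurable_hist measurable_hist_ctrl measurable_hist_ctrl_state)+

text \<open>The Borel kernel depends on \<open>\<mu>\<close>, and in general no single one serves all laws of the history.
Existence of the path law therefore alternates between choosing kernels and building laws.\<close>

lemma policy_borel_modification:
  assumes "\<pi> \<in> policies D" "\<mu> \<in> space (prob_algebra (hist_M D n))"
  obtains \<rho> where "\<rho> \<in> hist_M D n \<rightarrow>\<^sub>M prob_algebra CM" "AE h in \<mu>. \<pi> n h = \<rho> h"
proof -
  obtain G where G: "countable G" "Int_stable G" "G \<subseteq> Pow (topspace (ctrl_sp D))"
      "sets CM = sigma_sets (topspace (ctrl_sp D)) G"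
    by (rule second_countable_imp_countable_generator[OF borel_space_second_countable[OF ctrl_borel]])
  have \<pi>: "\<pi> n \<in> universal_completion (hist_M D n) \<rightarrow>\<^sub>M prob_algebra CM"
    using assms(1) by (simp add: policies_def)
  show ?thesis
  proof (rule universal_completion_borel_modification[OF assms(2) \<pi> G(1,2)])
    show "G \<subseteq> Pow (space CM)" "sets CM = sigma_sets (space CM) G" using G by simp_all
  qed (rule that)
qed

lemma trans_kernel_measurable':
  "(\<lambda>z. T (snd (fst z), snd z)) \<in> hist_M D n \<Otimes>\<^sub>M CM \<rightarrow>\<^sub>M prob_algebra SM"
  unfolding hist_M_def by (rule measurable_compose[OF _ trans_kernel_measurable]) simp

lemma is_path_lawD:
  assumes "is_path_law D \<pi> x P"
  shows "prob_space P" and "sets P = sets (path_M D)" and "AE \<omega> in P. fst (\<omega> 0) = x"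
    and "\<And>n A B. A \<in> sets (hist_M D n) \<Longrightarrow> B \<in> sets CM \<Longrightarrow>
        emeasure P {\<omega> \<in> space P. hist n \<omega> \<in> A \<and> snd (\<omega> n) \<in> B} =
        (\<integral>\<^sup>+\<omega>. emeasure (\<pi> n (hist n \<omega>)) B * indicator A (hist n \<omega>) \<partial>completion P)"
    and "\<And>n A B. A \<in> sets (hist_M D n \<Otimes>\<^sub>M CM) \<Longrightarrow> B \<in> sets SM \<Longrightarrow>
        emeasure P {\<omega> \<in> space P. (hist n \<omega>, snd (\<omega> n)) \<in> A \<and> fst (\<omega> (Suc n)) \<in> B} =
        (\<integral>\<^sup>+\<omega>. emeasure (T (\<omega> n)) B * indicator A (hist n \<omega>, snd (\<omega> n)) \<partial>P)"
proof -
  note 1 = assms[unfolded is_path_law_def]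
  note 2 = 1[THEN conjunct2] note 3 = 2[THEN conjunct2] note 4 = 3[THEN conjunct2]
  show "prob_space P" by (rule 1[THEN conjunct1])
  show "sets P = sets (path_M D)" by (rule 2[THEN conjunct1])
  show "AE \<omega> in P. fst (\<omega> 0) = x" by (rule 3[THEN conjunct1])
  show "emeasure P {\<omega> \<in> space P. hist n \<omega> \<in> A \<and> snd (\<omega> n) \<in> B} =
        (\<integral>\<^sup>+\<omega>. emeasure (\<pi> n (hist n \<omega>)) B * indicator A (hist n \<omega>) \<partial>completion P)"
    if "A \<in> sets (hist_M D n)" "B \<in> sets CM" for n A B
    by (rule 4[THEN conjunct1, rule_format, OF that])
  show "emeasure P {\<omega> \<in> space P. (hist n \<omega>, snd (\<omega> n)) \<in> A \<and> fst (\<omega> (Suc n)) \<in> B} =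
        (\<integral>\<^sup>+\<omega>. emeasure (T (\<omega> n)) B * indicator A (hist n \<omega>, snd (\<omega> n)) \<partial>P)"
    if "A \<in> sets (hist_M D n \<Otimes>\<^sub>M CM)" "B \<in> sets SM" for n A B
    by (rule 4[THEN conjunct2, rule_format, OF that])
qed

text \<open>On the right-hand side of the first identity of a path law, the completion does not affect the
integral, and \<open>\<pi> n\<close> may be replaced by its Borel version.\<close>

lemma path_law_hist_ctrl:
  assumes P: "is_path_law D \<pi> x P"
    and \<rho>: "\<rho> \<in> hist_M D n \<rightarrow>\<^sub>M prob_algebra CM" "AE h in hist_law P n. \<pi> n h = \<rho> h"
  shows "hist_ctrl_law P n = joint (hist_M D n) CM (hist_law P n) \<rho>"
proof -
  note pP = is_path_lawD(1)[OF P] and sP = is_path_lawD(2)[OF P] and eq = is_path_lawD(4)[OF P, of _ n]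
  note laws = hist_laws_in_prob_algebra[OF pP sP, of n]
  note [simp] = measurable_cong_sets[OF sP refl]
  show ?thesis
  proof (rule joint_eqI[OF laws(1) \<rho>(1)])
    show "finite_measure (hist_ctrl_law P n)" "sets (hist_ctrl_law P n) = sets (hist_M D n \<Otimes>\<^sub>M CM)"
      using laws(2) by (simp_all add: space_prob_algebra prob_space.finite_measure)
    fix A B assume A: "A \<in> sets (hist_M D n)" and B: "B \<in> sets CM"
    have "emeasure (hist_ctrl_law P n) (A \<times> B) =
        emeasure P ((\<lambda>\<omega>. (hist n \<omega>, snd (\<omega> n))) -` (A \<times> B) \<inter> space P)"
      unfolding hist_ctrl_law_def using A B measurable_hist_ctrl by (intro emeasure_distr) auto
    also have "(\<lambda>\<omega>. (hist n \<omega>, snd (\<omega> n))) -` (A \<times> B) \<inter> space P =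
        {\<omega> \<in> space P. hist n \<omega> \<in> A \<and> snd (\<omega> n) \<in> B}" by auto
    also note eq[OF A B]
    also note nn_integral_completion
    also have "(\<integral>\<^sup>+\<omega>. emeasure (\<pi> n (hist n \<omega>)) B * indicator A (hist n \<omega>) \<partial>P) =
        (\<integral>\<^sup>+\<omega>. emeasure (\<rho> (hist n \<omega>)) B * indicator A (hist n \<omega>) \<partial>P)"
    proof (rule nn_integral_cong_AE)
      have "AE \<omega> in P. \<pi> n (hist n \<omega>) = \<rho> (hist n \<omega>)"
        using \<rho>(2) measurable_hist unfolding hist_law_def by (intro AE_distrD[of "hist n" P]) auto
      then show "AE \<omega> in P. emeasure (\<pi> n (hist n \<omega>)) B * indicator A (hist n \<omega>) =
          emeasure (\<rho> (hist n \<omega>)) B * indicator A (hist n \<omega>)" by (rule AE_mp) simp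
    qed
    also have "\<dots> = (\<integral>\<^sup>+h. emeasure (\<rho> h) B * indicator A h \<partial>hist_law P n)"
      unfolding hist_law_def
    proof (rule nn_integral_distr[symmetric])
      show "hist n \<in> P \<rightarrow>\<^sub>M hist_M D n" using measurable_hist by simp
      have "(\<lambda>h. emeasure (\<rho> h) B) \<in> borel_measurable (hist_M D n)"
        by (rule measurable_compose[OF measurable_prob_algebraD[OF \<rho>(1)] measurable_emeasure_subprob_algebra[OF B]])
      then show "(\<lambda>h. emeasure (\<rho> h) B * indicator A h) \<in> borel_measurable (distr P (hist_M D n) (hist n))"
        using A by simp
    qed
    finally show "emeasure (hist_ctrl_law P n) (A \<times> B) =
        (\<integral>\<^sup>+h. emeasure (\<rho> h) B * indicator A h \<partial>hist_law P n)" .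
  qed
qed

lemma path_law_hist_ctrl_state:
  assumes P: "is_path_law D \<pi> x P"
  shows "hist_ctrl_state_law P n =
    joint (hist_M D n \<Otimes>\<^sub>M CM) SM (hist_ctrl_law P n) (\<lambda>z. T (snd (fst z), snd z))"
proof -
  note pP = is_path_lawD(1)[OF P] and sP = is_path_lawD(2)[OF P] and eq = is_path_lawD(5)[OF P, of _ n]
  note laws = hist_laws_in_prob_algebra[OF pP sP, of n]
  note [simp] = measurable_cong_sets[OF sP refl]
  show ?thesis
  proof (rule joint_eqI[OF laws(2) trans_kernel_measurable'])
    show "finite_measure (hist_ctrl_state_law P n)"
      "sets (hist_ctrl_state_law P n) = sets ((hist_M D n \<Otimes>\<^sub>M CM) \<Otimes>\<^sub>M SM)"
      using laws(3) by (simp_all add: space_prob_algebra prob_space.finite_measure)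
    fix A B assume A: "A \<in> sets (hist_M D n \<Otimes>\<^sub>M CM)" and B: "B \<in> sets SM"
    have "emeasure (hist_ctrl_state_law P n) (A \<times> B) =
        emeasure P ((\<lambda>\<omega>. ((hist n \<omega>, snd (\<omega> n)), fst (\<omega> (Suc n)))) -` (A \<times> B) \<inter> space P)"
      unfolding hist_ctrl_state_law_def using A B measurable_hist_ctrl_state
      by (intro emeasure_distr) auto
    also have "(\<lambda>\<omega>. ((hist n \<omega>, snd (\<omega> n)), fst (\<omega> (Suc n)))) -` (A \<times> B) \<inter> space P =
        {\<omega> \<in> space P. (hist n \<omega>, snd (\<omega> n)) \<in> A \<and> fst (\<omega> (Suc n)) \<in> B}" by auto
    also note eq[OF A B]
    also have "(\<integral>\<^sup>+\<omega>. emeasure (T (\<omega> n)) B * indicator A (hist n \<omega>, snd (\<omega> n)) \<partial>P) =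
        (\<integral>\<^sup>+z. emeasure (T (snd (fst z), snd z)) B * indicator A z \<partial>hist_ctrl_law P n)"
      unfolding hist_ctrl_law_def
    proof (subst nn_integral_distr)
      show "(\<lambda>\<omega>. (hist n \<omega>, snd (\<omega> n))) \<in> P \<rightarrow>\<^sub>M hist_M D n \<Otimes>\<^sub>M CM"
        using measurable_hist_ctrl by simp
      have "(\<lambda>z. emeasure (T (snd (fst z), snd z)) B) \<in> borel_measurable (hist_M D n \<Otimes>\<^sub>M CM)"
        by (rule measurable_compose[OF measurable_prob_algebraD[OF trans_kernel_measurable']
              measurable_emeasure_subprob_algebra[OF B]])
      then show "(\<lambda>z. emeasure (T (snd (fst z), snd z)) B * indicator A z) \<in>
          borel_measurable (distr P (hist_M D n \<Otimes>\<^sub>M CM) (\<lambda>\<omega>. (hist n \<omega>, snd (\<omega> n))))"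
        using A by simp
    qed (simp add: hist_def)
    finally show "emeasure (hist_ctrl_state_law P n) (A \<times> B) =
        (\<integral>\<^sup>+z. emeasure (T (snd (fst z), snd z)) B * indicator A z \<partial>hist_ctrl_law P n)" .
  qed
qed

lemma hist_law_Suc:
  assumes sP: "sets P = sets (path_M D)"
  shows "hist_law P (Suc n) = distr (hist_ctrl_state_law P n) (hist_M D (Suc n))
    (\<lambda>((h, u), y). ((fst h)(n := (snd h, u)), y))" (is "_ = distr _ _ ?g")
proof -
  have g: "?g \<in> (hist_M D n \<Otimes>\<^sub>M CM) \<Otimes>\<^sub>M SM \<rightarrow>\<^sub>M hist_M D (Suc n)"
    unfolding hist_M_def case_prod_beta'
    by (intro measurable_Pair measurable_fun_upd[where J="{..<n}"]) auto
  have m: "(\<lambda>\<omega>. ((hist n \<omega>, snd (\<omega> n)), fst (\<omega> (Suc n)))) \<in> P \<rightarrow>\<^sub>M (hist_M D n \<Otimes>\<^sub>M CM) \<Otimes>\<^sub>M SM"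
    using measurable_hist_ctrl_state by (simp add: measurable_cong_sets[OF sP refl])
  have "hist (Suc n) = ?g \<circ> (\<lambda>\<omega>. ((hist n \<omega>, snd (\<omega> n)), fst (\<omega> (Suc n))))"
    by (auto simp: fun_eq_iff hist_def less_Suc_eq)
  then show ?thesis
    unfolding hist_law_def hist_ctrl_state_law_def by (simp add: distr_distr[OF g m])
qed

lemma hist_law_0:
  assumes P: "is_path_law D \<pi> x P" and x: "x \<in> states D"
  shows "hist_law P 0 = return (hist_M D 0) (\<lambda>_. undefined, x)"
proof -
  note pP = is_path_lawD(1)[OF P] and sP = is_path_lawD(2)[OF P] and AE = is_path_lawD(3)[OF P]
  have c: "(\<lambda>_. undefined, x) \<in> space (hist_M D 0)"
    using x by (simp add: hist_M_def space_pair_measure space_PiM)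
  have "hist_law P 0 = distr P (hist_M D 0) (\<lambda>_. (\<lambda>_. undefined, x))"
    unfolding hist_law_def
  proof (rule distr_cong_AE)
    show "AE \<omega> in P. hist 0 \<omega> = (\<lambda>_. undefined, x)"
      using AE by (rule AE_mp) (auto simp: hist_def fun_eq_iff)
  qed (use c measurable_hist in \<open>simp_all add: measurable_cong_sets[OF sP refl]\<close>)
  also have "\<dots> = return (hist_M D 0) (\<lambda>_. undefined, x)"
    by (rule prob_space.distr_const[OF pP c])
  finally show ?thesis .
qed

text \<open>By induction on \<open>n\<close>, both measures give the same law to the history of length \<open>n\<close>: equal laws of
\<open>h\<^sub>n\<close> admit the same Borel version of \<open>\<pi> n\<close> and hence determine the same laws of \<open>(h\<^sub>n, u\<^sub>n)\<close>, of
\<open>(h\<^sub>n, u\<^sub>n, x\<^sub>n\<^sub>+\<^sub>1)\<close> and of \<open>h\<^sub>n\<^sub>+\<^sub>1\<close>. The histories contain all finite-dimensional distributions.\<close>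

lemma path_law_unique:
  assumes \<pi>: "\<pi> \<in> policies D" and x: "x \<in> states D"
    and P: "is_path_law D \<pi> x P" and P': "is_path_law D \<pi> x P'"
  shows "P = P'"
proof -
  note pP = is_path_lawD(1)[OF P] is_path_lawD(1)[OF P']
    and sP = is_path_lawD(2)[OF P] is_path_lawD(2)[OF P']
  have H: "hist_law P n = hist_law P' n" for n
  proof (induction n)
    case 0
    show ?case using hist_law_0[OF P x] hist_law_0[OF P' x] by simp
  next
    case (Suc n)
    obtain \<rho> where \<rho>: "\<rho> \<in> hist_M D n \<rightarrow>\<^sub>M prob_algebra CM" "AE h in hist_law P n. \<pi> n h = \<rho> h"
      by (rule policy_borel_modification[OF \<pi> hist_laws_in_prob_algebra(1)[OF pP(1) sP(1)]])
    have "hist_ctrl_law P n = hist_ctrl_law P' n"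
      using path_law_hist_ctrl[OF P \<rho>] path_law_hist_ctrl[OF P' \<rho>(1) \<rho>(2)[unfolded Suc.IH]] Suc.IH
      by simp
    then show ?case
      using path_law_hist_ctrl_state[OF P, of n] path_law_hist_ctrl_state[OF P', of n]
      by (simp add: hist_law_Suc[OF sP(1)] hist_law_Suc[OF sP(2)])
  qed
  show ?thesis
  proof (rule measure_eqI_PiM_infinite)
    show "sets P = sets (PiM UNIV (\<lambda>_. SM \<Otimes>\<^sub>M CM))" "sets P' = sets (PiM UNIV (\<lambda>_. SM \<Otimes>\<^sub>M CM))"
      using sP by (simp_all add: path_M_def)
    show "finite_measure P" using pP(1) by (rule prob_space.finite_measure)
    fix A :: "nat \<Rightarrow> ('x \<times> 'u) set" and J
    assume J: "finite J" and A: "\<And>i. i \<in> J \<Longrightarrow> A i \<in> sets (SM \<Otimes>\<^sub>M CM)"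
    obtain n where n: "J \<subseteq> {..<n}" using finite_nat_bounded[OF J] by auto
    let ?N = "\<lambda>_::nat. SM \<Otimes>\<^sub>M CM"
    let ?E = "prod_emb {..<n} ?N J (Pi\<^sub>E J A) \<times> space SM"
    have E: "?E \<in> sets (hist_M D n)"
      unfolding hist_M_def using A J n by (intro pair_measureI sets_PiM_I sets.top) auto
    have *: "hist n -` ?E \<inter> space (path_M D) = prod_emb UNIV ?N J (Pi\<^sub>E J A)"
    proof -
      have "(if i < n then y i else undefined) = y i" if "i \<in> J" for i and y :: "nat \<Rightarrow> 'x \<times> 'u"
        using that n by auto
      then show ?thesis
        by (auto simp: prod_emb_def hist_def path_M_def space_PiM PiE_iff space_pair_measure
            mem_Times_iff cong: ball_cong)
    qed
    have **: "emeasure Q (prod_emb UNIV ?N J (Pi\<^sub>E J A)) = emeasure (hist_law Q n) ?E"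
      if "sets Q = sets (path_M D)" for Q
      unfolding hist_law_def
      using emeasure_distr[OF _ E, of "hist n" Q] measurable_hist[of n] sets_eq_imp_space_eq[OF that] *
      by (simp add: measurable_cong_sets[OF that refl])
    show "emeasure P (prod_emb UNIV ?N J (Pi\<^sub>E J A)) = emeasure P' (prod_emb UNIV ?N J (Pi\<^sub>E J A))"
      using **[OF sP(1)] **[OF sP(2)] H[of n] by simp
  qed
qed

text \<open>The laws \<open>L n\<close> of the prefixes of length \<open>n\<close> are built recursively: \<open>L n\<close> determines the law \<open>H n\<close>
of the history, this determines a Borel version \<open>\<rho> n\<close> of \<open>\<pi> n\<close>, and this in turn determines
\<open>L (Suc n)\<close>. The kernels chosen on the way define a measure on paths by Ionescu-Tulcea, and its
histories have the laws \<open>H n\<close>. So \<open>\<rho> n\<close> and \<open>\<pi> n\<close> agree almost surely along its paths.\<close>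

lemma path_law_exists:
  assumes \<pi>: "\<pi> \<in> policies D" and x: "x \<in> states D"
  shows "\<exists>P. is_path_law D \<pi> x P"
proof -
  define Pn where "Pn n = PiM {..<n} (\<lambda>_::nat. SM \<Otimes>\<^sub>M CM)" for n
  have hM: "hist_M D n = Pn n \<Otimes>\<^sub>M SM" for n by (simp add: hist_M_def Pn_def)
  \<comment> \<open>The state at time n has the law \<open>return SM x\<close> for \<open>n = 0\<close> and otherwise depends on the last pair of the prefix.\<close>
  define \<tau> where "\<tau> n r = (if n = 0 then return SM x else T (r (n - 1)))" for n :: nat and r
  have \<tau>: "\<tau> n \<in> Pn n \<rightarrow>\<^sub>M prob_algebra SM" for n
  proof (cases n)
    case 0
    have "return SM x \<in> space (prob_algebra SM)"
      using x by (simp add: space_prob_algebra prob_space_return)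
    then show ?thesis using 0 by (simp add: \<tau>_def[abs_def])
  next
    case (Suc m)
    have "(\<lambda>r. r m) \<in> Pn n \<rightarrow>\<^sub>M SM \<Otimes>\<^sub>M CM"
      unfolding Pn_def Suc by (rule measurable_component_singleton) simp
    from measurable_compose[OF this trans_kernel_measurable] show ?thesis
      using Suc by (simp add: \<tau>_def[abs_def])
  qed
  define sel where
    "sel n \<mu> = (SOME \<rho>. \<rho> \<in> hist_M D n \<rightarrow>\<^sub>M prob_algebra CM \<and> (AE h in \<mu>. \<pi> n h = \<rho> h))" for n \<mu>
  have sel: "sel n \<mu> \<in> Pn n \<Otimes>\<^sub>M SM \<rightarrow>\<^sub>M prob_algebra CM" "AE h in \<mu>. \<pi> n h = sel n \<mu> h"
    if "\<mu> \<in> space (prob_algebra (Pn n \<Otimes>\<^sub>M SM))" for n \<mu>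
  proof -
    have "\<exists>\<rho>. \<rho> \<in> hist_M D n \<rightarrow>\<^sub>M prob_algebra CM \<and> (AE h in \<mu>. \<pi> n h = \<rho> h)"
      by (rule policy_borel_modification[OF \<pi>, of \<mu> n]) (use that hM in auto)
    from someI_ex[OF this]
    show "sel n \<mu> \<in> Pn n \<Otimes>\<^sub>M SM \<rightarrow>\<^sub>M prob_algebra CM" "AE h in \<mu>. \<pi> n h = sel n \<mu> h"
      unfolding sel_def[symmetric] by (simp_all add: hM)
  qed
  define step where "step n L = L \<bind> (\<lambda>r. distr (joint SM CM (\<tau> n r)
      (\<lambda>y. sel n (joint (Pn n) SM L (\<tau> n)) (r, y))) (Pn (Suc n)) (fun_upd r n))" for n L
  define L where "L n = rec_nat (return (Pn 0) (\<lambda>_. undefined)) step n" for n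
  define H where "H n = joint (Pn n) SM (L n) (\<tau> n)" for n
  define \<rho> where "\<rho> n = sel n (H n)" for n
  define Q where "Q n r = joint SM CM (\<tau> n r) (\<lambda>y. \<rho> n (r, y))" for n r
  have L0: "L 0 = return (Pn 0) (\<lambda>_. undefined)" by (simp add: L_def)
  have LS: "L (Suc n) = L n \<bind> (\<lambda>r. distr (Q n r) (Pn (Suc n)) (fun_upd r n))" for n
    by (simp add: L_def step_def Q_def \<rho>_def H_def)
  have main: "L n \<in> space (prob_algebra (Pn n)) \<and> H n \<in> space (prob_algebra (Pn n \<Otimes>\<^sub>M SM)) \<and>
      \<rho> n \<in> Pn n \<Otimes>\<^sub>M SM \<rightarrow>\<^sub>M prob_algebra CM" for n
  proof -
    have *: "H n \<in> space (prob_algebra (Pn n \<Otimes>\<^sub>M SM)) \<and> \<rho> n \<in> Pn n \<Otimes>\<^sub>M SM \<rightarrow>\<^sub>M prob_algebra CM"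
      if "L n \<in> space (prob_algebra (Pn n))" for n
    proof -
      have "H n \<in> space (prob_algebra (Pn n \<Otimes>\<^sub>M SM))"
        unfolding H_def by (rule joint_in_prob_algebra[OF that \<tau>])
      with sel(1)[OF this] show ?thesis by (simp add: \<rho>_def)
    qed
    have "L n \<in> space (prob_algebra (Pn n))"
    proof (induction n)
      case 0
      have "(\<lambda>_. undefined) \<in> space (Pn 0)" by (simp add: Pn_def space_PiM)
      then show ?case by (simp add: L0 space_prob_algebra prob_space_return)
    next
      case (Suc n)
      have "(\<lambda>r. distr (Q n r) (Pn (Suc n)) (fun_upd r n)) \<in> Pn n \<rightarrow>\<^sub>M prob_algebra (Pn (Suc n))"
        unfolding Q_def Pn_def
        by (rule bind_joint_fun_upd(3)) (use Suc \<tau>[of n] *[OF Suc] in \<open>simp_all add: Pn_def\<close>)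
      with Suc show ?case
        unfolding LS by (auto simp: space_prob_algebra[of "Pn (Suc n)"] intro!: sets_bind' prob_space_bind')
    qed
    with * show ?thesis by blast
  qed
  have Lp: "L n \<in> space (prob_algebra (Pn n))" and Hp: "H n \<in> space (prob_algebra (Pn n \<Otimes>\<^sub>M SM))"
    and \<rho>: "\<rho> n \<in> Pn n \<Otimes>\<^sub>M SM \<rightarrow>\<^sub>M prob_algebra CM" for n
    using main by blast+
  have Qm: "Q n \<in> PiM {..<n} (\<lambda>_. SM \<Otimes>\<^sub>M CM) \<rightarrow>\<^sub>M prob_algebra (SM \<Otimes>\<^sub>M CM)" for n
    unfolding Q_def[abs_def]
    by (rule bind_joint_fun_upd(2)) (use Lp[of n] \<tau>[of n] \<rho>[of n] in \<open>simp_all add: Pn_def\<close>)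
  obtain P where pP: "prob_space P" and sP: "sets P = sets (path_M D)"
    and R0: "distr P (Pn 0) (\<lambda>\<omega>. restrict \<omega> {..<0}) = return (Pn 0) (\<lambda>_. undefined)"
    and RS: "\<And>n. distr P (Pn (Suc n)) (\<lambda>\<omega>. restrict \<omega> {..<Suc n}) =
      distr P (Pn n) (\<lambda>\<omega>. restrict \<omega> {..<n}) \<bind> (\<lambda>r. distr (Q n r) (Pn (Suc n)) (fun_upd r n))"
    by (rule Ionescu_Tulcea_sequence[OF Qm, folded Pn_def path_M_def]) (rule that; assumption)
  note mP = measurable_cong_sets[OF sP refl]
  have spP: "space P = space (path_M D)" by (rule sets_eq_imp_space_eq[OF sP])
  have RL: "distr P (Pn n) (\<lambda>\<omega>. restrict \<omega> {..<n}) = L n" for n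
  proof (induction n)
    case 0
    show ?case unfolding L0 by (rule R0)
  next
    case (Suc n)
    show ?case unfolding RS LS Suc.IH ..
  qed
  have res: "(\<lambda>\<omega>. restrict \<omega> {..<n}) \<in> P \<rightarrow>\<^sub>M Pn n" for n
    unfolding mP Pn_def by (rule measurable_restrict_path)
  have HC: "hist_ctrl_law P n = joint (Pn n \<Otimes>\<^sub>M SM) CM (H n) (\<rho> n)" for n
  proof -
    let ?g = "\<lambda>r. ((restrict r {..<n}, fst (r n)), snd (r n))"
    have 1: "distr (L (Suc n)) ((Pn n \<Otimes>\<^sub>M SM) \<Otimes>\<^sub>M CM) ?g = joint (Pn n \<Otimes>\<^sub>M SM) CM (H n) (\<rho> n)"
      unfolding LS Q_def H_def Pn_def
      by (rule bind_joint_fun_upd(1)) (use Lp[of n] \<tau>[of n] \<rho>[of n] in \<open>simp_all add: Pn_def\<close>)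
    have comp: "(\<lambda>r. r n) \<in> Pn (Suc n) \<rightarrow>\<^sub>M SM \<Otimes>\<^sub>M CM"
      unfolding Pn_def by (rule measurable_component_singleton) simp
    have "(\<lambda>r. restrict r {..<n}) \<in> Pn (Suc n) \<rightarrow>\<^sub>M Pn n"
      unfolding Pn_def by (rule measurable_restrict_subset) auto
    then have g: "?g \<in> Pn (Suc n) \<rightarrow>\<^sub>M (Pn n \<Otimes>\<^sub>M SM) \<Otimes>\<^sub>M CM"
      by (intro measurable_Pair measurable_compose[OF comp measurable_fst]
        measurable_compose[OF comp measurable_snd])
    have "?g \<circ> (\<lambda>\<omega>. restrict \<omega> {..<Suc n}) = (\<lambda>\<omega> :: nat \<Rightarrow> 'x \<times> 'u. (hist n \<omega>, snd (\<omega> n)))"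
      by (auto simp: fun_eq_iff hist_def)
    then show ?thesis
      using 1 unfolding RL[symmetric] hist_ctrl_law_def by (simp only: distr_distr[OF g res] hM)
  qed
  have HL: "hist_law P n = H n" for n
  proof -
    have m: "(\<lambda>\<omega>. (hist n \<omega>, snd (\<omega> n))) \<in> P \<rightarrow>\<^sub>M hist_M D n \<Otimes>\<^sub>M CM"
      unfolding mP by (rule measurable_hist_ctrl)
    have "distr (hist_ctrl_law P n) (hist_M D n) fst = hist_law P n"
      unfolding hist_ctrl_law_def hist_law_def distr_distr[OF measurable_fst m] by (simp add: comp_def)
    then show ?thesis
      unfolding HC using distr_joint_fst[OF Hp[of n] \<rho>[of n]] by (simp add: hM)
  qed
  have histP: "hist n \<in> P \<rightarrow>\<^sub>M hist_M D n" for n unfolding mP by (rule measurable_hist)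
  have "is_path_law D \<pi> x P"
    unfolding is_path_law_def
  proof (intro conjI allI ballI)
    have "AE h in H 0. h \<in> {h \<in> space (Pn 0 \<Otimes>\<^sub>M SM). snd h = x}"
      unfolding H_def
    proof (rule AE_joint[OF Lp \<tau>])
      have "snd -` {x} \<inter> space (Pn 0 \<Otimes>\<^sub>M SM) \<in> sets (Pn 0 \<Otimes>\<^sub>M SM)"
        by (rule measurable_sets[OF measurable_snd singleton_sets[OF x]])
      also have "snd -` {x} \<inter> space (Pn 0 \<Otimes>\<^sub>M SM) = {h \<in> space (Pn 0 \<Otimes>\<^sub>M SM). snd h = x}" by auto
      finally show "{h \<in> space (Pn 0 \<Otimes>\<^sub>M SM). snd h = x} \<in> sets (Pn 0 \<Otimes>\<^sub>M SM)" .
      show "AE r in L 0. emeasure (\<tau> 0 r) {u \<in> space SM. (r, u) \<in> {h \<in> space (Pn 0 \<Otimes>\<^sub>M SM). snd h = x}} = 1"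
      proof (rule AE_I2)
        fix r assume "r \<in> space (L 0)"
        then have "r \<in> space (Pn 0)"
          using Lp[of 0] sets_eq_imp_space_eq[of "L 0" "Pn 0"] by (simp add: space_prob_algebra)
        then have "{u \<in> space SM. (r, u) \<in> {h \<in> space (Pn 0 \<Otimes>\<^sub>M SM). snd h = x}} = {x}"
          using x by (auto simp: space_pair_measure)
        then show "emeasure (\<tau> 0 r) {u \<in> space SM. (r, u) \<in> {h \<in> space (Pn 0 \<Otimes>\<^sub>M SM). snd h = x}} = 1"
          using singleton_sets[OF x] by (simp add: \<tau>_def)
      qed
    qed
    then have "AE \<omega> in P. hist 0 \<omega> \<in> {h \<in> space (Pn 0 \<Otimes>\<^sub>M SM). snd h = x}"
      unfolding HL[symmetric] hist_law_def by (rule AE_distrD[OF histP])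
    then show "AE \<omega> in P. fst (\<omega> 0) = x"
      by (rule AE_mp) (simp add: hist_def)
  next
    fix n A B assume A: "A \<in> sets (hist_M D n)" and B: "B \<in> sets CM"
    have "emeasure P {\<omega> \<in> space P. hist n \<omega> \<in> A \<and> snd (\<omega> n) \<in> B} =
        emeasure P ((\<lambda>\<omega>. (hist n \<omega>, snd (\<omega> n))) -` (A \<times> B) \<inter> space P)"
      by (rule arg_cong[where f="emeasure P"]) auto
    also have "\<dots> = emeasure (hist_ctrl_law P n) (A \<times> B)"
      unfolding hist_ctrl_law_def using A B measurable_hist_ctrl
      by (intro emeasure_distr[symmetric]) (auto simp: mP)
    also have "\<dots> = (\<integral>\<^sup>+h. emeasure (\<rho> n h) B * indicator A h \<partial>H n)"
      unfolding HC using A by (intro emeasure_joint_Times[OF Hp \<rho> _ B]) (simp add: hM)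
    also have "\<dots> = (\<integral>\<^sup>+\<omega>. emeasure (\<rho> n (hist n \<omega>)) B * indicator A (hist n \<omega>) \<partial>P)"
      unfolding HL[symmetric] hist_law_def
    proof (rule nn_integral_distr[OF histP])
      have "(\<lambda>h. emeasure (\<rho> n h) B) \<in> borel_measurable (hist_M D n)"
        unfolding hM by (rule measurable_compose[OF measurable_prob_algebraD[OF \<rho>] measurable_emeasure_subprob_algebra[OF B]])
      then show "(\<lambda>h. emeasure (\<rho> n h) B * indicator A h) \<in> borel_measurable (distr P (hist_M D n) (hist n))"
        using A by simp
    qed
    also have "\<dots> = (\<integral>\<^sup>+\<omega>. emeasure (\<pi> n (hist n \<omega>)) B * indicator A (hist n \<omega>) \<partial>P)"
    proof (rule nn_integral_cong_AE)
      have "AE h in H n. \<pi> n h = \<rho> n h" unfolding \<rho>_def by (rule sel(2)[OF Hp])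
      then have "AE \<omega> in P. \<pi> n (hist n \<omega>) = \<rho> n (hist n \<omega>)"
        unfolding HL[symmetric] hist_law_def by (rule AE_distrD[OF histP])
      then show "AE \<omega> in P. emeasure (\<rho> n (hist n \<omega>)) B * indicator A (hist n \<omega>) =
          emeasure (\<pi> n (hist n \<omega>)) B * indicator A (hist n \<omega>)" by (rule AE_mp) simp
    qed
    finally show "emeasure P {\<omega> \<in> space P. hist n \<omega> \<in> A \<and> snd (\<omega> n) \<in> B} =
        (\<integral>\<^sup>+\<omega>. emeasure (\<pi> n (hist n \<omega>)) B * indicator A (hist n \<omega>) \<partial>completion P)"
      by (simp only: nn_integral_completion)
  next
    fix n A B assume A: "A \<in> sets (hist_M D n \<Otimes>\<^sub>M CM)" and B: "B \<in> sets SM"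
    let ?g = "\<lambda>r. ((restrict r {..<n}, fst (r n)), snd (r n))"
    have comp: "(\<lambda>r. r n) \<in> Pn (Suc n) \<rightarrow>\<^sub>M SM \<Otimes>\<^sub>M CM"
      unfolding Pn_def by (rule measurable_component_singleton) simp
    have "(\<lambda>r. restrict r {..<n}) \<in> Pn (Suc n) \<rightarrow>\<^sub>M Pn n"
      unfolding Pn_def by (rule measurable_restrict_subset) auto
    then have g: "?g \<in> Pn (Suc n) \<rightarrow>\<^sub>M hist_M D n \<Otimes>\<^sub>M CM"
      unfolding hM by (intro measurable_Pair measurable_compose[OF comp measurable_fst]
        measurable_compose[OF comp measurable_snd])
    \<comment> \<open>The event of the second identity is an event of the history of length \<open>Suc n\<close>, whose law is known.\<close>
    define A' where "A' = ?g -` A \<inter> space (Pn (Suc n))"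
    have A': "A' \<in> sets (Pn (Suc n))" unfolding A'_def by (rule measurable_sets[OF g A])
    have A'r: "restrict \<omega> {..<Suc n} \<in> A' \<longleftrightarrow> (hist n \<omega>, snd (\<omega> n)) \<in> A" if "\<omega> \<in> space P" for \<omega> :: "nat \<Rightarrow> 'x \<times> 'u"
    proof -
      have "?g (restrict \<omega> {..<Suc n}) = (hist n \<omega>, snd (\<omega> n))"
        by (auto simp: hist_def fun_eq_iff)
      then show ?thesis
        unfolding A'_def using measurable_space[OF res that, of "Suc n"] by simp
    qed
    have "emeasure P {\<omega> \<in> space P. (hist n \<omega>, snd (\<omega> n)) \<in> A \<and> fst (\<omega> (Suc n)) \<in> B} =
        emeasure P (hist (Suc n) -` (A' \<times> B) \<inter> space P)"
      using A'r by (intro arg_cong[where f="emeasure P"]) (auto simp: hist_def[of "Suc n"])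
    also have "\<dots> = emeasure (hist_law P (Suc n)) (A' \<times> B)"
      unfolding hist_law_def using A' B
      by (intro emeasure_distr[OF histP, symmetric]) (simp add: hM)
    also have "\<dots> = (\<integral>\<^sup>+r. emeasure (\<tau> (Suc n) r) B * indicator A' r \<partial>L (Suc n))"
      unfolding HL H_def by (rule emeasure_joint_Times[OF Lp \<tau> A' B])
    also have "\<dots> = (\<integral>\<^sup>+\<omega>. emeasure (\<tau> (Suc n) (restrict \<omega> {..<Suc n})) B * indicator A' (restrict \<omega> {..<Suc n}) \<partial>P)"
      unfolding RL[symmetric]
    proof (rule nn_integral_distr[OF res])
      have "(\<lambda>h. emeasure (\<tau> (Suc n) h) B) \<in> borel_measurable (Pn (Suc n))"
        by (rule measurable_compose[OF measurable_prob_algebraD[OF \<tau>] measurable_emeasure_subprob_algebra[OF B]])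
      then show "(\<lambda>r. emeasure (\<tau> (Suc n) r) B * indicator A' r) \<in>
          borel_measurable (distr P (Pn (Suc n)) (\<lambda>\<omega>. restrict \<omega> {..<Suc n}))"
        using A' by simp
    qed
    also have "\<dots> = (\<integral>\<^sup>+\<omega>. emeasure (T (\<omega> n)) B * indicator A (hist n \<omega>, snd (\<omega> n)) \<partial>P)"
      by (rule nn_integral_cong) (simp add: \<tau>_def A'r indicator_def)
    finally show "emeasure P {\<omega> \<in> space P. (hist n \<omega>, snd (\<omega> n)) \<in> A \<and> fst (\<omega> (Suc n)) \<in> B} =
        (\<integral>\<^sup>+\<omega>. emeasure (T (\<omega> n)) B * indicator A (hist n \<omega>, snd (\<omega> n)) \<partial>P)" .
  qed (use pP sP in auto)
  then show ?thesis ..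
qed

lemma is_path_law_path_law:
  assumes "\<pi> \<in> policies D" "x \<in> states D"
  shows "is_path_law D \<pi> x (path_law D \<pi> x)"
proof -
  obtain P where P: "is_path_law D \<pi> x P" using path_law_exists[OF assms] ..
  then show ?thesis
    unfolding path_law_def by (rule theI) (rule path_law_unique[OF assms _ P])
qed

section \<open>Path laws: one-step identities and the optimal probability\<close>

text \<open>What a policy does with probability one after every history happens almost surely along its paths.
It is used for the feasibility of the controls and for the choices of a deterministic policy.\<close>

lemma AE_path_law_action:
  assumes \<pi>: "\<pi> \<in> policies D" and P: "is_path_law D \<pi> x P" and Z: "Z \<in> sets (SM \<Otimes>\<^sub>M CM)"
    and 1: "\<And>h. h \<in> space (hist_M D n) \<Longrightarrow> emeasure (\<pi> n h) {u \<in> space CM. (snd h, u) \<in> Z} = 1"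
  shows "AE \<omega> in P. \<omega> n \<in> Z"
proof -
  note pP = is_path_lawD(1)[OF P] and sP = is_path_lawD(2)[OF P]
  note laws = hist_laws_in_prob_algebra[OF pP sP, of n]
  obtain \<rho> where \<rho>: "\<rho> \<in> hist_M D n \<rightarrow>\<^sub>M prob_algebra CM" "AE h in hist_law P n. \<pi> n h = \<rho> h"
    by (rule policy_borel_modification[OF \<pi> laws(1)])
  have sp: "space (hist_law P n) = space (hist_M D n)" by (simp add: hist_law_def)
  define Z' where "Z' = (\<lambda>z. (snd (fst z), snd z)) -` Z \<inter> space (hist_M D n \<Otimes>\<^sub>M CM)"
  have "(\<lambda>z. (snd (fst z), snd z)) \<in> hist_M D n \<Otimes>\<^sub>M CM \<rightarrow>\<^sub>M SM \<Otimes>\<^sub>M CM"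
    unfolding hist_M_def by simp
  then have Z': "Z' \<in> sets (hist_M D n \<Otimes>\<^sub>M CM)" unfolding Z'_def using Z by (rule measurable_sets)
  have "AE z in hist_ctrl_law P n. z \<in> Z'"
    unfolding path_law_hist_ctrl[OF P \<rho>]
  proof (rule AE_joint[OF laws(1) \<rho>(1) Z'])
    show "AE h in hist_law P n. emeasure (\<rho> h) {u \<in> space CM. (h, u) \<in> Z'} = 1"
      using \<rho>(2)
    proof (rule AE_mp, intro AE_I2 impI)
      fix h assume h: "h \<in> space (hist_law P n)" and e: "\<pi> n h = \<rho> h"
      have "{u \<in> space CM. (h, u) \<in> Z'} = {u \<in> space CM. (snd h, u) \<in> Z}"
        using h by (auto simp: Z'_def space_pair_measure sp)
      with 1[of h] h e show "emeasure (\<rho> h) {u \<in> space CM. (h, u) \<in> Z'} = 1" by (simp add: sp)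
    qed
  qed
  then have "AE \<omega> in P. (hist n \<omega>, snd (\<omega> n)) \<in> Z'"
    unfolding hist_ctrl_law_def using measurable_hist_ctrl
    by (intro AE_distrD[of "\<lambda>\<omega>. (hist n \<omega>, snd (\<omega> n))" P]) (simp_all add: measurable_cong_sets[OF sP refl])
  then show ?thesis by (rule AE_mp) (simp add: Z'_def hist_def)
qed

text \<open>The Markov property of the transition: on events decided by the history and the control at time
\<open>n\<close>, the next state may be integrated out with the transition kernel.\<close>

lemma nn_integral_next_state:
  assumes P: "is_path_law D \<pi> x P" and A: "A \<in> sets (hist_M D n \<Otimes>\<^sub>M CM)"
    and g: "g \<in> borel_measurable SM"
  shows "(\<integral>\<^sup>+\<omega>. indicator A (hist n \<omega>, snd (\<omega> n)) * g (fst (\<omega> (Suc n))) \<partial>P) =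
    (\<integral>\<^sup>+\<omega>. indicator A (hist n \<omega>, snd (\<omega> n)) * (\<integral>\<^sup>+y. g y \<partial>T (\<omega> n)) \<partial>P)"
proof -
  note pP = is_path_lawD(1)[OF P] and sP = is_path_lawD(2)[OF P]
  note laws = hist_laws_in_prob_algebra[OF pP sP, of n]
  note mP = measurable_cong_sets[OF sP refl]
  let ?M = "hist_M D n \<Otimes>\<^sub>M CM"
  have f: "(\<lambda>z. indicator A (fst z) * g (snd z)) \<in> borel_measurable (?M \<Otimes>\<^sub>M SM)"
    using A measurable_compose[OF measurable_snd g, of ?M]
    by (intro borel_measurable_times_ennreal measurable_compose[OF measurable_fst borel_measurable_indicator]) auto
  have h: "(\<lambda>z. \<integral>\<^sup>+y. g y \<partial>T (snd (fst z), snd z)) \<in> borel_measurable ?M"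
    by (rule measurable_compose[OF measurable_prob_algebraD[OF trans_kernel_measurable']
          nn_integral_measurable_subprob_algebra[OF g]])
  have "(\<integral>\<^sup>+\<omega>. indicator A (hist n \<omega>, snd (\<omega> n)) * g (fst (\<omega> (Suc n))) \<partial>P) =
      (\<integral>\<^sup>+z. indicator A (fst z) * g (snd z) \<partial>hist_ctrl_state_law P n)"
    unfolding hist_ctrl_state_law_def
    by (subst nn_integral_distr) (use measurable_hist_ctrl_state f in \<open>simp_all add: mP\<close>)
  also have "\<dots> = (\<integral>\<^sup>+z. (\<integral>\<^sup>+y. indicator A z * g y \<partial>T (snd (fst z), snd z)) \<partial>hist_ctrl_law P n)"
    unfolding path_law_hist_ctrl_state[OF P]
    by (subst nn_integral_joint[OF laws(2) trans_kernel_measurable' f]) simp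
  also have "\<dots> = (\<integral>\<^sup>+z. indicator A z * (\<integral>\<^sup>+y. g y \<partial>T (snd (fst z), snd z)) \<partial>hist_ctrl_law P n)"
  proof (rule nn_integral_cong)
    fix z assume "z \<in> space (hist_ctrl_law P n)"
    then have "z \<in> space ?M" by (simp add: hist_ctrl_law_def)
    from measurable_space[OF trans_kernel_measurable' this]
    have "sets (T (snd (fst z), snd z)) = sets SM" by (simp add: space_prob_algebra)
    then show "(\<integral>\<^sup>+y. indicator A z * g y \<partial>T (snd (fst z), snd z)) =
        indicator A z * (\<integral>\<^sup>+y. g y \<partial>T (snd (fst z), snd z))"
      using g by (intro nn_integral_cmult) (simp cong: measurable_cong_sets)
  qed
  also have "\<dots> = (\<integral>\<^sup>+\<omega>. indicator A (hist n \<omega>, snd (\<omega> n)) * (\<integral>\<^sup>+y. g y \<partial>T (\<omega> n)) \<partial>P)"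
    unfolding hist_ctrl_law_def
  proof (subst nn_integral_distr)
    show "(\<lambda>z. indicator A z * (\<integral>\<^sup>+y. g y \<partial>T (snd (fst z), snd z)))
        \<in> borel_measurable (distr P ?M (\<lambda>\<omega>. (hist n \<omega>, snd (\<omega> n))))"
      using A h by simp
  qed (use measurable_hist_ctrl in \<open>simp_all add: mP hist_def\<close>)
  finally show ?thesis .
qed

lemma safe_sets:
  assumes "S \<in> sets SM" shows "safe D n S \<in> sets (path_M D)"
proof -
  have "safe D n S = space (path_M D) \<inter>
      (\<Inter>k. if enat k \<le> n then (\<lambda>\<omega>. fst (\<omega> k)) -` S \<inter> space (path_M D) else space (path_M D))"
    by (auto simp: safe_def)
  also have "\<dots> \<in> sets (path_M D)"
    using measurable_sets[OF measurable_fst_component assms]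
    by (intro sets.Int sets.top sets.countable_INT) auto
  finally show ?thesis .
qed

lemma prob_space_path_law:
  assumes "\<pi> \<in> policies D" "x \<in> states D"
  shows "prob_space (path_law D \<pi> x)" "sets (path_law D \<pi> x) = sets (path_M D)"
  using is_path_lawD(1,2)[OF is_path_law_path_law[OF assms]] .

lemma max_prob_upper:
  assumes "\<pi> \<in> policies D" "x \<in> states D"
  shows "measure (path_law D \<pi> x) A \<le> max_prob D x A"
  unfolding max_prob_def using assms prob_space.prob_le_1[OF prob_space_path_law(1)]
  by (intro cSUP_upper bdd_aboveI[of _ 1]) auto

lemma max_prob_least:
  assumes "policies D \<noteq> {}" "\<And>\<pi>. \<pi> \<in> policies D \<Longrightarrow> measure (path_law D \<pi> x) A \<le> c"
  shows "max_prob D x A \<le> c"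
  unfolding max_prob_def using assms by (rule cSUP_least)

lemma max_prob_le_1:
  assumes "policies D \<noteq> {}" "x \<in> states D" shows "max_prob D x A \<le> 1"
  using assms prob_space.prob_le_1[OF prob_space_path_law(1)] by (intro max_prob_least) auto

lemma deterministic_stationary_policy:
  assumes f: "f \<in> SM \<rightarrow>\<^sub>M CM" and feas: "\<And>x. x \<in> states D \<Longrightarrow> f x \<in> feasible_at D x"
    and F: "\<And>x. x \<in> states D \<Longrightarrow> feasible_at D x \<in> sets CM"
  shows "(\<lambda>n h. return CM (f (snd h))) \<in> policies D"
  unfolding policies_def
proof (intro CollectI allI conjI ballI)
  fix n
  have "(\<lambda>h. return CM (f (snd h))) \<in> hist_M D n \<rightarrow>\<^sub>M prob_algebra CM"
    unfolding hist_M_def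
    by (intro measurable_compose[OF _ measurable_return_prob_space] measurable_compose[OF measurable_snd f])
  moreover have "hist_M D n \<rightarrow>\<^sub>M prob_algebra CM \<subseteq> universal_completion (hist_M D n) \<rightarrow>\<^sub>M prob_algebra CM"
  proof (rule measurable_mono)
    show "sets (hist_M D n) \<subseteq> sets (universal_completion (hist_M D n))"
      using sets.sets_into_space[of _ "hist_M D n"]
      by (auto simp: sets_universal_completion space_prob_algebra)
  qed (simp_all add: space_universal_completion)
  ultimately show "(\<lambda>h. return CM (f (snd h))) \<in> universal_completion (hist_M D n) \<rightarrow>\<^sub>M prob_algebra CM"
    by blast
  fix h assume "h \<in> space (hist_M D n)"
  then have "snd h \<in> states D" by (auto simp: hist_M_def space_pair_measure)
  with F feas show "emeasure (completion (return CM (f (snd h)))) (feasible_at D (snd h)) = 1"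
    by simp
qed

end

section \<open>Value iteration for safety on a compact set\<close>

locale compact_safety =
  fixes D :: "('x, 'u) cdt_mp" and S :: "'x set"
  assumes cont: "continuous_cdt_mp D" and S: "compactin (state_sp D) S"
begin

sublocale cdt_mp D
  using cont by unfold_locales (simp add: continuous_cdt_mp_def)

abbreviation "X \<equiv> state_sp D"
abbreviation "U \<equiv> ctrl_sp D"

lemma U_compact: "compact_space U" and K_closed: "closedin (prod_topology X U) (feasible D)"
  and T_continuous: "continuous_map (subtopology (prod_topology X U) (feasible D)) (weak_topology X) T"
  using cont by (auto simp: continuous_cdt_mp_def)

lemma X_metrizable: "metrizable_space X" by (rule borel_space_metrizable[OF states_borel])

lemma S_closed: "closedin X S"
  using compactin_imp_closedin[OF metrizable_imp_Hausdorff_space[OF X_metrizable] S] .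

lemma S_subset: "S \<subseteq> states D" by (rule closedin_subset[OF S_closed])

lemma S_sets: "S \<in> sets SM" by (rule closedin_sets_borel_of[OF S_closed])

lemma feasible_sets: "feasible D \<in> sets (SM \<Otimes>\<^sub>M CM)"
  by (intro closedin_prod_sets_pair K_closed borel_space_second_countable states_borel ctrl_borel)

lemma feasible_at_sets: "x \<in> states D \<Longrightarrow> feasible_at D x \<in> sets CM"
  unfolding feasible_at_def
  by (intro closedin_sets_borel_of compact_section(1)[OF U_compact K_closed])

lemma feasible_atD:
  assumes "x \<in> states D" "u \<in> feasible_at D x"
  shows "(x, u) \<in> feasible D" "prob_space (T (x, u))" "sets (T (x, u)) = sets SM" "space (T (x, u)) = states D"
proof -
  show "(x, u) \<in> feasible D" using assms(2) by (simp add: feasible_at_def)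
  have "(x, u) \<in> space (SM \<Otimes>\<^sub>M CM)"
    using assms by (simp add: feasible_at_def space_pair_measure)
  from measurable_space[OF trans_kernel_measurable this]
  show "prob_space (T (x, u))" and s: "sets (T (x, u)) = sets SM"
    by (simp_all add: space_prob_algebra)
  show "space (T (x, u)) = states D" using sets_eq_imp_space_eq[OF s] by simp
qed

text \<open>The functions on which value iteration operates. Vanishing outside the closed set \<open>S\<close> keeps a
nonnegative function upper semicontinuous on all of \<open>X\<close>, and makes integrals over \<open>S\<close> integrals
over \<open>X\<close>.\<close>

definition usc_reward :: "('x \<Rightarrow> real) \<Rightarrow> bool" where
  "usc_reward g \<longleftrightarrow> usc_on X g \<and> (\<forall>x. 0 \<le> g x \<and> g x \<le> 1) \<and> (\<forall>x. x \<notin> S \<longrightarrow> g x = 0)"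

text \<open>The safety operator on Borel rewards: integrals over the whole space, extended by \<open>0\<close> to the states
outside \<open>S\<close>.\<close>

definition bellman :: "('x \<Rightarrow> real) \<Rightarrow> 'x \<Rightarrow> real" where
  "bellman g x = (if x \<in> S then (SUP u \<in> feasible_at D x. \<integral>y. g y \<partial>T (x, u)) else 0)"

lemma usc_rewardD:
  assumes "usc_reward g"
  shows "usc_on X g" "0 \<le> g x" "g x \<le> 1" "x \<notin> S \<Longrightarrow> g x = 0" "g \<in> borel_measurable SM"
  using assms usc_on_borel_measurable[of X g] by (auto simp: usc_reward_def)

lemma usc_reward_integral:
  assumes g: "usc_reward g" and xu: "x \<in> states D" "u \<in> feasible_at D x"
  shows "integrable (T (x, u)) g" "0 \<le> (\<integral>y. g y \<partial>T (x, u))" "(\<integral>y. g y \<partial>T (x, u)) \<le> 1"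
proof -
  interpret prob_space "T (x, u)" by (rule feasible_atD(2)[OF xu])
  have "g \<in> borel_measurable (T (x, u))"
    using usc_rewardD(5)[OF g] by (simp add: measurable_cong_sets[OF feasible_atD(3)[OF xu] refl])
  then show i: "integrable (T (x, u)) g"
    using usc_rewardD(2,3)[OF g] by (intro integrable_const_bound[of _ 1]) auto
  show "0 \<le> (\<integral>y. g y \<partial>T (x, u))" using usc_rewardD(2)[OF g] by (intro integral_nonneg_AE) simp
  have "(\<integral>y. g y \<partial>T (x, u)) \<le> (\<integral>y. 1 \<partial>T (x, u))"
    using usc_rewardD(3)[OF g] i by (intro integral_mono) auto
  then show "(\<integral>y. g y \<partial>T (x, u)) \<le> 1" by (simp add: prob_space)
qed

lemma usc_reward_usc_integral:
  assumes "usc_reward g"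
  shows "usc_on (subtopology (prod_topology X U) (feasible D)) (\<lambda>z. \<integral>y. g y \<partial>T z)"
  using usc_rewardD[OF assms] by (intro usc_on_weak_integral[OF X_metrizable T_continuous]) auto

lemma integral_feasible_le_1:
  assumes "usc_reward g" "z \<in> feasible D" shows "(\<integral>y. g y \<partial>T z) \<le> 1"
proof -
  obtain x u where z: "z = (x, u)" "x \<in> states D" "u \<in> feasible_at D x"
    using assms(2) feasible_subset by (cases z) (auto simp: feasible_at_def)
  show ?thesis unfolding z(1) by (rule usc_reward_integral(3)[OF assms(1) z(2,3)])
qed

lemma bellman_attained:
  assumes g: "usc_reward g" and x: "x \<in> S"
  obtains u where "u \<in> feasible_at D x" "bellman g x = (\<integral>y. g y \<partial>T (x, u))"
proof -
  have xX: "x \<in> states D" using x S_subset by blast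
  show ?thesis
  proof (rule section_attains_max[OF U_compact K_closed xX _ usc_reward_usc_integral[OF g] integral_feasible_le_1[OF g]])
    show "{u \<in> topspace U. (x, u) \<in> feasible D} \<noteq> {}"
      using feasible_at_nonempty[OF xX] by (simp add: feasible_at_def)
    fix u assume "u \<in> topspace U" "(x, u) \<in> feasible D"
      "(SUP u \<in> {u \<in> topspace U. (x, u) \<in> feasible D}. \<integral>y. g y \<partial>T (x, u)) = (\<integral>y. g y \<partial>T (x, u))"
    with x show thesis by (intro that[of u]) (simp_all add: feasible_at_def bellman_def)
  qed
qed

lemma bellman_upper:
  assumes g: "usc_reward g" and x: "x \<in> S" and u: "u \<in> feasible_at D x"
  shows "(\<integral>y. g y \<partial>T (x, u)) \<le> bellman g x"
proof -
  have xX: "x \<in> states D" using x S_subset by blast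
  have "bdd_above ((\<lambda>u. \<integral>y. g y \<partial>T (x, u)) ` feasible_at D x)"
    using usc_reward_integral(3)[OF g xX] by (intro bdd_aboveI[of _ 1]) auto
  with u have "(\<integral>y. g y \<partial>T (x, u)) \<le> (SUP u \<in> feasible_at D x. \<integral>y. g y \<partial>T (x, u))"
    by (rule cSUP_upper)
  then show ?thesis using x by (simp add: bellman_def)
qed

lemma usc_reward_bellman:
  assumes g: "usc_reward g" shows "usc_reward (bellman g)"
  unfolding usc_reward_def
proof (intro conjI allI impI)
  let ?s = "\<lambda>x. SUP u \<in> {u \<in> topspace U. (x, u) \<in> feasible D}. \<integral>y. g y \<partial>T (x, u)"
  have b: "0 \<le> bellman g x \<and> bellman g x \<le> 1" for x
  proof (cases "x \<in> S")
    case True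
    then obtain u where "u \<in> feasible_at D x" "bellman g x = (\<integral>y. g y \<partial>T (x, u))"
      by (rule bellman_attained[OF g])
    moreover have "x \<in> states D" using True S_subset by blast
    ultimately show ?thesis using usc_reward_integral(2,3)[OF g] by simp
  qed (simp add: bellman_def)
  then show "0 \<le> bellman g x" "bellman g x \<le> 1" for x by auto
  show "bellman g x = 0" if "x \<notin> S" for x using that by (simp add: bellman_def)
  have usc: "usc_on X ?s"
    using feasible_at_nonempty integral_feasible_le_1[OF g] unfolding feasible_at_def
    by (intro usc_on_section_SUP[OF U_compact K_closed _ usc_reward_usc_integral[OF g]]) auto
  show "usc_on X (bellman g)"
    unfolding usc_on_def
  proof
    fix c :: real
    show "closedin X {x \<in> states D. c \<le> bellman g x}"
    proof (cases "c \<le> 0")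
      \<comment> \<open>For \<open>c \<le> 0\<close> the superlevel set is everything, because the function is nonnegative.\<close>
      case True
      then have "{x \<in> states D. c \<le> bellman g x} = states D" using b order_trans by blast
      then show ?thesis by simp
    next
      case False
      then have "{x \<in> states D. c \<le> bellman g x} = S \<inter> {x \<in> states D. c \<le> ?s x}"
        using S_subset by (auto simp: bellman_def feasible_at_def split: if_splits)
      then show ?thesis using closedin_Int[OF S_closed usc_onD[OF usc]] by simp
    qed
  qed
qed

lemma bellman_mono:
  assumes "usc_reward g" "usc_reward h" "\<And>x. g x \<le> h x"
  shows "bellman g x \<le> bellman h x"
proof (cases "x \<in> S")
  case True
  then have xX: "x \<in> states D" using S_subset by blast
  obtain u where u: "u \<in> feasible_at D x" "bellman g x = (\<integral>y. g y \<partial>T (x, u))"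
    by (rule bellman_attained[OF assms(1) True])
  note u(2)
  also have "(\<integral>y. g y \<partial>T (x, u)) \<le> (\<integral>y. h y \<partial>T (x, u))"
    using usc_reward_integral(1)[OF _ xX u(1)] assms by (intro integral_mono) auto
  also have "\<dots> \<le> bellman h x" by (rule bellman_upper[OF assms(2) True u(1)])
  finally show ?thesis .
qed (simp add: bellman_def)

definition val :: "nat \<Rightarrow> 'x \<Rightarrow> real" where
  "val n = (bellman ^^ n) (indicator S)"

lemma val_0: "val 0 = indicator S" and val_Suc: "val (Suc n) = bellman (val n)"
  by (simp_all add: val_def)

lemma usc_reward_val: "usc_reward (val n)"
proof (induction n)
  case 0
  have "closedin X {x \<in> states D. c \<le> indicator S x}" for c :: real
  proof -
    have "{x \<in> states D. c \<le> indicator S x} = (if c \<le> 0 then states D else if c \<le> 1 then S else {})"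
      using S_subset by (auto simp: indicator_def split: if_splits)
    then show ?thesis using S_closed by simp
  qed
  then show ?case by (simp add: val_0 usc_reward_def usc_on_def)
qed (simp add: val_Suc usc_reward_bellman)

lemma val_Suc_le: "val (Suc n) x \<le> val n x"
proof (induction n arbitrary: x)
  case 0
  show ?case
    using usc_rewardD(3,4)[OF usc_reward_val[of "Suc 0"]] by (cases "x \<in> S") (simp_all add: val_0)
next
  case (Suc n)
  show ?case
    unfolding val_Suc[of "Suc n"] val_Suc[of n]
    by (rule bellman_mono) (use usc_reward_val usc_reward_bellman Suc in \<open>simp_all add: val_Suc\<close>)
qed

definition val_inf :: "'x \<Rightarrow> real" where "val_inf x = (INF n. val n x)"

lemma val_tendsto: "(\<lambda>n. val n x) \<longlonglongrightarrow> val_inf x"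
  unfolding val_inf_def
proof (rule LIMSEQ_decseq_INF)
  show "bdd_below (range (\<lambda>n. val n x))"
    using usc_rewardD(2)[OF usc_reward_val] by (intro bdd_belowI[of _ 0]) auto
  show "decseq (\<lambda>n. val n x)" by (rule decseq_SucI) (rule val_Suc_le)
qed

lemma val_inf_le: "val_inf x \<le> val n x"
  unfolding val_inf_def using usc_rewardD(2)[OF usc_reward_val]
  by (intro cINF_lower bdd_belowI[of _ 0]) auto

lemma usc_reward_val_inf: "usc_reward val_inf"
  unfolding usc_reward_def
proof (intro conjI allI impI)
  show "usc_on X val_inf"
    by (rule usc_on_limit[OF usc_rewardD(1)[OF usc_reward_val] val_inf_le val_tendsto])
  show "0 \<le> val_inf x" for x
    by (rule LIMSEQ_le_const[OF val_tendsto]) (simp add: usc_rewardD(2)[OF usc_reward_val])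
  show "val_inf x \<le> 1" for x
    by (rule order_trans[OF val_inf_le usc_rewardD(3)[OF usc_reward_val]])
  show "val_inf x = 0" if "x \<notin> S" for x
    using usc_rewardD(4)[OF usc_reward_val that] by (simp add: val_inf_def)
qed

text \<open>One inequality is monotonicity. For the other, the controls \<open>u\<close> at \<open>x\<close> with
\<open>\<integral> val n dT(\<cdot>|x,u) \<ge> val_inf x\<close> form nonempty closed sets that decrease with \<open>n\<close>. A common element
satisfies the same inequality with \<open>val_inf\<close> in place of \<open>val n\<close>, by dominated convergence.\<close>

lemma bellman_val_inf: "bellman val_inf = val_inf"
proof (rule ext, rule antisym)
  fix x
  show "bellman val_inf x \<le> val_inf x"
    unfolding val_inf_def[of x]
  proof (rule cINF_greatest)
    fix n
    have "bellman val_inf x \<le> bellman (val n) x"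
      by (rule bellman_mono[OF usc_reward_val_inf usc_reward_val val_inf_le])
    also have "\<dots> \<le> val n x" unfolding val_Suc[symmetric] by (rule val_Suc_le)
    finally show "bellman val_inf x \<le> val n x" .
  qed simp
  show "val_inf x \<le> bellman val_inf x"
  proof (cases "x \<in> S")
    case True
    then have xX: "x \<in> states D" using S_subset by blast
    let ?J = "\<lambda>n. {z \<in> topspace (subtopology (prod_topology X U) (feasible D)). val_inf x \<le> (\<integral>y. val n y \<partial>T z)}"
    let ?C = "\<lambda>n. {u \<in> topspace U. (x, u) \<in> ?J n}"
    have C: "?C n = {u \<in> feasible_at D x. val_inf x \<le> (\<integral>y. val n y \<partial>T (x, u))}" for n
      using xX by (auto simp: feasible_at_def)
    have "(\<Inter>n. ?C n) \<noteq> {}"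
    proof (rule compact_space_imp_nest[OF U_compact])
      fix n
      have "closedin (prod_topology X U) (?J n)"
        by (rule closedin_trans_full[OF usc_onD[OF usc_reward_usc_integral[OF usc_reward_val]] K_closed])
      then show "closedin U (?C n)" by (rule compact_section(1)[OF U_compact _ xX])
      obtain u where "u \<in> feasible_at D x" "bellman (val n) x = (\<integral>y. val n y \<partial>T (x, u))"
        by (rule bellman_attained[OF usc_reward_val True])
      moreover have "val_inf x \<le> bellman (val n) x"
        unfolding val_Suc[symmetric] by (rule val_inf_le)
      ultimately show "?C n \<noteq> {}" unfolding C by auto
    next
      show "decseq ?C"
        unfolding C
      proof (rule decseq_SucI, rule subsetI)
        fix n u assume "u \<in> {u \<in> feasible_at D x. val_inf x \<le> (\<integral>y. val (Suc n) y \<partial>T (x, u))}"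
        then have u: "u \<in> feasible_at D x" "val_inf x \<le> (\<integral>y. val (Suc n) y \<partial>T (x, u))" by auto
        note u(2)
        also have "(\<integral>y. val (Suc n) y \<partial>T (x, u)) \<le> (\<integral>y. val n y \<partial>T (x, u))"
          using usc_reward_integral(1)[OF usc_reward_val xX u(1)] val_Suc_le by (intro integral_mono) auto
        finally show "u \<in> {u \<in> feasible_at D x. val_inf x \<le> (\<integral>y. val n y \<partial>T (x, u))}"
          using u(1) by simp
      qed
    qed
    then obtain u where "\<And>n. u \<in> ?C n" by blast
    then have u: "u \<in> feasible_at D x" "\<And>n. val_inf x \<le> (\<integral>y. val n y \<partial>T (x, u))"
      unfolding C by auto
    interpret prob_space "T (x, u)" by (rule feasible_atD(2)[OF xX u(1)])
    have "(\<lambda>n. \<integral>y. val n y \<partial>T (x, u)) \<longlonglongrightarrow> (\<integral>y. val_inf y \<partial>T (x, u))"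
    proof (rule integral_dominated_convergence[where w="\<lambda>_. 1"])
      show "val_inf \<in> borel_measurable (T (x, u))" "val n \<in> borel_measurable (T (x, u))" for n
        using usc_reward_integral(1)[OF usc_reward_val_inf xX u(1)] usc_reward_integral(1)[OF usc_reward_val xX u(1)]
        by auto
      show "AE y in T (x, u). (\<lambda>n. val n y) \<longlonglongrightarrow> val_inf y" by (simp add: val_tendsto)
      show "AE y in T (x, u). norm (val n y) \<le> 1" for n
        using usc_rewardD(2,3)[OF usc_reward_val[of n]] by simp
    qed simp
    then have "val_inf x \<le> (\<integral>y. val_inf y \<partial>T (x, u))"
      by (rule LIMSEQ_le_const) (use u(2) in blast)
    also have "\<dots> \<le> bellman val_inf x" by (rule bellman_upper[OF usc_reward_val_inf True u(1)])
    finally show ?thesis .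
  next
    case False
    then show ?thesis using usc_rewardD(4)[OF usc_reward_val_inf] by (simp add: bellman_def)
  qed
qed

section \<open>Bounded fixpoints of the safety operator\<close>

lemma safe_op_restrict:
  assumes g: "usc_reward g"
  shows "safe_op D S (restrict g S) = restrict (bellman g) S"
proof (rule ext)
  fix x
  show "safe_op D S (restrict g S) x = restrict (bellman g) S x"
  proof (cases "x \<in> S")
    case True
    then have xX: "x \<in> states D" using S_subset by blast
    have e: "(\<lambda>y. indicator S y *\<^sub>R restrict g S y) = g"
      using usc_rewardD(4)[OF g] by (auto simp: fun_eq_iff indicator_def)
    have "(LINT y : S | completion (T (x, u)). restrict g S y) = (\<integral>y. g y \<partial>T (x, u))"
      if "u \<in> feasible_at D x" for u
      unfolding set_lebesgue_integral_def e
      using usc_reward_integral(1)[OF g xX that] by (intro integral_completion) auto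
    then show ?thesis using True by (simp add: safe_op_def bellman_def)
  qed (simp add: safe_op_def)
qed

text \<open>An upper semicontinuous function is Borel, so its superlevel sets are Borel and hence analytic.\<close>

lemma restrict_bounded_usa:
  assumes g: "usc_reward g" shows "restrict g S \<in> bounded_usa X S"
  unfolding bounded_usa_def
proof (intro CollectI conjI allI)
  show "bounded (restrict g S ` S)"
    using usc_rewardD(2,3)[OF g] by (auto simp: bounded_iff intro!: exI[of _ 1])
  fix c
  have "{x \<in> S. c < restrict g S x} = S \<inter> {x \<in> space SM. c < g x}" using S_subset by auto
  moreover have "\<dots> \<in> sets SM"
    using usc_rewardD(5)[OF g] S_sets by (intro sets.Int) (simp_all only: borel_measurable_iff_greater)
  ultimately show "analytic_in (subtopology X S) {x \<in> S. c < restrict g S x}"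
    by (intro borel_subset_analytic[OF states_borel]) auto
qed simp

text \<open>The integral of \<open>f\<close> is at most that of any integrable majorant of \<open>\<bar>f\<bar>\<close>, whether or not \<open>f\<close> is
measurable, because the Bochner integral of a function that is not integrable is \<open>0\<close>. Thus the
bound \<open>R * val n\<close> passes through the operator.\<close>

lemma fixpoint_le_val:
  assumes f: "safe_op D S f = f" and R: "\<And>x. x \<in> S \<Longrightarrow> \<bar>f x\<bar> \<le> R" and x: "x \<in> S"
  shows "\<bar>f x\<bar> \<le> R * val n x"
  using x
proof (induction n arbitrary: x)
  case 0
  then show ?case using R by (simp add: val_0)
next
  case (Suc n)
  then have xX: "x \<in> states D" using S_subset by blast
  have R0: "0 \<le> R" using R[OF Suc.prems] by linarith
  have "\<bar>LINT y : S | completion (T (x, u)). f y\<bar> \<le> R * val (Suc n) x" if u: "u \<in> feasible_at D x" for u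
  proof -
    have i: "integrable (T (x, u)) (\<lambda>y. R * val n y)"
      using usc_reward_integral(1)[OF usc_reward_val xX u] by simp
    have eq: "(\<integral>y. R * val n y \<partial>completion (T (x, u))) = R * (\<integral>y. val n y \<partial>T (x, u))"
      using i by (subst integral_completion) auto
    have "\<bar>LINT y : S | completion (T (x, u)). f y\<bar> \<le> (\<integral>y. R * val n y \<partial>completion (T (x, u)))"
    proof -
      let ?F = "\<lambda>y. indicator S y *\<^sub>R f y"
      have "norm (\<integral>y. ?F y \<partial>completion (T (x, u))) \<le> (\<integral>y. norm (?F y) \<partial>completion (T (x, u)))"
        by (rule integral_norm_bound)
      also have "\<dots> \<le> (\<integral>y. R * val n y \<partial>completion (T (x, u)))"
      proof (rule integral_mono')
        show "integrable (completion (T (x, u))) (\<lambda>y. R * val n y)"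
          using i by (subst integrable_completion) auto
        show "norm (?F y) \<le> R * val n y" for y
          using Suc.IH[of y] R0 usc_rewardD(2)[OF usc_reward_val, of n y] by (cases "y \<in> S") auto
        show "0 \<le> R * val n y" for y
          using R0 usc_rewardD(2)[OF usc_reward_val, of n y] by simp
      qed
      finally show ?thesis by (simp add: set_lebesgue_integral_def)
    qed
    also note eq
    also have "R * (\<integral>y. val n y \<partial>T (x, u)) \<le> R * val (Suc n) x"
      unfolding val_Suc using bellman_upper[OF usc_reward_val Suc.prems u] R0 by (rule mult_left_mono)
    finally show ?thesis .
  qed
  then have "\<bar>SUP u \<in> feasible_at D x. LINT y : S | completion (T (x, u)). f y\<bar> \<le> R * val (Suc n) x"
    using feasible_at_nonempty[OF xX] by (intro cSup_abs_le) auto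
  moreover have "f x = (SUP u \<in> feasible_at D x. LINT y : S | completion (T (x, u)). f y)"
    using fun_cong[OF f, of x] Suc.prems by (simp add: safe_op_def)
  ultimately show ?case by simp
qed

lemma fixpoint_le_val_inf:
  assumes "safe_op D S f = f" "\<And>x. x \<in> S \<Longrightarrow> \<bar>f x\<bar> \<le> R" "x \<in> S"
  shows "\<bar>f x\<bar> \<le> R * val_inf x"
  by (rule LIMSEQ_le_const[OF tendsto_mult_left[OF val_tendsto]])
    (use fixpoint_le_val[OF assms] in blast)

lemma val_inf_fixpoint: "safe_op D S (restrict val_inf S) = restrict val_inf S"
  by (simp add: safe_op_restrict[OF usc_reward_val_inf] bellman_val_inf)

lemma usc_reward_zero: "usc_reward (\<lambda>_. 0)"
proof -
  have "{x \<in> states D. c \<le> (0::real)} = (if c \<le> 0 then states D else {})" for c by auto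
  then show ?thesis by (simp add: usc_reward_def usc_on_def)
qed

lemma zero_fixpoint: "safe_op D S (restrict (\<lambda>_. 0) S) = restrict (\<lambda>_. 0) S"
proof -
  have "bellman (\<lambda>_. 0) x = 0" for x
    using feasible_at_nonempty[of x] S_subset by (auto simp: bellman_def)
  then show ?thesis by (simp add: safe_op_restrict[OF usc_reward_zero] cong: restrict_cong)
qed

text \<open>If every set \<open>{val n \<ge> 1}\<close> were nonempty, these nested closed subsets of the compact set \<open>S\<close> would
have a common point, at which \<open>val_inf\<close> is \<open>1\<close>. So \<open>val n < 1\<close> on \<open>S\<close> for some \<open>n\<close>, and the
maximum of \<open>val n\<close> serves as \<open>c\<close>.\<close>

lemma val_uniformly_less_1:
  assumes "\<And>x. val_inf x < 1"
  obtains n c where "0 \<le> c" "c < 1" "\<And>x. val n x \<le> c"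
proof (cases "S = {}")
  case True
  then have "val 0 x \<le> 0" for x unfolding val_0 by simp
  then show ?thesis by (intro that[of 0 0]) auto
next
  case False
  let ?Y = "subtopology X S"
  have Y: "compact_space ?Y" "topspace ?Y = S"
    using S S_subset by (auto simp: compact_space_subtopology)
  have usc: "usc_on ?Y (val n)" for n
    using usc_on_compose[OF usc_rewardD(1)[OF usc_reward_val], of ?Y "\<lambda>x. x" n]
      continuous_map_from_subtopology[OF continuous_map_id, of X S] by (simp add: id_def)
  have "\<exists>n. {x \<in> S. 1 \<le> val n x} = {}"
  proof (rule ccontr)
    assume n: "\<nexists>n. {x \<in> S. 1 \<le> val n x} = {}"
    have "(\<Inter>n. {x \<in> S. 1 \<le> val n x}) \<noteq> {}"
    proof (rule compact_space_imp_nest[OF Y(1)])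
      show "closedin ?Y {x \<in> S. 1 \<le> val n x}" for n
        using usc_onD[OF usc[of n], of 1] unfolding Y(2) .
      show "{x \<in> S. 1 \<le> val n x} \<noteq> {}" for n using n by blast
      show "decseq (\<lambda>n. {x \<in> S. 1 \<le> val n x})"
        by (rule decseq_SucI) (use val_Suc_le in \<open>force intro: order_trans\<close>)
    qed
    then obtain x where "\<And>n. 1 \<le> val n x" by auto
    then have "1 \<le> val_inf x" by (intro LIMSEQ_le_const[OF val_tendsto]) simp
    with assms[of x] show False by simp
  qed
  then obtain n where n: "{x \<in> S. 1 \<le> val n x} = {}" ..
  show ?thesis
  proof (rule usc_on_attains_max[OF Y(1) _ usc[of n], of 1, unfolded Y(2)])
    show "S \<noteq> {}" by (rule False)
    show "val n y \<le> 1" for y by (rule usc_rewardD(3)[OF usc_reward_val])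
    fix y assume y: "y \<in> S" "\<And>z. z \<in> S \<Longrightarrow> val n z \<le> val n y"
    have "val n z \<le> val n y" for z
      using y(2)[of z] usc_rewardD(2,4)[OF usc_reward_val[of n]] by (cases "z \<in> S") auto
    then show thesis
      using n y(1) usc_rewardD(2)[OF usc_reward_val[of n]] by (intro that[of "val n y" n]) (auto simp: not_le)
  qed
qed

text \<open>With the constant \<open>c\<close> that bounds some \<open>val n\<close>, the fixpoint \<open>val_inf\<close> is bounded by \<open>c\<close>, hence by
\<open>c * val_inf\<close>.\<close>

lemma val_inf_zero:
  assumes "\<And>x. val_inf x < 1"
  shows "val_inf x = 0"
proof (cases "x \<in> S")
  case True
  obtain n c where c: "0 \<le> c" "c < 1" "\<And>x. val n x \<le> c"
    by (rule val_uniformly_less_1[OF assms]) (rule that)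
  have "\<bar>restrict val_inf S x\<bar> \<le> c * val_inf x"
  proof (rule fixpoint_le_val_inf[OF val_inf_fixpoint _ True])
    fix y assume "y \<in> S"
    then show "\<bar>restrict val_inf S y\<bar> \<le> c"
      using order_trans[OF val_inf_le c(3), of y] usc_rewardD(2)[OF usc_reward_val_inf, of y] by simp
  qed
  with True have "(1 - c) * val_inf x \<le> 0" by (simp add: algebra_simps)
  with c(2) usc_rewardD(2)[OF usc_reward_val_inf, of x] show ?thesis
    by (auto simp: mult_le_0_iff)
qed (rule usc_rewardD(4)[OF usc_reward_val_inf])

section \<open>The value iterates bound the probability of remaining safe\<close>

text \<open>The expectation of \<open>val (n - k) x\<^sub>k\<close> on the event of safety up to time \<open>k\<close> does not increase with
\<open>k\<close>, since the control at time \<open>k\<close> is feasible and the Bellman operator takes the best one. It is at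
most \<open>val n x\<close> for \<open>k = 0\<close> and equals the probability of safety for \<open>k = n\<close>.\<close>

lemma prob_safe_le_val:
  assumes \<pi>: "\<pi> \<in> policies D" and x: "x \<in> states D"
  shows "measure (path_law D \<pi> x) (safe D (enat n) S) \<le> val n x"
proof -
  define P where "P = path_law D \<pi> x"
  have P: "is_path_law D \<pi> x P" unfolding P_def by (rule is_path_law_path_law[OF \<pi> x])
  note sP = is_path_lawD(2)[OF P]
  interpret prob_space P by (rule is_path_lawD(1)[OF P])
  have spP: "space P = space (path_M D)" by (rule sets_eq_imp_space_eq[OF sP])
  have feas: "AE \<omega> in P. \<omega> k \<in> feasible D" for k
  proof (rule AE_path_law_action[OF \<pi> P feasible_sets])
    fix h assume h: "h \<in> space (hist_M D k)"
    then have hX: "snd h \<in> states D" by (auto simp: hist_M_def space_pair_measure)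
    have \<pi>k: "\<pi> k \<in> universal_completion (hist_M D k) \<rightarrow>\<^sub>M prob_algebra CM"
      and 1: "emeasure (completion (\<pi> k h)) (feasible_at D (snd h)) = 1"
      using \<pi> h by (auto simp: policies_def)
    have "sets (\<pi> k h) = sets CM"
      using measurable_space[OF \<pi>k, of h] h by (simp add: space_prob_algebra space_universal_completion)
    with 1 feasible_at_sets[OF hX] show "emeasure (\<pi> k h) {u \<in> space CM. (snd h, u) \<in> feasible D} = 1"
      by (simp add: feasible_at_def)
  qed
  define E where "E k = (\<integral>\<^sup>+\<omega>. indicator (safe D (enat k) S) \<omega> * ennreal (val (n - k) (fst (\<omega> k))) \<partial>P)" for k
  have step: "E (Suc k) \<le> E k" if k: "k < n" for k
  proof -
    define m where "m = n - Suc k"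
    have nk: "n - k = Suc m" using k by (simp add: m_def)
    let ?M = "hist_M D k \<Otimes>\<^sub>M CM"
    \<comment> \<open>Safety up to time k as an event of the history and the control at time k.\<close>
    define A where "A = {z \<in> space ?M. (\<forall>i<k. fst (fst (fst z) i) \<in> S) \<and> snd (fst z) \<in> S}"
    have A_eq: "A = ((\<lambda>z. snd (fst z)) -` S \<inter> space ?M) \<inter>
        (\<Inter>i. if i < k then (\<lambda>z. fst (fst (fst z) i)) -` S \<inter> space ?M else space ?M)"
      unfolding A_def by (auto split: if_splits)
    have "(\<lambda>z. fst (fst (fst z) i)) \<in> hist_M D k \<Otimes>\<^sub>M CM \<rightarrow>\<^sub>M SM" if "i < k" for i
    proof -
      have "(\<lambda>r. r i) \<in> PiM {..<k} (\<lambda>_. SM \<Otimes>\<^sub>M CM) \<rightarrow>\<^sub>M SM \<Otimes>\<^sub>M CM"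
        using that by (intro measurable_component_singleton) simp
      then have "(\<lambda>r. fst (r i)) \<in> PiM {..<k} (\<lambda>_. SM \<Otimes>\<^sub>M CM) \<rightarrow>\<^sub>M SM"
        by (rule measurable_compose[OF _ measurable_fst])
      then show ?thesis
        unfolding hist_M_def by (rule measurable_compose[rotated]) simp
    qed
    moreover have "(\<lambda>z. snd (fst z)) \<in> hist_M D k \<Otimes>\<^sub>M CM \<rightarrow>\<^sub>M SM"
      unfolding hist_M_def by simp
    ultimately have A: "A \<in> sets (hist_M D k \<Otimes>\<^sub>M CM)"
      unfolding A_eq using measurable_sets[OF _ S_sets]
      by (intro sets.Int[OF _ sets.countable_INT]) auto
    have safeA: "indicator (safe D (enat k) S) \<omega> = (indicator A (hist k \<omega>, snd (\<omega> k)) :: ennreal)"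
      if \<omega>: "\<omega> \<in> space P" for \<omega>
    proof -
      have "(hist k \<omega>, snd (\<omega> k)) \<in> space ?M"
        using measurable_space[OF measurable_hist_ctrl] \<omega> spP by simp
      then have "(hist k \<omega>, snd (\<omega> k)) \<in> A \<longleftrightarrow> (\<forall>i<k. fst (\<omega> i) \<in> S) \<and> fst (\<omega> k) \<in> S"
        by (simp add: A_def hist_def)
      also have "\<dots> \<longleftrightarrow> \<omega> \<in> safe D (enat k) S"
        using \<omega> spP by (auto simp: safe_def le_less)
      finally show ?thesis by (simp add: indicator_def)
    qed
    have "E (Suc k) \<le> (\<integral>\<^sup>+\<omega>. indicator (safe D (enat k) S) \<omega> * ennreal (val m (fst (\<omega> (Suc k)))) \<partial>P)"
      unfolding E_def m_def[symmetric]
      by (intro nn_integral_mono mult_right_mono) (auto simp: safe_def indicator_def)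
    also have "\<dots> = (\<integral>\<^sup>+\<omega>. indicator A (hist k \<omega>, snd (\<omega> k)) * ennreal (val m (fst (\<omega> (Suc k)))) \<partial>P)"
      by (rule nn_integral_cong) (simp add: safeA)
    also have "\<dots> = (\<integral>\<^sup>+\<omega>. indicator A (hist k \<omega>, snd (\<omega> k)) * (\<integral>\<^sup>+y. ennreal (val m y) \<partial>T (\<omega> k)) \<partial>P)"
      using usc_rewardD(5)[OF usc_reward_val] by (intro nn_integral_next_state[OF P A]) simp
    also have "\<dots> \<le> (\<integral>\<^sup>+\<omega>. indicator (safe D (enat k) S) \<omega> * ennreal (val (Suc m) (fst (\<omega> k))) \<partial>P)"
    proof (rule nn_integral_mono_AE, rule AE_mp[OF feas[of k]], intro AE_I2 impI)
      fix \<omega> assume \<omega>: "\<omega> \<in> space P" and f: "\<omega> k \<in> feasible D"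
      show "indicator A (hist k \<omega>, snd (\<omega> k)) * (\<integral>\<^sup>+y. ennreal (val m y) \<partial>T (\<omega> k))
          \<le> indicator (safe D (enat k) S) \<omega> * ennreal (val (Suc m) (fst (\<omega> k)))"
      proof (cases "\<omega> \<in> safe D (enat k) S")
        case True
        then have xS: "fst (\<omega> k) \<in> S" by (auto simp: safe_def)
        then have xX: "fst (\<omega> k) \<in> states D" using S_subset by blast
        have u: "snd (\<omega> k) \<in> feasible_at D (fst (\<omega> k))"
          using f feasible_subset by (auto simp: feasible_at_def)
        have "(\<integral>\<^sup>+y. ennreal (val m y) \<partial>T (\<omega> k)) = ennreal (\<integral>y. val m y \<partial>T (\<omega> k))"
          using usc_reward_integral(1)[OF usc_reward_val xX u, of m] usc_rewardD(2)[OF usc_reward_val[of m]]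
          by (intro nn_integral_eq_integral) auto
        also have "\<dots> \<le> ennreal (val (Suc m) (fst (\<omega> k)))"
          unfolding val_Suc using bellman_upper[OF usc_reward_val xS u, of m] by (intro ennreal_leI) simp
        finally show ?thesis unfolding safeA[OF \<omega>, symmetric] using True by simp
      qed (simp add: safeA[OF \<omega>, symmetric])
    qed
    also have "\<dots> = E k" unfolding E_def nk ..
    finally show ?thesis .
  qed
  have "E k \<le> E 0" if "k \<le> n" for k
    using that
  proof (induction k)
    case (Suc k)
    then show ?case using step[of k] by (auto intro: order_trans)
  qed simp
  then have "E n \<le> E 0" by simp
  also have "E 0 \<le> (\<integral>\<^sup>+\<omega>. ennreal (val n x) \<partial>P)"
    unfolding E_def
  proof (rule nn_integral_mono_AE, rule AE_mp[OF is_path_lawD(3)[OF P]], intro AE_I2 impI)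
    fix \<omega> :: "nat \<Rightarrow> 'x \<times> 'u" assume "fst (\<omega> 0) = x"
    then show "indicator (safe D (enat 0) S) \<omega> * ennreal (val (n - 0) (fst (\<omega> 0))) \<le> ennreal (val n x)"
      by (simp add: indicator_def)
  qed
  also have "\<dots> = ennreal (val n x)" by (simp add: emeasure_space_1)
  also have "E n = emeasure P (safe D (enat n) S)"
  proof -
    have "E n = (\<integral>\<^sup>+\<omega>. indicator (safe D (enat n) S) \<omega> \<partial>P)"
      unfolding E_def by (rule nn_integral_cong) (auto simp: val_0 safe_def indicator_def)
    then show ?thesis using safe_sets[OF S_sets, of "enat n"] sP by simp
  qed
  finally show ?thesis
    unfolding P_def[symmetric] emeasure_eq_measure
    using usc_rewardD(2)[OF usc_reward_val] by (simp add: ennreal_le_iff)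
qed

section \<open>Trapping states and a policy that never leaves them\<close>

text \<open>This set is a projection along the compact factor \<open>U\<close>, which is the form of measurability that the
selection theorem needs.\<close>

lemma section_hits_closed_sets:
  assumes J: "closedin (prod_topology X U) J" and C: "closedin U C"
  shows "{x \<in> states D. {u \<in> topspace U. (x, u) \<in> J} \<inter> C \<noteq> {}} \<in> sets SM"
proof -
  have "closedin (prod_topology X U) (J \<inter> (states D \<times> C))"
    using J C by (intro closedin_Int) (simp_all add: closedin_prod_Times_iff)
  then have "closedin X (fst ` (J \<inter> (states D \<times> C)))"
    using closed_map_fst[OF U_compact, of X] by (simp add: closed_map_def)
  moreover have "fst ` (J \<inter> (states D \<times> C)) = {x \<in> states D. {u \<in> topspace U. (x, u) \<in> J} \<inter> C \<noteq> {}}"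
    using closedin_subset[OF C] by (force simp: image_iff)
  ultimately show ?thesis using closedin_sets_borel_of by simp
qed

text \<open>The states from which some policy remains safe forever with probability one, expressed by the value iterates.\<close>

definition trap :: "'x set" where "trap = {x \<in> states D. 1 \<le> val_inf x}"

lemma trap_sets: "trap \<in> sets SM"
  unfolding trap_def
  by (rule closedin_sets_borel_of[OF usc_onD[OF usc_rewardD(1)[OF usc_reward_val_inf]]])

lemma trap_subset: "trap \<subseteq> S"
  using usc_rewardD(4)[OF usc_reward_val_inf] by (force simp: trap_def)

text \<open>A function with values in \<open>[0,1]\<close> and integral \<open>1\<close> is \<open>1\<close> almost everywhere.\<close>

lemma trap_prob_1:
  assumes xu: "x \<in> states D" "u \<in> feasible_at D x" and 1: "1 \<le> (\<integral>y. val_inf y \<partial>T (x, u))"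
  shows "emeasure (T (x, u)) trap = 1"
proof -
  interpret prob_space "T (x, u)" by (rule feasible_atD(2)[OF xu])
  note i = usc_reward_integral(1)[OF usc_reward_val_inf xu]
  have "(\<integral>y. 1 - val_inf y \<partial>T (x, u)) = 0"
    using 1 usc_reward_integral(3)[OF usc_reward_val_inf xu] i by (simp add: prob_space)
  moreover have "integrable (T (x, u)) (\<lambda>y. 1 - val_inf y)" using i by simp
  ultimately have "AE y in T (x, u). 1 - val_inf y = 0"
    using usc_rewardD(3)[OF usc_reward_val_inf]
    by (subst (asm) integral_nonneg_eq_0_iff_AE) auto
  then have "AE y in T (x, u). y \<in> trap"
    by (rule AE_mp) (use feasible_atD(4)[OF xu] in \<open>auto simp: trap_def\<close>)
  then show ?thesis
    using AE_in_set_eq_1[of trap] trap_sets feasible_atD(3)[OF xu] by (simp add: emeasure_eq_measure)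
qed

text \<open>At a state of the trap, a control attaining \<open>bellman val_inf x = val_inf x = 1\<close> keeps the next state in
the trap. Elsewhere any feasible control will do; both cases are served by one measurable selection.\<close>

lemma trapping_selector:
  obtains f where "f \<in> SM \<rightarrow>\<^sub>M CM" "\<And>x. x \<in> states D \<Longrightarrow> f x \<in> feasible_at D x"
    "\<And>x. x \<in> trap \<Longrightarrow> emeasure (T (x, f x)) trap = 1"
proof -
  let ?J = "{z \<in> topspace (subtopology (prod_topology X U) (feasible D)). 1 \<le> (\<integral>y. val_inf y \<partial>T z)}"
  have J: "closedin (prod_topology X U) ?J"
    by (rule closedin_trans_full[OF usc_onD[OF usc_reward_usc_integral[OF usc_reward_val_inf]] K_closed])
  let ?JX = "\<lambda>x. {u \<in> topspace U. (x, u) \<in> ?J}"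
  have JX: "?JX x = {u \<in> feasible_at D x. 1 \<le> (\<integral>y. val_inf y \<partial>T (x, u))}" if "x \<in> states D" for x
    using that by (auto simp: feasible_at_def)
  define \<Psi> where "\<Psi> x = (if x \<in> trap then ?JX x else {u \<in> topspace U. (x, u) \<in> feasible D})" for x
  have "t1_space U"
    using Hausdorff_imp_t1_space[OF metrizable_imp_Hausdorff_space[OF borel_space_metrizable[OF ctrl_borel]]] .
  show ?thesis
  proof (rule measurable_selection[OF U_compact borel_space_second_countable[OF ctrl_borel] \<open>t1_space U\<close>, of SM \<Psi>])
    fix x assume "x \<in> space SM"
    then have x: "x \<in> states D" by simp
    show "closedin U (\<Psi> x)"
      unfolding \<Psi>_def using compact_section(1)[OF U_compact J x] compact_section(1)[OF U_compact K_closed x]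
      by simp
    show "\<Psi> x \<noteq> {}"
    proof (cases "x \<in> trap")
      case True
      then have xS: "x \<in> S" using trap_subset by blast
      obtain u where "u \<in> feasible_at D x" "bellman val_inf x = (\<integral>y. val_inf y \<partial>T (x, u))"
        by (rule bellman_attained[OF usc_reward_val_inf xS])
      then have "u \<in> \<Psi> x"
        using True unfolding \<Psi>_def JX[OF x] bellman_val_inf by (simp add: trap_def)
      then show ?thesis by blast
    qed (use feasible_at_nonempty[OF x] in \<open>simp add: \<Psi>_def feasible_at_def\<close>)
  next
    fix C assume C: "closedin U C"
    have "{x \<in> space SM. \<Psi> x \<inter> C \<noteq> {}} = (trap \<inter> {x \<in> states D. ?JX x \<inter> C \<noteq> {}}) \<union>
        ({x \<in> states D. {u \<in> topspace U. (x, u) \<in> feasible D} \<inter> C \<noteq> {}} - trap)"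
      by (auto simp: \<Psi>_def)
    also have "\<dots> \<in> sets SM"
      by (intro sets.Un sets.Int sets.Diff trap_sets section_hits_closed_sets J K_closed C)
    finally show "{x \<in> space SM. \<Psi> x \<inter> C \<noteq> {}} \<in> sets SM" .
  next
    fix f assume f: "f \<in> SM \<rightarrow>\<^sub>M CM" and f\<Psi>: "\<And>x. x \<in> space SM \<Longrightarrow> f x \<in> \<Psi> x"
    have feas: "f x \<in> feasible_at D x" if "x \<in> states D" for x
      using f\<Psi>[of x] that JX[OF that] by (auto simp: \<Psi>_def feasible_at_def split: if_splits)
    show thesis
    proof (rule that[OF f feas])
      fix x assume x: "x \<in> trap"
      then have xX: "x \<in> states D" by (simp add: trap_def)
      have "1 \<le> (\<integral>y. val_inf y \<partial>T (x, f x))"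
        using f\<Psi>[of x] x xX JX[OF xX] by (simp add: \<Psi>_def)
      then show "emeasure (T (x, f x)) trap = 1" by (rule trap_prob_1[OF xX feas[OF xX]])
    qed
  qed
qed

lemma policies_nonempty: "policies D \<noteq> {}"
proof -
  obtain f where "f \<in> SM \<rightarrow>\<^sub>M CM" "\<And>x. x \<in> states D \<Longrightarrow> f x \<in> feasible_at D x"
    by (rule trapping_selector) (rule that; assumption)
  from deterministic_stationary_policy[OF this feasible_at_sets] show ?thesis by blast
qed

text \<open>Under the stationary policy of the trapping selector, the state remains in the trap almost surely at
each step, hence almost surely forever.\<close>

lemma max_prob_trap:
  assumes x: "x \<in> trap" shows "max_prob D x (safe D \<infinity> S) = 1"
proof -
  have xX: "x \<in> states D" using x by (simp add: trap_def)
  obtain f where f: "f \<in> SM \<rightarrow>\<^sub>M CM" "\<And>x. x \<in> states D \<Longrightarrow> f x \<in> feasible_at D x"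
    and ft: "\<And>x. x \<in> trap \<Longrightarrow> emeasure (T (x, f x)) trap = 1"
    by (rule trapping_selector) (rule that; assumption)
  define \<pi> where "\<pi> = (\<lambda>(n::nat) (h :: (nat \<Rightarrow> 'x \<times> 'u) \<times> 'x). return CM (f (snd h)))"
  have \<pi>: "\<pi> \<in> policies D"
    unfolding \<pi>_def by (rule deterministic_stationary_policy[OF f feasible_at_sets])
  define P where "P = path_law D \<pi> x"
  have P: "is_path_law D \<pi> x P" unfolding P_def by (rule is_path_law_path_law[OF \<pi> xX])
  note sP = is_path_lawD(2)[OF P]
  note mP = measurable_cong_sets[OF sP refl]
  interpret prob_space P by (rule is_path_lawD(1)[OF P])
  have spP: "space P = space (path_M D)" by (rule sets_eq_imp_space_eq[OF sP])
  let ?N = "SM \<Otimes>\<^sub>M CM"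
  \<comment> \<open>The policy prescribes actions in Z: from the trap they lead back into the trap.\<close>
  define Z where "Z = {z \<in> space ?N. fst z \<in> trap \<longrightarrow> emeasure (T z) trap = 1}"
  have Z: "Z \<in> sets ?N"
  proof -
    have m: "(\<lambda>z. emeasure (T z) trap) \<in> borel_measurable ?N"
      by (rule measurable_compose[OF measurable_prob_algebraD[OF trans_kernel_measurable]
            measurable_emeasure_subprob_algebra[OF trap_sets]])
    have "Z = (space ?N - fst -` trap \<inter> space ?N) \<union> ((\<lambda>z. emeasure (T z) trap) -` {1} \<inter> space ?N)"
      by (auto simp: Z_def)
    also have "\<dots> \<in> sets ?N"
      using measurable_sets[OF measurable_fst trap_sets] measurable_sets[OF m, of "{1}"] by auto
    finally show ?thesis .
  qed
  have act: "AE \<omega> in P. \<omega> n \<in> Z" for n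
  proof (rule AE_path_law_action[OF \<pi> P Z])
    fix h assume "h \<in> space (hist_M D n)"
    then have h: "snd h \<in> states D" by (auto simp: hist_M_def space_pair_measure)
    have fh: "f (snd h) \<in> space CM" using f(2)[OF h] by (simp add: feasible_at_def)
    have "{u \<in> space CM. (snd h, u) \<in> Z} = Pair (snd h) -` Z \<inter> space CM" by auto
    moreover have "Pair (snd h) -` Z \<inter> space CM \<in> sets CM"
      using h by (intro measurable_sets[OF measurable_Pair1' Z]) simp
    moreover have "(snd h, f (snd h)) \<in> Z" using h fh ft by (simp add: Z_def space_pair_measure)
    ultimately show "emeasure (\<pi> n h) {u \<in> space CM. (snd h, u) \<in> Z} = 1"
      using fh by (simp add: \<pi>_def)
  qed
  have AEt: "AE \<omega> in P. fst (\<omega> n) \<in> trap" for n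
  proof (induction n)
    case 0
    show ?case using is_path_lawD(3)[OF P] by (rule AE_mp) (simp add: x)
  next
    case (Suc n)
    let ?g = "indicator (states D - trap) :: 'x \<Rightarrow> ennreal"
    \<comment> \<open>Conditioning on the pair at time n, the next state leaves the trap with probability 0.\<close>
    have g: "?g \<in> borel_measurable SM" using sets.compl_sets[OF trap_sets] by simp
    have "(\<integral>\<^sup>+\<omega>. ?g (fst (\<omega> (Suc n))) \<partial>P) =
        (\<integral>\<^sup>+\<omega>. indicator (space (hist_M D n \<Otimes>\<^sub>M CM)) (hist n \<omega>, snd (\<omega> n)) * ?g (fst (\<omega> (Suc n))) \<partial>P)"
      using measurable_space[OF measurable_hist_ctrl] spP by (intro nn_integral_cong) simp
    also have "\<dots> = (\<integral>\<^sup>+\<omega>. indicator (space (hist_M D n \<Otimes>\<^sub>M CM)) (hist n \<omega>, snd (\<omega> n)) * (\<integral>\<^sup>+y. ?g y \<partial>T (\<omega> n)) \<partial>P)"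
      by (rule nn_integral_next_state[OF P sets.top g])
    also have "\<dots> = (\<integral>\<^sup>+\<omega>. 0 \<partial>P)"
    proof (rule nn_integral_cong_AE)
      have "AE \<omega> in P. fst (\<omega> n) \<in> trap \<and> \<omega> n \<in> Z" using Suc act[of n] by (rule AE_conjI)
      then show "AE \<omega> in P. indicator (space (hist_M D n \<Otimes>\<^sub>M CM)) (hist n \<omega>, snd (\<omega> n)) * (\<integral>\<^sup>+y. ?g y \<partial>T (\<omega> n)) = 0"
      proof (rule AE_mp, intro AE_I2 impI)
        fix \<omega> assume "fst (\<omega> n) \<in> trap \<and> \<omega> n \<in> Z"
        then have 1: "emeasure (T (\<omega> n)) trap = 1" and \<omega>: "\<omega> n \<in> space ?N" by (auto simp: Z_def)
        have TP: "prob_space (T (\<omega> n))" and sT: "sets (T (\<omega> n)) = sets SM"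
          using measurable_space[OF trans_kernel_measurable \<omega>] by (simp_all add: space_prob_algebra)
        have "space (T (\<omega> n)) = states D" using sets_eq_imp_space_eq[OF sT] by simp
        moreover have "emeasure (T (\<omega> n)) (space (T (\<omega> n)) - trap) = 0"
          using 1 prob_space.emeasure_space_1[OF TP] trap_sets sT
          by (subst emeasure_compl) auto
        moreover have "states D - trap \<in> sets (T (\<omega> n))"
          using sets.compl_sets[OF trap_sets] sT by simp
        ultimately show "indicator (space (hist_M D n \<Otimes>\<^sub>M CM)) (hist n \<omega>, snd (\<omega> n)) * (\<integral>\<^sup>+y. ?g y \<partial>T (\<omega> n)) = 0"
          by simp
      qed
    qed
    finally have 0: "(\<integral>\<^sup>+\<omega>. ?g (fst (\<omega> (Suc n))) \<partial>P) = 0" by simp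
    have "(\<lambda>\<omega>. ?g (fst (\<omega> (Suc n)))) \<in> borel_measurable P"
      unfolding mP by (rule measurable_compose[OF measurable_fst_component g])
    with 0 have "AE \<omega> in P. ?g (fst (\<omega> (Suc n))) = 0" by (simp add: nn_integral_0_iff_AE)
    then show ?case
    proof (rule AE_mp, intro AE_I2 impI)
      fix \<omega> assume \<omega>: "\<omega> \<in> space P" and "?g (fst (\<omega> (Suc n))) = 0"
      moreover have "fst (\<omega> (Suc n)) \<in> states D"
        using measurable_space[OF measurable_fst_component, of \<omega>] \<omega> spP by simp
      ultimately show "fst (\<omega> (Suc n)) \<in> trap" by (auto simp: indicator_def split: if_splits)
    qed
  qed
  have "AE \<omega> in P. \<forall>n. fst (\<omega> n) \<in> trap" using AEt by (simp add: AE_all_countable)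
  then have "AE \<omega> in P. \<omega> \<in> safe D \<infinity> S"
  proof (rule AE_mp, intro AE_I2 impI)
    fix \<omega> assume "\<omega> \<in> space P" "\<forall>n. fst (\<omega> n) \<in> trap"
    then show "\<omega> \<in> safe D \<infinity> S" using trap_subset spP by (auto simp: safe_def)
  qed
  then have "measure P (safe D \<infinity> S) = 1"
    using AE_in_set_eq_1[of "safe D \<infinity> S"] safe_sets[OF S_sets] sP by simp
  then have "1 \<le> max_prob D x (safe D \<infinity> S)"
    using max_prob_upper[OF \<pi> xX, of "safe D \<infinity> S"] by (simp add: P_def)
  with max_prob_le_1[OF policies_nonempty xX] show ?thesis by (intro antisym)
qed

section \<open>The four conditions and the trap\<close>

lemma max_prob_safe_antimono:
  assumes "m \<le> n" "x \<in> states D"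
  shows "max_prob D x (safe D n S) \<le> max_prob D x (safe D m S)"
proof (rule max_prob_least[OF policies_nonempty])
  fix \<pi> assume \<pi>: "\<pi> \<in> policies D"
  interpret prob_space "path_law D \<pi> x" by (rule prob_space_path_law(1)[OF \<pi> assms(2)])
  have "safe D n S \<subseteq> safe D m S" using assms(1) by (auto simp: safe_def intro: order_trans)
  then have "measure (path_law D \<pi> x) (safe D n S) \<le> measure (path_law D \<pi> x) (safe D m S)"
    using safe_sets[OF S_sets] prob_space_path_law(2)[OF \<pi> assms(2)] by (intro finite_measure_mono) auto
  also have "\<dots> \<le> max_prob D x (safe D m S)" by (rule max_prob_upper[OF \<pi> assms(2)])
  finally show "measure (path_law D \<pi> x) (safe D n S) \<le> max_prob D x (safe D m S)" .
qed

lemma max_prob_safe_le_val: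
  assumes "x \<in> states D" shows "max_prob D x (safe D (enat n) S) \<le> val n x"
  using prob_safe_le_val[OF _ assms] by (rule max_prob_least[OF policies_nonempty])

lemma max_prob_nonneg:
  assumes "x \<in> states D" shows "0 \<le> max_prob D x A"
proof -
  obtain \<pi> where "\<pi> \<in> policies D" using policies_nonempty by blast
  from max_prob_upper[OF this assms, of A] measure_nonneg[of "path_law D \<pi> x" A] show ?thesis by linarith
qed

lemma safe_index_finite_iff: "safe_index D S < \<infinity> \<longleftrightarrow> (\<exists>n. safe_bound D n S < 1)"
proof
  assume fin: "safe_index D S < \<infinity>"
  show "\<exists>n. safe_bound D n S < 1"
  proof (rule ccontr)
    assume "\<nexists>n. safe_bound D n S < 1"
    then have "safe_index D S = Inf {}" unfolding safe_index_def by simp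
    with fin show False by (simp add: top_enat_def)
  qed
next
  assume "\<exists>n. safe_bound D n S < 1"
  then obtain n where "safe_bound D n S < 1" ..
  then have "safe_index D S \<le> enat n" unfolding safe_index_def by (intro Inf_lower) blast
  then show "safe_index D S < \<infinity>" by (rule order_le_less_trans) simp
qed

lemma safe_bound_least:
  assumes "\<And>x. x \<in> states D \<Longrightarrow> max_prob D x (safe D (enat n) S) \<le> c"
  shows "safe_bound D n S \<le> c"
  unfolding safe_bound_def using states_nonempty assms by (rule cSUP_least)

lemma max_prob_le_safe_bound:
  assumes "x \<in> states D" shows "max_prob D x (safe D (enat n) S) \<le> safe_bound D n S"
  unfolding safe_bound_def using assms max_prob_le_1[OF policies_nonempty]
  by (intro cSUP_upper bdd_aboveI[of _ 1]) auto

lemma trap_empty_iff: "trap = {} \<longleftrightarrow> (\<forall>x. val_inf x < 1)"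
proof -
  have "val_inf x < 1" if "x \<notin> states D" for x
  proof -
    have "x \<notin> S" using that S_subset by blast
    then show ?thesis using usc_rewardD(4)[OF usc_reward_val_inf] by simp
  qed
  then show ?thesis unfolding trap_def by (auto simp: not_le)
qed

text \<open>The functions \<open>val_inf\<close> and \<open>0\<close> are both fixpoints. They differ if the trap is nonempty; otherwise
\<open>val_inf\<close> vanishes and with it every bounded fixpoint.\<close>

lemma unique_fixpoint_iff:
  "(\<exists>!f. f \<in> bounded_usa X S \<and> safe_op D S f = f) \<longleftrightarrow> trap = {}"
proof
  assume u: "\<exists>!f. f \<in> bounded_usa X S \<and> safe_op D S f = f"
  have eq: "restrict val_inf S = restrict (\<lambda>_. 0) S"
    using u restrict_bounded_usa[OF usc_reward_val_inf] val_inf_fixpoint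
      restrict_bounded_usa[OF usc_reward_zero] zero_fixpoint by blast
  have "val_inf x < 1" for x
    using fun_cong[OF eq, of x] usc_rewardD(4)[OF usc_reward_val_inf, of x] by (cases "x \<in> S") auto
  then show "trap = {}" by (simp add: trap_empty_iff)
next
  assume "trap = {}"
  then have w: "val_inf x = 0" for x using val_inf_zero by (simp add: trap_empty_iff)
  show "\<exists>!f. f \<in> bounded_usa X S \<and> safe_op D S f = f"
  proof (rule ex1I[of _ "restrict (\<lambda>_. 0) S"])
    show "restrict (\<lambda>_. 0) S \<in> bounded_usa X S \<and> safe_op D S (restrict (\<lambda>_. 0) S) = restrict (\<lambda>_. 0) S"
      using restrict_bounded_usa[OF usc_reward_zero] zero_fixpoint ..
    fix f assume f: "f \<in> bounded_usa X S \<and> safe_op D S f = f"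
    then have fext: "f \<in> extensional S" and "bounded (f ` S)" by (auto simp: bounded_usa_def)
    then obtain R where "\<forall>y\<in>f ` S. norm y \<le> R" unfolding bounded_iff by blast
    then have R: "\<And>x. x \<in> S \<Longrightarrow> \<bar>f x\<bar> \<le> R" by simp
    show "f = restrict (\<lambda>_. 0) S"
    proof (rule ext)
      fix x show "f x = restrict (\<lambda>_. 0) S x"
        using fixpoint_le_val_inf[OF conjunct2[OF f] R, of x] w[of x] fext
        by (cases "x \<in> S") (simp_all add: extensional_def)
    qed
  qed
qed

lemma safe_index_finite_iff_trap: "safe_index D S < \<infinity> \<longleftrightarrow> trap = {}"
  unfolding safe_index_finite_iff
proof
  assume "\<exists>n. safe_bound D n S < 1"
  then obtain n where n: "safe_bound D n S < 1" ..
  show "trap = {}"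
  proof (rule equals0I)
    fix x assume x: "x \<in> trap"
    then have xX: "x \<in> states D" by (simp add: trap_def)
    have "1 \<le> max_prob D x (safe D (enat n) S)"
      using max_prob_safe_antimono[OF _ xX, of "enat n" \<infinity>] max_prob_trap[OF x] by simp
    with n max_prob_le_safe_bound[OF xX, of n] show False by simp
  qed
next
  assume "trap = {}"
  then have lt: "val_inf x < 1" for x by (simp add: trap_empty_iff)
  obtain n c where c: "c < 1" "\<And>x. val n x \<le> c"
    by (rule val_uniformly_less_1[OF lt]) (rule that)
  have "safe_bound D n S \<le> c"
    by (rule safe_bound_least) (rule order_trans[OF max_prob_safe_le_val c(2)])
  with c(1) show "\<exists>n. safe_bound D n S < 1" by (intro exI[of _ n]) simp
qed

lemma max_prob_zero_iff_trap:
  "(\<forall>x \<in> states D. max_prob D x (safe D \<infinity> S) = 0) \<longleftrightarrow> trap = {}"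
proof
  assume 0: "\<forall>x \<in> states D. max_prob D x (safe D \<infinity> S) = 0"
  show "trap = {}"
  proof (rule equals0I)
    fix x assume "x \<in> trap"
    with 0 max_prob_trap show False by (force simp: trap_def)
  qed
next
  assume "trap = {}"
  then have w: "val_inf x = 0" for x using val_inf_zero by (simp add: trap_empty_iff)
  show "\<forall>x \<in> states D. max_prob D x (safe D \<infinity> S) = 0"
  proof
    fix x assume x: "x \<in> states D"
    have "max_prob D x (safe D \<infinity> S) \<le> val_inf x"
    proof (rule LIMSEQ_le_const[OF val_tendsto], intro exI allI impI)
      fix n
      show "max_prob D x (safe D \<infinity> S) \<le> val n x"
        using max_prob_safe_antimono[OF _ x, of "enat n" \<infinity>] max_prob_safe_le_val[OF x, of n] by simp
    qed
    with w max_prob_nonneg[OF x] show "max_prob D x (safe D \<infinity> S) = 0" by (intro antisym) simp_all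
  qed
qed

lemma sure_set_inf_empty_iff_trap: "sure_set_inf D S = {} \<longleftrightarrow> trap = {}"
proof
  assume e: "sure_set_inf D S = {}"
  show "trap = {}"
  proof (rule equals0I)
    fix x assume x: "x \<in> trap"
    then have xX: "x \<in> states D" by (simp add: trap_def)
    have "max_prob D x (safe D (enat n) S) = 1" for n
      using max_prob_safe_antimono[OF _ xX, of "enat n" \<infinity>] max_prob_trap[OF x]
        max_prob_le_1[OF policies_nonempty xX] by (intro antisym) simp_all
    then have "x \<in> sure_set_inf D S" using xX by (simp add: sure_set_inf_def sure_set_def)
    with e show False by simp
  qed
next
  assume "trap = {}"
  then have lt: "val_inf x < 1" for x by (simp add: trap_empty_iff)
  obtain n c where c: "c < 1" "\<And>x. val n x \<le> c"
    by (rule val_uniformly_less_1[OF lt]) (rule that)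
  have "sure_set D n S = {}"
  proof (rule equals0I)
    fix x assume "x \<in> sure_set D n S"
    then have "x \<in> states D" "max_prob D x (safe D (enat n) S) = 1" by (simp_all add: sure_set_def)
    with max_prob_safe_le_val[of x n] c(2)[of x] c(1) show False by simp
  qed
  then show "sure_set_inf D S = {}" unfolding sure_set_inf_def by blast
qed

end

theorem theorem5:
  fixes D :: "('x, 'u) cdt_mp" and S :: "'x set"
  assumes "continuous_cdt_mp D"
    and "compactin (state_sp D) S"
  shows "(safe_index D S < \<infinity> \<longleftrightarrow>
            (\<exists>!f. f \<in> bounded_usa (state_sp D) S \<and> safe_op D S f = f)) \<and>
         ((\<exists>!f. f \<in> bounded_usa (state_sp D) S \<and> safe_op D S f = f) \<longleftrightarrow>
            (\<forall>x \<in> states D. max_prob D x (safe D \<infinity> S) = 0)) \<and>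
         ((\<forall>x \<in> states D. max_prob D x (safe D \<infinity> S) = 0) \<longleftrightarrow>
            sure_set_inf D S = {})"
proof -
  interpret compact_safety D S using assms by (rule compact_safety.intro)
  show ?thesis
    unfolding safe_index_finite_iff_trap unique_fixpoint_iff max_prob_zero_iff_trap
      sure_set_inf_empty_iff_trap by simp
qed

end
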